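(* $\operatorname{Aut}\mathbb{E}$ permutes the leaves of the $\beta$-foliation of $\mathbb{E}$ transitively (that is, every automorphism of $\mathbb{E}$ maps each leaf onto a leaf, and the resulting action of $\operatorname{Aut}\mathbb{E}$ on the set of leaves is transitive). Specifically, if $\beta_1,\beta_2\in\mathbb{C}$ with $|\beta_1|+|\beta_2|<1$, $x\in\varphi_{\beta_1\beta_2}(\mathbb{D})$ and $\upsilon,\chi\in\operatorname{Aut}\mathbb{D}$ are given by $$\upsilon(z)=\omega\frac{z-\alpha}{\bar\alpha z-1},\qquad \chi(z)=\zeta\frac{z-\theta}{\bar\theta z-1}\qquad(\omega,\zeta\in\mathbb{T},\ \alpha,\theta\in\mathbb{D}),$$ then $x\cdot\chi\in\varphi_{\gamma_1\gamma_2}(\mathbb{D})$ where $$\gamma_1=\frac{\beta_1(1-|\theta|^2)}{|1-\zeta\theta\beta_2|^2-|\theta\beta_1|^2},\qquad \gamma_2=\frac{\bar\theta(1-|\beta_1|^2+|\beta_2|^2)-\zeta\beta_2-\bar\zeta\bar\theta^2\bar\beta_2}{|1-\zeta\theta\beta_2|^2-|\theta\beta_1|^2},$$ and $\upsilon\cdot x\in\varphi_{\delta_1\delta_2}(\mathbb{D})$ where $$\delta_1=\omega\,\frac{\alpha(1-|\beta_2|^2+|\beta_1|^2)-\beta_1-\alpha^2\bar\beta_1}{|1-\bar\alpha\beta_1|^2-|\alpha\beta_2|^2},\qquad \delta_2=\frac{\beta_2(1-|\alpha|^2)}{|1-\bar\alpha\beta_1|^2-|\alpha\beta_2|^2}.$$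 Moreover, for any $\beta_1,\beta_2\in\mathbb{C}$ such that $|\beta_1|+|\beta_2|<1$, if $\upsilon,\chi\in\operatorname{Aut}\mathbb{D}$ are given by $$\upsilon(z)=\frac{z-\alpha}{\bar\alpha z-1},\qquad \chi(z)=\frac{z-\theta}{\bar\theta z-1}$$ with $$\alpha=\xi_1\tanh\{\tfrac12\tanh^{-1}(|\beta_1|+|\beta_2|)+\tfrac12\tanh^{-1}(|\beta_1|-|\beta_2|)\},$$ $$\theta=\xi_2\tanh\{\tfrac12\tanh^{-1}(|\beta_1|+|\beta_2|)-\tfrac12\tanh^{-1}(|\beta_1|-|\beta_2|)\},$$ where $\beta_1=|\beta_1|\xi_1$, $\bar\beta_2=|\beta_2|\xi_2$ and $\xi_1,\xi_2\in\mathbb{T}$, then $$\upsilon^{-1}\cdot\varphi_{\beta_1\beta_2}(\mathbb{D})\cdot\chi^{-1}=\varphi_{00}(\mathbb{D})=\{(0,0,\lambda):\lambda\in\mathbb{D}\}.$$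
   Context: $\mathbb{D}$ is the open unit disc and $\mathbb{T}$ the unit circle in $\mathbb{C}$. The tetrablock is the domain $$\mathbb{E}=\{(x_1,x_2,x_3)\in\mathbb{C}^3: 1-x_1z-x_2w+x_3zw\neq 0 \text{ for all } z,w\in\mathbb{C} \text{ with } |z|\leq 1,\ |w|\leq 1\},$$ with closure $\overline{\mathbb{E}}$. For a domain $\Omega$, $\operatorname{Aut}\Omega$ is the group of analytic bijective self-maps of $\Omega$ with analytic inverse. For $\beta_1,\beta_2\in\mathbb{C}$ with $|\beta_1|+|\beta_2|<1$ define $\varphi_{\beta_1\beta_2}:\mathbb{D}\to\mathbb{C}^3$ by $$\varphi_{\beta_1\beta_2}(\lambda)=(\beta_1+\bar\beta_2\lambda,\ \beta_2+\bar\beta_1\lambda,\ \lambda).$$ It maps $\mathbb{D}$ into $\mathbb{E}$, and every point of $\mathbb{E}$ lies in exactly one of the discs $\varphi_{\beta_1\beta_2}(\mathbb{D})$, $|\beta_1|+|\beta_2|<1$. The family of these discs is called the $\beta$-foliation of $\mathbb{E}$, and the discs are its leaves. Actions of $\operatorname{Aut}\mathbb{D}$: for $x\in\mathbb{C}^3$ let $\Psi(z,x)=\dfrac{x_3z-x_1}{x_2z-1}$. For $x,y\in\mathbb{C}^3$ with $x_2y_1\neq1$ define $$x\diamond y=\frac{1}{1-x_2y_1}\,(x_1-x_3y_1,\ y_2-x_2y_3,\ x_1y_2-x_3y_3).$$ Each $\upsilon\in\operatorname{Aut}\mathbb{D}$ can be written $\upsilon=\Psi(\cdot,\tau(\upsilon))$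 with $\tau(\upsilon)\in\overline{\mathbb{E}}$; explicitly, if $\upsilon(z)=\omega\dfrac{z-\alpha}{\bar\alpha z-1}$ with $\omega\in\mathbb{T}$, $\alpha\in\mathbb{D}$, then $\tau(\upsilon)=(\omega\alpha,\bar\alpha,\omega)$. For $x\in\mathbb{E}$ and $\upsilon,\chi\in\operatorname{Aut}\mathbb{D}$, $\upsilon\cdot x=\tau(\upsilon)\diamond x$ and $x\cdot\chi=x\diamond\tau(\chi)$; these are commuting left and right actions of $\operatorname{Aut}\mathbb{D}$ on $\mathbb{E}$ by automorphisms of $\mathbb{E}$. For a set $S\subset\mathbb{E}$, $\upsilon\cdot S\cdot\chi=\{\upsilon\cdot x\cdot\chi:x\in S\}$. *)

theory Defs
  imports "HOL-Complex_Analysis.Complex_Analysis" "HOL-Algebra.Group_Action"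
begin

text \<open>
  Analyticity in several variables: complex Frechet differentiability, i.e. the real derivative of
  \<open>has_derivative\<close> exists and is complex-linear. Only used on open sets.
\<close>
definition analytic_map_on :: "(complex ^ 'n \<Rightarrow> complex ^ 'm) \<Rightarrow> (complex ^ 'n) set \<Rightarrow> bool" where
  "analytic_map_on f S \<longleftrightarrow>
     (\<forall>x\<in>S. \<exists>f'. Vector_Spaces.linear (*s) (*s) f' \<and> (f has_derivative f') (at x within S))"

text \<open>
  The automorphism group of a domain \<open>\<Omega>\<close>, for a given notion \<open>an f \<Omega>\<close> of ``\<open>f\<close> is analytic on \<open>\<Omega>\<close>''.
  Self-maps of \<open>\<Omega>\<close> are represented, as in \<^const>\<open>BijGroup\<close>, by functions on the ambient space that are
  \<^const>\<open>undefined\<close> outside \<open>\<Omega>\<close>, so that equal maps of \<open>\<Omega>\<close> are equal group elements.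
\<close>
definition Aut_group :: "(('a \<Rightarrow> 'a) \<Rightarrow> 'a set \<Rightarrow> bool) \<Rightarrow> 'a set \<Rightarrow> ('a \<Rightarrow> 'a) monoid" where
  "Aut_group an \<Omega> =
     (BijGroup \<Omega>)\<lparr>carrier := {f \<in> Bij \<Omega>. an f \<Omega> \<and> an (inv_into \<Omega> f) \<Omega>}\<rparr>"

abbreviation unit_disc :: "complex set" (\<open>\<D>\<close>) where
  "\<D> \<equiv> ball 0 1"

definition tetrablock :: "(complex ^ 3) set" (\<open>\<E>\<close>) where
  "\<E> = {x. \<forall>z w. norm z \<le> 1 \<longrightarrow> norm w \<le> 1 \<longrightarrow> 1 - x$1 * z - x$2 * w + x$3 * z * w \<noteq> 0}"

definition Aut_disc :: "(complex \<Rightarrow> complex) monoid" where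
  "Aut_disc = Aut_group (\<lambda>f S. f holomorphic_on S) \<D>"

definition Aut_tetrablock :: "(complex ^ 3 \<Rightarrow> complex ^ 3) monoid" where
  "Aut_tetrablock = Aut_group analytic_map_on \<E>"

definition beta_disc :: "complex \<Rightarrow> complex \<Rightarrow> complex \<Rightarrow> complex ^ 3" (\<open>\<phi>\<close>) where
  "\<phi> \<beta>\<^sub>1 \<beta>\<^sub>2 z = vector [\<beta>\<^sub>1 + cnj \<beta>\<^sub>2 * z, \<beta>\<^sub>2 + cnj \<beta>\<^sub>1 * z, z]"

definition beta_leaves :: "(complex ^ 3) set set" where
  "beta_leaves = {\<phi> \<beta>\<^sub>1 \<beta>\<^sub>2 ` \<D> | \<beta>\<^sub>1 \<beta>\<^sub>2. norm \<beta>\<^sub>1 + norm \<beta>\<^sub>2 < 1}"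

definition Psi :: "complex \<Rightarrow> complex ^ 3 \<Rightarrow> complex" (\<open>\<Psi>\<close>) where
  "\<Psi> z x = (x$3 * z - x$1) / (x$2 * z - 1)"

text \<open>Only meaningful when \<open>x$2 * y$1 \<noteq> 1\<close>.\<close>
definition diamond :: "complex ^ 3 \<Rightarrow> complex ^ 3 \<Rightarrow> complex ^ 3" (infixl \<open>\<diamondop>\<close> 70) where
  "x \<diamondop> y = (1 / (1 - x$2 * y$1)) *s
     vector [x$1 - x$3 * y$1, y$2 - x$2 * y$3, x$1 * y$2 - x$3 * y$3]"

text \<open>
  For \<open>\<upsilon>\<close> in the automorphism group of the disc the description is unambiguous, since a nonconstant
  function \<open>\<Psi> (\<cdot>, t)\<close> determines \<open>t\<close>; if \<open>\<upsilon> z = \<omega> * (z - \<alpha>) / (cnj \<alpha> * z - 1)\<close> then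
  \<open>\<tau> \<upsilon> = (\<omega> * \<alpha>, cnj \<alpha>, \<omega>)\<close>.
\<close>
definition tau :: "(complex \<Rightarrow> complex) \<Rightarrow> complex ^ 3" (\<open>\<tau>\<close>) where
  "\<tau> \<upsilon> = (THE t. t \<in> closure \<E> \<and> (\<forall>z\<in>\<D>. \<upsilon> z = \<Psi> z t))"

definition left_act :: "(complex \<Rightarrow> complex) \<Rightarrow> complex ^ 3 \<Rightarrow> complex ^ 3" where
  "left_act \<upsilon> x = \<tau> \<upsilon> \<diamondop> x"

definition right_act :: "complex ^ 3 \<Rightarrow> (complex \<Rightarrow> complex) \<Rightarrow> complex ^ 3" where
  "right_act x \<eta> = x \<diamondop> \<tau> \<eta>"

definition two_sided_act ::
  "(complex \<Rightarrow> complex) \<Rightarrow> (complex ^ 3) set \<Rightarrow> (complex \<Rightarrow> complex) \<Rightarrow> (complex ^ 3) set" where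
  "two_sided_act \<upsilon> S \<eta> = {right_act (left_act \<upsilon> x) \<eta> | x. x \<in> S}"

end

theory Submission
  imports Defs
begin

text \<open>
  The left action of a disc automorphism is an explicit rational map of \<open>\<E>\<close>, and the right action is
  its conjugate under the exchange of the first two coordinates. Both carry a leaf onto the leaf with
  the stated parameters; this is a computation. Suitable compositions of them carry any given leaf to
  the central leaf \<open>{(0, 0, l)}\<close> and any given point to some \<open>(0, 0, r)\<close> with \<open>0 \<le> r < 1\<close>.
  Transitivity follows, and an arbitrary automorphism can be normalised to an automorphism \<open>f\<close> with
  \<open>f 0 = (0, 0, r)\<close>. It remains to see that \<open>r = 0\<close> and that such an \<open>f\<close> maps the central leaf to itself.

  For this, compare velocities of analytic discs. At the origin these velocities fill the unit ball
  of the norm \<open>N v = max \<bar>v\<^sub>1\<bar> \<bar>v\<^sub>2\<bar> + \<bar>v\<^sub>3\<bar>\<close>: the Schwarz lemma applied to the functions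
  \<open>\<Psi> \<eta>\<close> with \<open>\<bar>\<eta>\<bar> = 1\<close> gives one inclusion, and explicit discs built from the leaves give the other
  (\<open>metric0_le_1\<close>, \<open>analytic_disc_through_0\<close>). Let \<open>B\<close> be the derivative of the inverse of \<open>f\<close> at
  \<open>p = (0, 0, r)\<close>. Every disc through \<open>p\<close> bounds \<open>N\<close> of the image of its velocity from above, and
  every \<open>\<Psi> \<eta>\<close> bounds \<open>N (B v)\<close> from below (\<open>metric_transport\<close>). This has three consequences.

  \<^item> The lower bounds make \<open>N (B v)\<close> grow linearly when \<open>v\<close> leaves the complex line of
    \<open>e\<^sub>3 = (0, 0, 1)\<close> in any transversal direction, starting at \<open>e\<^sub>3\<close>. The only vectors around which \<open>N\<close>
    behaves in this way are the multiples of \<open>e\<^sub>3\<close>, so \<open>B e\<^sub>3\<close> is a multiple of \<open>e\<^sub>3\<close>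
    (\<open>transport_third_axis\<close>).

  \<^item> Suppose that \<open>r > 0\<close>. Discs in a copy of the symmetrized bidisc inside \<open>\<E>\<close> show that in the direction
    \<open>(\<omega>, cnj \<omega>, t)\<close> the function \<open>N (B v)\<close> grows only quadratically in the real variable \<open>t\<close>, while \<open>N\<close> itself depends
    on the modulus of the third coordinate. So the third coordinate of \<open>B (\<omega>, cnj \<omega>, 0)\<close>, divided by that of
    \<open>B e\<^sub>3\<close>, would be a nonzero imaginary number for every unimodular \<open>\<omega>\<close>, which is impossible for a
    combination of \<open>\<omega>\<close> and \<open>cnj \<omega>\<close> (\<open>origin_not_moved_up_leaf\<close>). Hence \<open>r = 0\<close>.

  \<^item> When \<open>r = 0\<close>, the image of the central leaf is a disc through the origin with velocity \<open>b e\<^sub>3\<close>,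
    \<open>\<bar>b\<bar> = 1\<close>. Equality in the Schwarz lemma for all \<open>\<Psi> \<eta>\<close> at once determines that disc
    (\<open>extremal_disc_unique\<close>): it is the central leaf.
\<close>

no_notation fps_nth (infixl \<open>$\<close> 75)

section \<open>The tetrablock as the union of the leaves\<close>

lemma vec3_eq_iff: "x = (y::'a^3) \<longleftrightarrow> x$1 = y$1 \<and> x$2 = y$2 \<and> x$3 = y$3"
  by (simp add: vec_eq_iff forall_3)

lemma of_real_norm_power2: "(complex_of_real (norm z))\<^sup>2 = z * cnj z"
  by (metis complex_norm_square of_real_power)

lemma beta_disc_nth [simp]:
  "\<phi> a b z $ 1 = a + cnj b * z" "\<phi> a b z $ 2 = b + cnj a * z" "\<phi> a b z $ 3 = z"
  by (simp_all add: beta_disc_def)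

definition swap12 :: "complex ^ 3 \<Rightarrow> complex ^ 3" where
  "swap12 x = vector [x$2, x$1, x$3]"

lemma swap12_nth [simp]: "swap12 x $ 1 = x$2" "swap12 x $ 2 = x$1" "swap12 x $ 3 = x$3"
  by (simp_all add: swap12_def)

lemma swap12_swap12 [simp]: "swap12 (swap12 x) = x"
  by (simp add: vec3_eq_iff)

lemma swap12_beta_disc [simp]: "swap12 (\<phi> a b z) = \<phi> b a z"
  by (simp add: vec3_eq_iff)

lemma swap12_in_tetrablock [simp]: "swap12 x \<in> \<E> \<longleftrightarrow> x \<in> \<E>"
proof -
  have "swap12 y \<in> \<E>" if y: "y \<in> \<E>" for y
    unfolding tetrablock_def
  proof (clarsimp)
    fix z w :: complex assume "norm z \<le> 1" "norm w \<le> 1" "1 - y$2 * z - y$1 * w + y$3 * z * w = 0"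
    then show False using y unfolding tetrablock_def
      by (auto dest!: spec[of _ w] spec[of _ z] simp: algebra_simps)
  qed
  then show ?thesis by (metis swap12_swap12)
qed

text \<open>
  For fixed \<open>w\<close> the defining polynomial is affine in \<open>z\<close>, so it has no zero in the closed disc exactly
  when its constant coefficient dominates the other one.
\<close>

lemma tetrablock_norm_less:
  assumes x: "x \<in> \<E>" and w: "norm w \<le> 1"
  shows "norm (x$1 - x$3 * w) < norm (1 - x$2 * w)"
proof (rule ccontr)
  assume neg: "\<not> ?thesis"
  have E: "1 - x$1 * z - x$2 * w + x$3 * z * w \<noteq> 0" if "norm z \<le> 1" for z
    using x that w unfolding tetrablock_def by blast
  have n0: "1 - x$2 * w \<noteq> 0" using E[of 0] by simp
  have n1: "x$1 - x$3 * w \<noteq> 0" using neg n0 by auto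
  define z where "z = (1 - x$2 * w) / (x$1 - x$3 * w)"
  have "norm z \<le> 1" using neg n1 by (simp add: z_def norm_divide)
  moreover have "1 - x$1 * z - x$2 * w + x$3 * z * w = (1 - x$2 * w) - z * (x$1 - x$3 * w)"
    by (simp add: algebra_simps)
  moreover have "z * (x$1 - x$3 * w) = 1 - x$2 * w" using n1 by (simp add: z_def)
  ultimately show False using E[of z] by simp
qed

lemma tetrablock_coord_less:
  assumes "x \<in> \<E>" shows "norm (x$1) < 1" "norm (x$2) < 1"
  using tetrablock_norm_less[of x 0] tetrablock_norm_less[of "swap12 x" 0] assms by simp_all

lemma norm_diff_squares:
  "(norm (1 - b * w))\<^sup>2 - (norm (a - c * w))\<^sup>2
     = 1 - (norm a)\<^sup>2 - 2 * Re (w * (b - cnj a * c)) + (norm w)\<^sup>2 * ((norm b)\<^sup>2 - (norm c)\<^sup>2)"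
  unfolding cmod_power2 by (simp add: power2_eq_square algebra_simps)

text \<open>
  The inequality \<open>tetrablock_norm_less\<close>, squared, for the unimodular \<open>w\<close> that makes the cross term as
  large as possible.
\<close>

lemma tetrablock_gap:
  assumes x: "x \<in> \<E>"
  shows "2 * norm (x$2 - cnj (x$1) * x$3) < 1 - (norm (x$1))\<^sup>2 + (norm (x$2))\<^sup>2 - (norm (x$3))\<^sup>2"
proof -
  define k where "k = x$2 - cnj (x$1) * x$3"
  \<comment> \<open>chosen so that \<open>w * k\<close> is real and nonnegative\<close>
  define w where "w = (if k = 0 then 1 else cnj k / norm k)"
  have w: "norm w = 1" by (simp add: w_def norm_divide)
  have wk: "w * k = norm k"
    by (auto simp: w_def divide_simps complex_norm_square[symmetric] power2_eq_square mult.commute)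
  have "norm (x$1 - x$3 * w) < norm (1 - x$2 * w)"
    by (rule tetrablock_norm_less) (use x w in auto)
  then have "0 < (norm (1 - x$2 * w))\<^sup>2 - (norm (x$1 - x$3 * w))\<^sup>2"
    by (simp add: power_strict_mono)
  then show ?thesis
    unfolding norm_diff_squares k_def[symmetric] wk w by (simp add: k_def)
qed

text \<open>
  The two equations defining \<open>\<phi> a b l\<close> can be solved for \<open>a\<close> and \<open>b\<close> as soon as \<open>\<bar>l\<bar> \<noteq> 1\<close>; this is
  what makes the leaves a foliation.
\<close>

lemma eq_beta_disc:
  assumes "norm (x$3) \<noteq> 1"
  defines "r \<equiv> complex_of_real (1 - (norm (x$3))\<^sup>2)"
  shows "x = \<phi> ((x$1 - cnj (x$2) * x$3) / r) ((x$2 - cnj (x$1) * x$3) / r) (x$3)"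
proof -
  have "1 - (norm (x$3))\<^sup>2 \<noteq> 0" using assms(1) by (simp add: abs_square_eq_1)
  then have r0: "r \<noteq> 0" unfolding r_def by (metis of_real_eq_0_iff)
  have r: "r = 1 - x$3 * cnj (x$3)" by (simp add: r_def of_real_norm_power2)
  have cr: "cnj r = r" by (simp add: r_def)
  have "p = (p - cnj q * x$3) / r + cnj ((q - cnj p * x$3) / r) * x$3" for p q
  proof -
    have "(p - cnj q * x$3) / r + cnj ((q - cnj p * x$3) / r) * x$3
        = (p - cnj q * x$3 + (cnj q - p * cnj (x$3)) * x$3) / r"
      by (simp add: cr add_divide_distrib)
    also have "p - cnj q * x$3 + (cnj q - p * cnj (x$3)) * x$3 = p * r"
      by (simp add: r algebra_simps)
    finally show ?thesis using r0 by simp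
  qed
  then show ?thesis unfolding vec3_eq_iff beta_disc_nth by blast
qed

lemma tetrablock_param:
  assumes x: "x \<in> \<E>"
  obtains a b where "norm a + norm b < 1" "norm (x$3) < 1" "x = \<phi> a b (x$3)"
    "a = (x$1 - cnj (x$2) * x$3) / (1 - (norm (x$3))\<^sup>2)"
    "b = (x$2 - cnj (x$1) * x$3) / (1 - (norm (x$3))\<^sup>2)"
proof -
  define r where "r = 1 - (norm (x$3))\<^sup>2"
  define a where "a = (x$1 - cnj (x$2) * x$3) / r"
  define b where "b = (x$2 - cnj (x$1) * x$3) / r"
  have s: "norm (x$1 - cnj (x$2) * x$3) + norm (x$2 - cnj (x$1) * x$3) < r"
    using tetrablock_gap[OF x] tetrablock_gap[of "swap12 x"] x by (simp add: r_def)
  then have r: "r > 0" using norm_ge_zero by (smt (verit))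
  have 1: "norm (x$3) < 1"
    using r by (simp add: r_def abs_square_less_1)
  have 2: "norm a + norm b < 1"
    using s r by (simp add: a_def b_def norm_divide flip: add_divide_distrib)
  have "x = \<phi> a b (x$3)"
    unfolding a_def b_def r_def by (rule eq_beta_disc) (use r in \<open>auto simp: r_def\<close>)
  then show thesis using that[of a b] 1 2 unfolding a_def b_def r_def by simp
qed

text \<open>
  Here \<open>b (1 - \<bar>l\<bar>\<^sup>2)\<close> is \<open>x\<^sub>2 - cnj x\<^sub>1 x\<^sub>3\<close> for the point \<open>x = \<phi> a b l\<close>, so that the estimate is the
  one of \<open>tetrablock_gap\<close>, now for points on the leaf. It reduces to \<open>\<bar>a\<bar> < 1 - \<bar>b\<bar>\<close>.
\<close>

lemma leaf_gap:
  assumes ab: "norm a + norm b < 1" and l: "norm l < 1"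
  shows "2 * norm (b * complex_of_real (1 - (norm l)\<^sup>2)) < 1 - (norm (a + cnj b * l))\<^sup>2 + (norm (b + cnj a * l))\<^sup>2 - (norm l)\<^sup>2"
proof -
  have r: "1 - (norm l)\<^sup>2 > 0" using l by (simp add: abs_square_less_1)
  have e: "1 - (norm (a + cnj b * l))\<^sup>2 + (norm (b + cnj a * l))\<^sup>2 - (norm l)\<^sup>2
      = (1 - (norm l)\<^sup>2) * (1 - (norm a)\<^sup>2 + (norm b)\<^sup>2)"
    unfolding cmod_power2 by (simp add: power2_eq_square algebra_simps)
  have "(norm a)\<^sup>2 < (1 - norm b)\<^sup>2"
    using ab by (intro power_strict_mono) auto
  then have "2 * norm b < 1 - (norm a)\<^sup>2 + (norm b)\<^sup>2"
    by (simp add: power2_eq_square algebra_simps)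
  then have "(1 - (norm l)\<^sup>2) * (2 * norm b) < (1 - (norm l)\<^sup>2) * (1 - (norm a)\<^sup>2 + (norm b)\<^sup>2)"
    using r by (rule mult_strict_left_mono)
  moreover have "norm (b * complex_of_real (1 - (norm l)\<^sup>2)) = norm b * (1 - (norm l)\<^sup>2)"
    unfolding norm_mult norm_of_real using r by simp
  ultimately show ?thesis unfolding e by (simp add: mult_ac)
qed

text \<open>
  Used to extend an estimate from \<open>\<bar>w\<bar> = 1\<close> to \<open>\<bar>w\<bar> \<le> 1\<close> in the next lemma.
\<close>

lemma leaf_sum_squares:
  assumes ab: "norm a + norm b < 1" and l: "norm l < 1"
  shows "(norm (a + cnj b * l))\<^sup>2 + (norm (b + cnj a * l))\<^sup>2 < 1 + (norm l)\<^sup>2"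
proof -
  define A B t where "A = norm a" "B = norm b" "t = norm l"
  have AB: "A \<ge> 0" "B \<ge> 0" "A + B < 1" "t \<ge> 0" "t < 1" using ab l by (simp_all add: A_B_t_def)
  have "(norm (a + cnj b * l))\<^sup>2 + (norm (b + cnj a * l))\<^sup>2
     = (A\<^sup>2 + B\<^sup>2) * (1 + t\<^sup>2) + 4 * Re (a * b * cnj l)"
    unfolding cmod_power2 A_B_t_def by (simp add: power2_eq_square algebra_simps)
  also have "Re (a * b * cnj l) \<le> A * B * t"
    using complex_Re_le_cmod[of "a * b * cnj l"] by (simp add: norm_mult A_B_t_def)
  also have "(A\<^sup>2 + B\<^sup>2) * (1 + t\<^sup>2) + 4 * (A * B * t) \<le> (A + B)\<^sup>2 * (1 + t\<^sup>2)"
  proof -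
    have "(A + B)\<^sup>2 * (1 + t\<^sup>2) - ((A\<^sup>2 + B\<^sup>2) * (1 + t\<^sup>2) + 4 * (A * B * t)) = 2 * (A * B) * (1 - t)\<^sup>2"
      by (simp add: power2_eq_square algebra_simps)
    also have "\<dots> \<ge> 0" using AB by simp
    finally show ?thesis by simp
  qed
  also have "(A + B)\<^sup>2 * (1 + t\<^sup>2) < 1 * (1 + t\<^sup>2)"
    using AB by (intro mult_strict_right_mono) (auto simp: abs_square_less_1 add_pos_nonneg)
  finally show ?thesis by (simp add: A_B_t_def)
qed

text \<open>
  By \<open>norm_diff_squares\<close>, the difference of the squares of the two coefficients of the defining polynomial is
  bounded below by a quadratic polynomial in \<open>t = \<bar>w\<bar>\<close>. The gap inequality says that this polynomial is
  positive at \<open>t = 1\<close>, and it is positive at \<open>t = 0\<close>; it stays positive in between because of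
  \<open>leaf_sum_squares\<close>.
\<close>

lemma beta_disc_in_tetrablock:
  assumes ab: "norm a + norm b < 1" and l: "norm l < 1"
  shows "\<phi> a b l \<in> \<E>"
proof -
  define x1 where "x1 = a + cnj b * l"
  define x2 where "x2 = b + cnj a * l"
  have less1: "norm (p + cnj q * l) < 1" if "norm p + norm q < 1" for p q
  proof -
    have "norm (p + cnj q * l) \<le> norm p + norm q * norm l"
      by (metis norm_mult norm_triangle_ineq complex_mod_cnj)
    also have "\<dots> \<le> norm p + norm q" using l by (simp add: mult_left_le)
    finally show ?thesis using that by simp
  qed
  have x1: "norm x1 < 1" and x2: "norm x2 < 1"
    using less1[of a b] less1[of b a] ab by (simp_all add: x1_def x2_def)
  define P where "P = (norm x2)\<^sup>2 - (norm l)\<^sup>2"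
  have k: "x2 - cnj x1 * l = b * complex_of_real (1 - (norm l)\<^sup>2)"
    by (simp add: x1_def x2_def of_real_norm_power2 algebra_simps)
  have gap: "2 * norm (x2 - cnj x1 * l) < 1 - (norm x1)\<^sup>2 + P"
    using leaf_gap[OF ab l] by (simp add: k) (simp add: x1_def x2_def P_def)
  have P: "P \<le> 1 - (norm x1)\<^sup>2"
    using leaf_sum_squares[OF ab l] by (simp add: P_def x1_def x2_def)
  have main: "norm (x1 - l * w) < norm (1 - x2 * w)" if w: "norm w \<le> 1" for w
  proof -
    define t where "t = norm w"
    define k where "k = norm (x2 - cnj x1 * l)"
    have t: "0 \<le> t" "t \<le> 1" using w by (simp_all add: t_def)
    have x1': "0 < 1 - (norm x1)\<^sup>2" using x1 by (simp add: abs_square_less_1)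
    have "Re (w * (x2 - cnj x1 * l)) \<le> t * k"
      using complex_Re_le_cmod[of "w * (x2 - cnj x1 * l)"] by (simp add: norm_mult t_def k_def)
    then have 1: "(norm (1 - x2 * w))\<^sup>2 - (norm (x1 - l * w))\<^sup>2 \<ge> 1 - (norm x1)\<^sup>2 - 2 * (t * k) + t\<^sup>2 * P"
      unfolding norm_diff_squares P_def t_def by simp
    have 2: "(1 - t) * (1 - (norm x1)\<^sup>2 - t * P) \<ge> 0"
    proof -
      have "t * P \<le> 1 - (norm x1)\<^sup>2"
      proof (cases "P \<le> 0")
        case True
        then show ?thesis using t x1' mult_nonneg_nonpos[of t P] by linarith
      next
        case False
        then show ?thesis using t P mult_left_le_one_le[of P t] by linarith
      qed
      then show ?thesis using t by (intro mult_nonneg_nonneg) auto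
    qed
    have "1 - (norm x1)\<^sup>2 - 2 * (t * k) + t\<^sup>2 * P > 0"
    proof (cases "t = 0")
      case True
      then show ?thesis using x1' by simp
    next
      case False
      then have "t * (2 * k) < t * (1 - (norm x1)\<^sup>2 + P)"
        using gap t by (intro mult_strict_left_mono) (auto simp: k_def)
      then show ?thesis using 2 by (simp add: power2_eq_square algebra_simps)
    qed
    then have "(norm (x1 - l * w))\<^sup>2 < (norm (1 - x2 * w))\<^sup>2" using 1 by linarith
    then show ?thesis by (rule power_less_imp_less_base) simp
  qed
  show ?thesis unfolding tetrablock_def
  proof (clarsimp simp: x1_def[symmetric] x2_def[symmetric])
    fix z w :: complex
    assume z: "norm z \<le> 1" and w: "norm w \<le> 1" and "1 - x1 * z - x2 * w + l * z * w = 0"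
    then have "1 - x2 * w = z * (x1 - l * w)" by (simp add: algebra_simps)
    then have "norm (1 - x2 * w) \<le> norm (x1 - l * w)"
      using z by (simp add: norm_mult mult_left_le_one_le)
    then show False using main[OF w] by simp
  qed
qed

lemma beta_disc_eqD:
  assumes "\<phi> a b l = \<phi> c d m" "norm l < 1"
  shows "a = c" "b = d" "l = m"
proof -
  show lm: "l = m" using arg_cong[OF assms(1), of "\<lambda>x. x$3"] by simp
  have 1: "a + cnj b * l = c + cnj d * l" and 2: "b + cnj a * l = d + cnj c * l"
    using arg_cong[OF assms(1), of "\<lambda>x. x$1"] arg_cong[OF assms(1), of "\<lambda>x. x$2"] lm by simp_all
  have "1 - (norm l)\<^sup>2 \<noteq> 0" using assms(2) by (simp add: abs_square_eq_1)
  then have "complex_of_real (1 - (norm l)\<^sup>2) \<noteq> 0" unfolding of_real_eq_0_iff .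
  then have 3: "1 - l * cnj l \<noteq> 0" by (simp add: of_real_norm_power2)
  have 4: "cnj b + a * cnj l = cnj d + c * cnj l"
    using arg_cong[OF 2, of cnj] by simp
  have "(a - c) * (1 - l * cnj l)
      = (a + cnj b * l - (c + cnj d * l)) - (cnj b + a * cnj l - (cnj d + c * cnj l)) * l"
    by (simp add: algebra_simps)
  also have "\<dots> = 0" unfolding 1 4 by simp
  finally have "(a - c) * (1 - l * cnj l) = 0" .
  then show ac: "a = c" using 3 by simp
  then show "b = d" using 2 by simp
qed

lemma beta_disc_in_tetrablock_iff:
  assumes l: "norm l < 1"
  shows "\<phi> a b l \<in> \<E> \<longleftrightarrow> norm a + norm b < 1"
proof
  assume "\<phi> a b l \<in> \<E>"
  then obtain c d where "norm c + norm d < 1" "\<phi> a b l = \<phi> c d (\<phi> a b l $ 3)"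
    by (rule tetrablock_param) blast
  then show "norm a + norm b < 1" using beta_disc_eqD[of a b l c d l] l by simp
qed (simp add: beta_disc_in_tetrablock l)

text \<open>
  This description of \<open>\<E>\<close> shows that it is open, and it is a convenient test for membership.
\<close>

lemma tetrablock_eq:
  "\<E> = {x. norm (x$3) < 1 \<and> norm (x$1 - cnj (x$2) * x$3) + norm (x$2 - cnj (x$1) * x$3) < 1 - (norm (x$3))\<^sup>2}"
  (is "_ = ?R")
proof (intro subset_antisym subsetI)
  fix x assume x: "x \<in> \<E>"
  have "norm (x$3) < 1" using x by (rule tetrablock_param)
  then show "x \<in> ?R"
    using tetrablock_gap[OF x] tetrablock_gap[of "swap12 x"] x by simp
next
  fix x assume x: "x \<in> ?R"
  define r where "r = 1 - (norm (x$3))\<^sup>2"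
  have r: "r > 0" using x by (simp add: r_def abs_square_less_1)
  define a where "a = (x$1 - cnj (x$2) * x$3) / r"
  define b where "b = (x$2 - cnj (x$1) * x$3) / r"
  have "x = \<phi> a b (x$3)"
    unfolding a_def b_def r_def by (rule eq_beta_disc) (use r in \<open>auto simp: r_def\<close>)
  moreover have "norm a + norm b < 1"
  proof -
    have "norm (x$1 - cnj (x$2) * x$3) + norm (x$2 - cnj (x$1) * x$3) < r"
      using x by (simp add: r_def)
    then show ?thesis using r by (simp add: a_def b_def norm_divide flip: add_divide_distrib)
  qed
  ultimately show "x \<in> \<E>" using beta_disc_in_tetrablock[of a b "x$3"] x by simp
qed

lemma open_tetrablock: "open \<E>"
  unfolding tetrablock_eq Collect_conj_eq
  by (intro open_Int open_Collect_less continuous_intros)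

lemma tetrablock_scale:
  assumes x: "x \<in> \<E>" and s: "norm s \<le> 1"
  shows "vector [s * x$1, x$2, s * x$3] \<in> \<E>"
  unfolding tetrablock_def
proof (clarsimp)
  fix z w :: complex
  assume "norm z \<le> 1" "norm w \<le> 1" and e: "1 - s * x$1 * z - x$2 * w + s * x$3 * z * w = 0"
  moreover from this have "norm (s * z) \<le> 1" using s by (simp add: norm_mult mult_le_one)
  ultimately have "1 - x$1 * (s * z) - x$2 * w + x$3 * (s * z) * w \<noteq> 0"
    using x unfolding tetrablock_def by blast
  then show False using e by (simp add: algebra_simps)
qed

section \<open>The left and right actions on leaves\<close>

text \<open>
  \<open>\<tau> \<upsilon> \<diamondop> x\<close> for \<open>\<upsilon> z = \<omega> (z - \<alpha>) / (cnj \<alpha> z - 1)\<close>; see \<open>left_act_eq\<close>.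
\<close>

definition left_moebius :: "complex \<Rightarrow> complex \<Rightarrow> complex ^ 3 \<Rightarrow> complex ^ 3" where
  "left_moebius \<omega> \<alpha> x = vector
     [\<omega> * (\<alpha> - x$1) / (1 - cnj \<alpha> * x$1), (x$2 - cnj \<alpha> * x$3) / (1 - cnj \<alpha> * x$1),
      \<omega> * (\<alpha> * x$2 - x$3) / (1 - cnj \<alpha> * x$1)]"

lemma left_moebius_nth [simp]:
  "left_moebius \<omega> \<alpha> x $ 1 = \<omega> * (\<alpha> - x$1) / (1 - cnj \<alpha> * x$1)"
  "left_moebius \<omega> \<alpha> x $ 2 = (x$2 - cnj \<alpha> * x$3) / (1 - cnj \<alpha> * x$1)"
  "left_moebius \<omega> \<alpha> x $ 3 = \<omega> * (\<alpha> * x$2 - x$3) / (1 - cnj \<alpha> * x$1)"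
  by (simp_all add: left_moebius_def)

lemma one_minus_mult_nonzero:
  assumes "norm (a::complex) < 1" "norm b \<le> 1" shows "1 - a * b \<noteq> 0" "1 - b * a \<noteq> 0"
proof -
  have "norm (a * b) < 1"
    using assms mult_left_le[of "norm b" "norm a"] by (simp add: norm_mult)
  then show "1 - a * b \<noteq> 0" "1 - b * a \<noteq> 0" by (auto simp: mult.commute)
qed

lemma moebius_norm_le:
  assumes "norm a < 1" "norm z \<le> 1"
  shows "norm (cnj a - z) \<le> norm (1 - a * z)"
proof -
  have "(norm (1 - a * z))\<^sup>2 - (norm (cnj a - z))\<^sup>2 = (1 - (norm a)\<^sup>2) * (1 - (norm z)\<^sup>2)"
    unfolding cmod_power2 by (simp add: power2_eq_square algebra_simps)
  also have "\<dots> \<ge> 0"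
    using power_le_one[of "norm a" 2] power_le_one[of "norm z" 2] assms by simp
  finally have "(norm (cnj a - z))\<^sup>2 \<le> (norm (1 - a * z))\<^sup>2" by linarith
  then show ?thesis by (rule power2_le_imp_le) simp
qed

text \<open>
  Up to nonvanishing factors, the defining polynomial of the image point at \<open>(z, w)\<close> is the one of \<open>x\<close>
  at \<open>(u, w)\<close>, where \<open>u\<close> is the image of \<open>z\<close> under an automorphism of the closed disc.
\<close>

lemma left_moebius_in_tetrablock:
  assumes x: "x \<in> \<E>" and \<omega>: "norm \<omega> = 1" and \<alpha>: "norm \<alpha> < 1"
  shows "left_moebius \<omega> \<alpha> x \<in> \<E>"
proof -
  define d where "d = 1 - cnj \<alpha> * x$1"
  have d: "d \<noteq> 0" unfolding d_def
    by (rule one_minus_mult_nonzero) (use \<alpha> tetrablock_coord_less[OF x] in auto)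
  show ?thesis unfolding tetrablock_def
  proof (clarsimp simp: d_def[symmetric])
    fix z w :: complex
    assume z: "norm z \<le> 1" and w: "norm w \<le> 1"
      and e: "1 - \<omega> * (\<alpha> - x$1) * z / d - (x$2 - cnj \<alpha> * x$3) * w / d + \<omega> * (\<alpha> * x$2 - x$3) * z * w / d = 0"
    have *: "d - A - B + C = d * (1 - A / d - B / d + C / d)" for A B C
      using d by (simp add: field_simps)
    have z': "norm (\<omega> * z) \<le> 1" using z \<omega> by (simp add: norm_mult)
    define k where "k = 1 - \<alpha> * (\<omega> * z)"
    have k: "k \<noteq> 0" unfolding k_def by (rule one_minus_mult_nonzero) (use \<alpha> z' in auto)
    define u where "u = (cnj \<alpha> - \<omega> * z) / k"
    have "norm u \<le> 1"
      using moebius_norm_le[OF \<alpha> z'] k by (simp add: u_def k_def norm_divide)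
    then have ne: "1 - x$1 * u - x$2 * w + x$3 * u * w \<noteq> 0"
      using x w unfolding tetrablock_def by blast
    have uk: "u * k = cnj \<alpha> - \<omega> * z" using k by (simp add: u_def)
    have "k * (1 - x$1 * u - x$2 * w + x$3 * u * w) = k - x$1 * (u * k) - x$2 * w * k + x$3 * w * (u * k)"
      by (simp add: algebra_simps)
    also have "\<dots> = d - \<omega> * (\<alpha> - x$1) * z - (x$2 - cnj \<alpha> * x$3) * w + \<omega> * (\<alpha> * x$2 - x$3) * z * w"
      unfolding uk unfolding k_def d_def by (simp add: algebra_simps)
    also have "\<dots> = d * (1 - \<omega> * (\<alpha> - x$1) * z / d - (x$2 - cnj \<alpha> * x$3) * w / d + \<omega> * (\<alpha> * x$2 - x$3) * z * w / d)"
      by (rule *)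
    finally show False using e k ne by simp
  qed
qed

lemma mult_cnj_eq_1: "norm z = 1 \<Longrightarrow> z * cnj z = 1"
  by (metis of_real_1 of_real_norm_power2 one_power2)

lemma left_moebius_inverse:
  assumes x: "x \<in> \<E>" and \<omega>: "norm \<omega> = 1" and \<alpha>: "norm \<alpha> < 1"
  shows "left_moebius (cnj \<omega>) (\<omega> * \<alpha>) (left_moebius \<omega> \<alpha> x) = x"
proof -
  define d where "d = 1 - cnj \<alpha> * x$1"
  have d: "d \<noteq> 0" unfolding d_def
    by (rule one_minus_mult_nonzero) (use \<alpha> tetrablock_coord_less[OF x] in auto)
  define r where "r = 1 - \<alpha> * cnj \<alpha>"
  have r: "r \<noteq> 0" unfolding r_def by (rule one_minus_mult_nonzero) (use \<alpha> in auto)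
  have \<omega>\<omega>: "cnj \<omega> * \<omega> = 1" using mult_cnj_eq_1[OF \<omega>] by (simp add: mult.commute)
  have D: "1 - cnj (\<omega> * \<alpha>) * (\<omega> * (\<alpha> - x$1) / d) = r / d"
  proof -
    have "1 - cnj (\<omega> * \<alpha>) * (\<omega> * (\<alpha> - x$1) / d) = (d - (cnj \<omega> * \<omega>) * (cnj \<alpha> * (\<alpha> - x$1))) / d"
      using d by (simp add: diff_divide_distrib mult_ac)
    then show ?thesis unfolding \<omega>\<omega> by (simp add: d_def r_def algebra_simps)
  qed
  have 1: "cnj \<omega> * (\<omega> * \<alpha> - \<omega> * (\<alpha> - x$1) / d) = x$1 * r / d"
  proof -
    have "x$1 * r = \<alpha> * d - (\<alpha> - x$1)" by (simp add: d_def r_def algebra_simps)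
    then have "x$1 * r / d = (cnj \<omega> * \<omega>) * (\<alpha> - (\<alpha> - x$1) / d)"
      unfolding \<omega>\<omega> using d by (simp add: diff_divide_distrib)
    then show ?thesis by (simp add: right_diff_distrib mult_ac)
  qed
  have 2: "(x$2 - cnj \<alpha> * x$3) / d - cnj (\<omega> * \<alpha>) * (\<omega> * (\<alpha> * x$2 - x$3) / d) = x$2 * r / d"
  proof -
    have "(x$2 - cnj \<alpha> * x$3) / d - cnj (\<omega> * \<alpha>) * (\<omega> * (\<alpha> * x$2 - x$3) / d)
      = ((x$2 - cnj \<alpha> * x$3) - (cnj \<omega> * \<omega>) * (cnj \<alpha> * (\<alpha> * x$2 - x$3))) / d"
      by (simp add: diff_divide_distrib mult_ac)
    then show ?thesis unfolding \<omega>\<omega> by (simp add: r_def algebra_simps)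
  qed
  have 3: "cnj \<omega> * (\<omega> * \<alpha> * ((x$2 - cnj \<alpha> * x$3) / d) - \<omega> * (\<alpha> * x$2 - x$3) / d) = x$3 * r / d"
  proof -
    have "cnj \<omega> * (\<omega> * \<alpha> * ((x$2 - cnj \<alpha> * x$3) / d) - \<omega> * (\<alpha> * x$2 - x$3) / d)
      = (cnj \<omega> * \<omega>) * ((\<alpha> * (x$2 - cnj \<alpha> * x$3) - (\<alpha> * x$2 - x$3)) / d)"
      by (simp add: diff_divide_distrib algebra_simps)
    then show ?thesis unfolding \<omega>\<omega> by (simp add: r_def algebra_simps)
  qed
  show ?thesis
    unfolding vec3_eq_iff left_moebius_nth d_def[symmetric] D 1 2 3
    using d r by simp
qed

text \<open>
  The parameters \<open>\<delta>\<^sub>1\<close> and \<open>\<delta>\<^sub>2\<close> of the leaf to which the left action moves the leaf with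
  parameters \<open>a\<close>, \<open>b\<close>.
\<close>

definition left_beta1 :: "complex \<Rightarrow> complex \<Rightarrow> complex \<Rightarrow> complex \<Rightarrow> complex" where
  "left_beta1 \<omega> \<alpha> a b = \<omega> * ((\<alpha> * complex_of_real (1 - (norm b)\<^sup>2 + (norm a)\<^sup>2) - a - \<alpha>\<^sup>2 * cnj a)
     / complex_of_real ((norm (1 - cnj \<alpha> * a))\<^sup>2 - (norm (\<alpha> * b))\<^sup>2))"

definition left_beta2 :: "complex \<Rightarrow> complex \<Rightarrow> complex \<Rightarrow> complex" where
  "left_beta2 \<alpha> a b = b * complex_of_real (1 - (norm \<alpha>)\<^sup>2)
     / complex_of_real ((norm (1 - cnj \<alpha> * a))\<^sup>2 - (norm (\<alpha> * b))\<^sup>2)"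

lemma left_denominator_pos:
  assumes "norm a + norm b < 1" "norm \<alpha> < 1"
  shows "(norm (1 - cnj \<alpha> * a))\<^sup>2 - (norm (\<alpha> * b))\<^sup>2 > 0"
proof -
  have "norm \<alpha> * (norm a + norm b) \<le> norm a + norm b"
    using assms by (intro mult_left_le_one_le) auto
  then have "norm (\<alpha> * b) < 1 - norm (cnj \<alpha> * a)"
    using assms by (simp add: norm_mult distrib_left)
  also have "\<dots> \<le> norm (1 - cnj \<alpha> * a)"
    by (metis norm_one norm_triangle_ineq2)
  finally have "(norm (\<alpha> * b))\<^sup>2 < (norm (1 - cnj \<alpha> * a))\<^sup>2"
    by (intro power_strict_mono) auto
  then show ?thesis by simp
qed

text \<open>
  The first claim amounts to two polynomial identities. The bound on the new
  parameters follows from the others: the image point lies in \<open>\<E>\<close>, and a point of the disc \<open>\<phi> c d ` \<D>\<close> lies in \<open>\<E>\<close>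
  only if \<open>\<bar>c\<bar> + \<bar>d\<bar> < 1\<close>.
\<close>

lemma left_moebius_beta_disc:
  assumes ab: "norm a + norm b < 1" and \<omega>: "norm \<omega> = 1" and \<alpha>: "norm \<alpha> < 1" and l: "norm l < 1"
  defines "m \<equiv> left_moebius \<omega> \<alpha> (\<phi> a b l) $ 3"
  shows "left_moebius \<omega> \<alpha> (\<phi> a b l) = \<phi> (left_beta1 \<omega> \<alpha> a b) (left_beta2 \<alpha> a b) m"
    and "norm m < 1"
    and "norm (left_beta1 \<omega> \<alpha> a b) + norm (left_beta2 \<alpha> a b) < 1"
proof -
  have E: "\<phi> a b l \<in> \<E>" using ab l by (rule beta_disc_in_tetrablock)
  have E': "left_moebius \<omega> \<alpha> (\<phi> a b l) \<in> \<E>" using E \<omega> \<alpha> by (rule left_moebius_in_tetrablock)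
  show m: "norm m < 1" unfolding m_def using E' by (rule tetrablock_param)
  define D where "D = 1 - cnj \<alpha> * (a + cnj b * l)"
  have D: "D \<noteq> 0" unfolding D_def
    by (rule one_minus_mult_nonzero) (use \<alpha> tetrablock_coord_less[OF E] in auto)
  define d where "d = complex_of_real ((norm (1 - cnj \<alpha> * a))\<^sup>2 - (norm (\<alpha> * b))\<^sup>2)"
  have d0: "d \<noteq> 0" unfolding d_def of_real_eq_0_iff using left_denominator_pos[OF ab \<alpha>] by linarith
  have d: "d = (1 - cnj \<alpha> * a) * (1 - \<alpha> * cnj a) - \<alpha> * cnj \<alpha> * (b * cnj b)"
    by (simp add: d_def of_real_norm_power2)
  have cd: "cnj d = d" by (simp add: d_def)
  define p where "p = \<alpha> * (1 - b * cnj b + a * cnj a) - a - \<alpha>\<^sup>2 * cnj a"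
  define q where "q = b * (1 - \<alpha> * cnj \<alpha>)"
  have L1: "left_beta1 \<omega> \<alpha> a b = \<omega> * (p / d)"
    by (simp add: left_beta1_def p_def d_def of_real_norm_power2)
  have L2: "left_beta2 \<alpha> a b = q / d"
    by (simp add: left_beta2_def q_def d_def of_real_norm_power2)
  define n where "n = \<alpha> * (b + cnj a * l) - l"
  have mn: "m = \<omega> * n / D" by (simp add: m_def n_def D_def)
  have e1: "(\<alpha> - (a + cnj b * l)) * d = p * D + cnj q * n"
    unfolding p_def q_def d D_def n_def by (simp add: algebra_simps power2_eq_square)
  have e2: "(b + cnj a * l - cnj \<alpha> * l) * d = q * D + cnj p * n"
    unfolding p_def q_def d D_def n_def by (simp add: algebra_simps power2_eq_square)
  have \<omega>\<omega>: "cnj \<omega> * \<omega> = 1" using mult_cnj_eq_1[OF \<omega>] by (simp add: mult.commute)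
  have "\<omega> * (\<alpha> - (a + cnj b * l)) / D = \<omega> * (p / d) + cnj (q / d) * (\<omega> * n / D)"
  proof -
    have "\<omega> * (\<alpha> - (a + cnj b * l)) / D = \<omega> * ((\<alpha> - (a + cnj b * l)) * d) / (D * d)"
      using d0 by simp
    also have "\<dots> = \<omega> * (p / d) + cnj (q / d) * (\<omega> * n / D)"
      unfolding e1 using d0 D by (simp add: cd field_simps)
    finally show ?thesis .
  qed
  moreover have "(b + cnj a * l - cnj \<alpha> * l) / D = q / d + cnj (\<omega> * (p / d)) * (\<omega> * n / D)"
  proof -
    have "(b + cnj a * l - cnj \<alpha> * l) / D = ((b + cnj a * l - cnj \<alpha> * l) * d) / (D * d)"
      using d0 by simp
    also have "\<dots> = q / d + (cnj \<omega> * \<omega>) * (cnj p * n) / (d * D)"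
      unfolding e2 \<omega>\<omega> using d0 D by (simp add: field_simps)
    finally show ?thesis by (simp add: cd mult_ac)
  qed
  ultimately show eq: "left_moebius \<omega> \<alpha> (\<phi> a b l) = \<phi> (left_beta1 \<omega> \<alpha> a b) (left_beta2 \<alpha> a b) m"
    unfolding vec3_eq_iff L1 L2 by (simp add: D_def mn) (simp add: n_def)
  show "norm (left_beta1 \<omega> \<alpha> a b) + norm (left_beta2 \<alpha> a b) < 1"
    using E' unfolding eq beta_disc_in_tetrablock_iff[OF m] .
qed

text \<open>
  Surjectivity: the inverse map carries the image leaf into some leaf, which must be the original
  one because leaves are disjoint.
\<close>

lemma left_moebius_leaf:
  assumes ab: "norm a + norm b < 1" and \<omega>: "norm \<omega> = 1" and \<alpha>: "norm \<alpha> < 1"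
  shows "left_moebius \<omega> \<alpha> ` \<phi> a b ` \<D> = \<phi> (left_beta1 \<omega> \<alpha> a b) (left_beta2 \<alpha> a b) ` \<D>"
    (is "_ = \<phi> ?c ?d ` \<D>")
proof
  show "left_moebius \<omega> \<alpha> ` \<phi> a b ` \<D> \<subseteq> \<phi> ?c ?d ` \<D>"
  proof clarify
    fix l assume "l \<in> \<D>"
    then have "norm l < 1" by simp
    from left_moebius_beta_disc(1,2)[OF ab \<omega> \<alpha> this]
    show "left_moebius \<omega> \<alpha> (\<phi> a b l) \<in> \<phi> ?c ?d ` \<D>"
      by (metis imageI mem_ball_0)
  qed
next
  have cd: "norm ?c + norm ?d < 1" using left_moebius_beta_disc(3)[OF ab \<omega> \<alpha>, of 0] by simp
  have \<omega>': "norm (cnj \<omega>) = 1" "norm (\<omega> * \<alpha>) < 1" using \<omega> \<alpha> by (simp_all add: norm_mult)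
  have inv: "left_moebius \<omega> \<alpha> (left_moebius (cnj \<omega>) (\<omega> * \<alpha>) x) = x" if "x \<in> \<E>" for x
  proof -
    have "cnj \<omega> * (\<omega> * \<alpha>) = \<alpha>"
      using mult_cnj_eq_1[OF \<omega>] by (metis mult.assoc mult.commute mult_1)
    then show ?thesis using left_moebius_inverse[OF that \<omega>'] unfolding complex_cnj_cnj by metis
  qed
  define a' where a': "a' = left_beta1 (cnj \<omega>) (\<omega> * \<alpha>) ?c ?d"
  define b' where b': "b' = left_beta2 (\<omega> * \<alpha>) ?c ?d"
  note inv_disc = left_moebius_beta_disc[OF cd \<omega>', folded a' b']
  have same: "a' = a" "b' = b"
  proof -
    define m where "m = left_moebius \<omega> \<alpha> (\<phi> a b 0) $ 3"
    have E: "\<phi> a b 0 \<in> \<E>" using ab by (simp add: beta_disc_in_tetrablock)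
    have m: "norm m < 1" "left_moebius \<omega> \<alpha> (\<phi> a b 0) = \<phi> ?c ?d m"
      using left_moebius_beta_disc[OF ab \<omega> \<alpha>, of 0] by (simp_all add: m_def)
    have "\<phi> a b 0 = left_moebius (cnj \<omega>) (\<omega> * \<alpha>) (\<phi> ?c ?d m)"
      using left_moebius_inverse[OF E \<omega> \<alpha>] m(2) by simp
    also have "\<dots> = \<phi> a' b' (left_moebius (cnj \<omega>) (\<omega> * \<alpha>) (\<phi> ?c ?d m) $ 3)"
      by (rule inv_disc(1)[OF m(1)])
    finally have "\<phi> a b 0 = \<phi> a' b' (left_moebius (cnj \<omega>) (\<omega> * \<alpha>) (\<phi> ?c ?d m) $ 3)" .
    from beta_disc_eqD[OF this] show "a' = a" "b' = b" by simp_all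
  qed
  show "\<phi> ?c ?d ` \<D> \<subseteq> left_moebius \<omega> \<alpha> ` \<phi> a b ` \<D>"
  proof clarify
    fix l assume l: "l \<in> \<D>"
    let ?l' = "left_moebius (cnj \<omega>) (\<omega> * \<alpha>) (\<phi> ?c ?d l) $ 3"
    have "\<phi> ?c ?d l \<in> \<E>" using cd l by (simp add: beta_disc_in_tetrablock)
    note E = this
    have "left_moebius (cnj \<omega>) (\<omega> * \<alpha>) (\<phi> ?c ?d l) = \<phi> a b ?l'"
      using inv_disc(1)[of l] l unfolding same mem_ball_0 by blast
    then have "\<phi> ?c ?d l = left_moebius \<omega> \<alpha> (\<phi> a b ?l')"
      using inv[OF E] by metis
    moreover have "?l' \<in> \<D>" using inv_disc(2)[of l] l unfolding mem_ball_0 by blast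
    ultimately show "\<phi> ?c ?d l \<in> left_moebius \<omega> \<alpha> ` \<phi> a b ` \<D>" by blast
  qed
qed

text \<open>
  \<open>x \<diamondop> \<tau> \<eta>\<close> for \<open>\<eta> z = \<zeta> (z - \<theta>) / (cnj \<theta> z - 1)\<close>; see \<open>right_act_eq\<close>. This form
  transfers every property of the left action to the right action.
\<close>

definition right_moebius :: "complex \<Rightarrow> complex \<Rightarrow> complex ^ 3 \<Rightarrow> complex ^ 3" where
  "right_moebius \<zeta> \<theta> x = swap12 (left_moebius \<zeta> (cnj (\<zeta> * \<theta>)) (swap12 x))"

lemma right_moebius_leaf:
  assumes ab: "norm a + norm b < 1" and \<zeta>: "norm \<zeta> = 1" and \<theta>: "norm \<theta> < 1"
  shows "right_moebius \<zeta> \<theta> ` \<phi> a b ` \<D> =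
    \<phi> (left_beta2 (cnj (\<zeta> * \<theta>)) b a) (left_beta1 \<zeta> (cnj (\<zeta> * \<theta>)) b a) ` \<D>"
proof -
  have "right_moebius \<zeta> \<theta> ` \<phi> a b ` \<D> = swap12 ` left_moebius \<zeta> (cnj (\<zeta> * \<theta>)) ` \<phi> b a ` \<D>"
    by (simp add: right_moebius_def image_image)
  also have "left_moebius \<zeta> (cnj (\<zeta> * \<theta>)) ` \<phi> b a ` \<D>
      = \<phi> (left_beta1 \<zeta> (cnj (\<zeta> * \<theta>)) b a) (left_beta2 (cnj (\<zeta> * \<theta>)) b a) ` \<D>"
    by (rule left_moebius_leaf) (use assms in \<open>auto simp: norm_mult\<close>)
  finally show ?thesis by (simp add: image_image)
qed

section \<open>Velocities of analytic discs in the tetrablock\<close>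

lemma has_derivative_vec_nthI:
  fixes f :: "'a::real_normed_vector \<Rightarrow> complex ^ 'n"
  assumes "\<And>i. ((\<lambda>x. f x $ i) has_derivative (\<lambda>h. f' h $ i)) (at a within S)"
  shows "(f has_derivative f') (at a within S)"
proof (subst has_derivative_componentwise_within, rule ballI)
  fix b :: "complex ^ 'n" assume "b \<in> Basis"
  then obtain i c where b: "b = axis i c" by (auto simp: Basis_vec_def)
  show "((\<lambda>x. f x \<bullet> b) has_derivative (\<lambda>x. f' x \<bullet> b)) (at a within S)"
    unfolding b inner_axis by (intro has_derivative_inner_left assms)
qed

lemma has_derivative_vec_nth:
  assumes "(f has_derivative f') F"
  shows "((\<lambda>x. f x $ i) has_derivative (\<lambda>h. f' h $ i)) F"
  by (rule bounded_linear.has_derivative[OF bounded_linear_vec_nth assms])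

text \<open>
  An analytic disc in \<open>\<E>\<close> centred at \<open>p\<close> with velocity \<open>v\<close>.
\<close>

definition analytic_disc :: "(complex \<Rightarrow> complex ^ 3) \<Rightarrow> complex ^ 3 \<Rightarrow> complex ^ 3 \<Rightarrow> bool" where
  "analytic_disc y p v \<longleftrightarrow>
     (\<forall>l\<in>\<D>. y l \<in> \<E> \<and> (\<exists>u. (y has_derivative (\<lambda>h. h *s u)) (at l))) \<and>
     y 0 = p \<and> (y has_derivative (\<lambda>h. h *s v)) (at 0)"

lemma curve_has_derivative_iff:
  fixes y :: "complex \<Rightarrow> complex ^ 'n"
  shows "(y has_derivative (\<lambda>h. h *s v)) (at l) \<longleftrightarrow>
     (\<forall>i. ((\<lambda>l. y l $ i) has_field_derivative v $ i) (at l))"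
  (is "?A \<longleftrightarrow> ?B")
proof
  assume ?A
  from has_derivative_vec_nth[OF this] show ?B
    by (simp add: has_field_derivative_def mult.commute[of _ "_ $ _"])
next
  assume ?B
  then show ?A
    by (intro has_derivative_vec_nthI) (simp add: has_field_derivative_def mult.commute[of _ "_ $ _"])
qed

lemma analytic_discI:
  assumes "\<And>l. norm l < 1 \<Longrightarrow> y l \<in> \<E>"
    and "\<And>i. (\<lambda>l. y l $ i) holomorphic_on \<D>"
    and "y 0 = p"
    and "\<And>i. ((\<lambda>l. y l $ i) has_field_derivative v $ i) (at 0)"
  shows "analytic_disc y p v"
proof -
  have "\<exists>u. (y has_derivative (\<lambda>h. h *s u)) (at l)" if "l \<in> \<D>" for l
    unfolding curve_has_derivative_iff
    using holomorphic_derivI[OF assms(2) open_ball that] by (intro exI[of _ "\<chi> i. deriv (\<lambda>l. y l $ i) l"]) simp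
  then show ?thesis
    using assms by (auto simp: analytic_disc_def curve_has_derivative_iff)
qed

lemma analytic_discD:
  assumes "analytic_disc y p v"
  shows "norm l < 1 \<Longrightarrow> y l \<in> \<E>" "(\<lambda>l. y l $ i) holomorphic_on \<D>" "y 0 = p"
    "((\<lambda>l. y l $ i) has_field_derivative v $ i) (at 0)"
proof -
  show "(\<lambda>l. y l $ i) holomorphic_on \<D>"
    using assms unfolding analytic_disc_def curve_has_derivative_iff holomorphic_on_def
    by (meson field_differentiable_at_within field_differentiable_def)
qed (use assms in \<open>auto simp: analytic_disc_def curve_has_derivative_iff\<close>)

lemma analytic_disc_swap12:
  assumes "analytic_disc y p v" shows "analytic_disc (\<lambda>l. swap12 (y l)) (swap12 p) (swap12 v)"
proof (rule analytic_discI)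
  fix i :: 3
  consider "i = 1" | "i = 2" | "i = 3" using exhaust_3 by blast
  then show "(\<lambda>l. swap12 (y l) $ i) holomorphic_on \<D>"
    "((\<lambda>l. swap12 (y l) $ i) has_field_derivative swap12 v $ i) (at 0)"
    by (cases; simp add: analytic_discD[OF assms])+
qed (use analytic_discD[OF assms] in auto)

lemma analytic_disc_compose:
  assumes y: "analytic_disc y p v" and g: "analytic_map_on g \<E>" "g ` \<E> \<subseteq> \<E>"
    and B: "(g has_derivative B) (at p within \<E>)" "\<And>c u. B (c *s u) = c *s B u"
  shows "analytic_disc (\<lambda>l. g (y l)) (g p) (B v)"
proof -
  have sub: "y ` \<D> \<subseteq> \<E>" using y by (auto simp: analytic_disc_def)
  have chain: "((\<lambda>l. g (y l)) has_derivative (\<lambda>h. h *s G u)) (at l)"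
    if "l \<in> \<D>" "(y has_derivative (\<lambda>h. h *s u)) (at l)" "(g has_derivative G) (at (y l) within \<E>)"
      "\<And>c u. G (c *s u) = c *s G u" for l u G
  proof -
    have "(g has_derivative G) (at (y l) within y ` \<D>)"
      using that(3) sub by (rule has_derivative_subset)
    moreover have "(y has_derivative (\<lambda>h. h *s u)) (at l within \<D>)"
      using that(2) by (rule has_derivative_at_withinI)
    ultimately have "(g \<circ> y has_derivative G \<circ> (\<lambda>h. h *s u)) (at l within \<D>)"
      by (rule diff_chain_within[rotated])
    then show ?thesis using that(1,4) by (simp add: o_def at_within_open[OF _ open_ball])
  qed
  have "\<exists>u. ((\<lambda>l. g (y l)) has_derivative (\<lambda>h. h *s u)) (at l)" if l: "l \<in> \<D>" for l
  proof -
    obtain u where "(y has_derivative (\<lambda>h. h *s u)) (at l)"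
      using y[unfolded analytic_disc_def] l by blast
    moreover have "y l \<in> \<E>" using sub l by blast
    then obtain G where "Vector_Spaces.linear (*s) (*s) G" "(g has_derivative G) (at (y l) within \<E>)"
      using g(1) unfolding analytic_map_on_def by blast
    ultimately show ?thesis using chain[OF l, of u G] by (auto simp: Vector_Spaces.linear_iff)
  qed
  moreover have "((\<lambda>l. g (y l)) has_derivative (\<lambda>h. h *s B v)) (at 0)"
    using y B by (intro chain) (auto simp: analytic_disc_def)
  ultimately show ?thesis using y g(2) by (auto simp: analytic_disc_def)
qed

text \<open>
  The Schwarz lemma for \<open>F\<close> followed by the disc automorphism that moves \<open>F 0\<close> to \<open>0\<close>.
\<close>

lemma schwarz_pick_deriv_0:
  assumes hol: "F holomorphic_on \<D>" and F: "\<And>z. norm z < 1 \<Longrightarrow> norm (F z) < 1"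
    and d: "(F has_field_derivative d) (at 0)"
  shows "norm d \<le> 1 - (norm (F 0))\<^sup>2"
proof -
  define c where "c = F 0"
  have c: "norm c < 1" using F[of 0] by (simp add: c_def)
  define r where "r = 1 - (norm c)\<^sup>2"
  have r: "r > 0" using c by (simp add: r_def abs_square_less_1)
  have rc: "1 - cnj c * c = complex_of_real r" by (simp add: r_def of_real_norm_power2 mult.commute)
  have ne: "1 - cnj c * F z \<noteq> 0" if "norm z < 1" for z
  proof -
    have "norm (cnj c * F z) < 1"
      using c F[OF that] mult_strict_mono'[of "norm c" 1 "norm (F z)" 1] by (simp add: norm_mult)
    then show ?thesis by auto
  qed
  define G where "G z = (F z - c) / (1 - cnj c * F z)" for z
  have "G holomorphic_on \<D>"
    unfolding G_def using ne by (intro holomorphic_intros hol) auto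
  moreover have "norm (G z) < 1" if z: "norm z < 1" for z
  proof -
    have "(norm (1 - cnj c * F z))\<^sup>2 - (norm (F z - c))\<^sup>2 = r * (1 - (norm (F z))\<^sup>2)"
      unfolding cmod_power2 r_def by (simp add: power2_eq_square algebra_simps)
    also have "\<dots> > 0" using r F[OF z] by (simp add: abs_square_less_1)
    finally have "(norm (F z - c))\<^sup>2 < (norm (1 - cnj c * F z))\<^sup>2" by simp
    then have "norm (F z - c) < norm (1 - cnj c * F z)" by (rule power_less_imp_less_base) simp
    then show ?thesis using ne[OF z] by (simp add: G_def norm_divide)
  qed
  moreover have "G 0 = 0" by (simp add: G_def c_def)
  ultimately have "norm (deriv G 0) \<le> 1"
    using Schwarz_Lemma(2)[of G 0] by simp
  moreover have "(G has_field_derivative d / r) (at 0)"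
    unfolding G_def
    by (rule derivative_eq_intros d | use ne[of 0] r in \<open>simp add: c_def[symmetric] rc\<close>)+
  then have "deriv G 0 = d / r" by (rule DERIV_imp_deriv)
  ultimately show ?thesis using r by (simp add: norm_divide r_def[symmetric] c_def[symmetric])
qed

text \<open>
  For unimodular \<open>\<eta>\<close>, the function \<open>\<Psi> \<eta>\<close> maps \<open>\<E>\<close> into the disc, by \<open>tetrablock_norm_less\<close>.
\<close>

lemma Psi_disc:
  assumes y: "analytic_disc y (\<phi> 0 0 r) v" and \<eta>: "norm \<eta> = 1"
  defines "F \<equiv> \<lambda>l. \<Psi> \<eta> (y l)"
  shows "F holomorphic_on \<D>" "\<And>l. norm l < 1 \<Longrightarrow> norm (F l) < 1" "F 0 = - (r * \<eta>)"
    "(F has_field_derivative v$1 - v$3 * \<eta> - r * \<eta>\<^sup>2 * v$2) (at 0)"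
proof -
  have less: "norm (y l $ 1 - y l $ 3 * \<eta>) < norm (1 - y l $ 2 * \<eta>)" if "norm l < 1" for l
    using tetrablock_norm_less[OF analytic_discD(1)[OF y that]] \<eta> by simp
  then have ne: "y l $ 2 * \<eta> - 1 \<noteq> 0" if "norm l < 1" for l using that
    by (metis eq_iff_diff_eq_0 norm_ge_zero norm_zero not_le)
  show "F holomorphic_on \<D>"
    unfolding F_def Psi_def using ne by (intro holomorphic_intros analytic_discD(2)[OF y]) auto
  show "norm (F l) < 1" if "norm l < 1" for l
    using less[OF that] ne[OF that] by (simp add: F_def Psi_def norm_divide norm_minus_commute)
  show "F 0 = - (r * \<eta>)" by (simp add: F_def Psi_def analytic_discD(3)[OF y])
  show "(F has_field_derivative v$1 - v$3 * \<eta> - r * \<eta>\<^sup>2 * v$2) (at 0)"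
    unfolding F_def Psi_def
    by (rule derivative_eq_intros analytic_discD(4)[OF y] refl
        | simp add: analytic_discD(3)[OF y] power2_eq_square algebra_simps)+
qed

lemma analytic_disc_tangent_bound:
  assumes y: "analytic_disc y (\<phi> 0 0 r) v" and \<eta>: "norm \<eta> = 1"
  shows "norm (v$1 - v$3 * \<eta> - r * \<eta>\<^sup>2 * v$2) \<le> 1 - (norm r)\<^sup>2"
    "norm (v$2 - v$3 * \<eta> - r * \<eta>\<^sup>2 * v$1) \<le> 1 - (norm r)\<^sup>2"
proof -
  have *: "norm (v$1 - v$3 * \<eta> - r * \<eta>\<^sup>2 * v$2) \<le> 1 - (norm r)\<^sup>2"
    if "analytic_disc y (\<phi> 0 0 r) v" for y v
    using schwarz_pick_deriv_0[OF Psi_disc(1,2,4)[OF that \<eta>]] Psi_disc(3)[OF that \<eta>] \<eta>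
    by (simp add: norm_mult)
  show "norm (v$1 - v$3 * \<eta> - r * \<eta>\<^sup>2 * v$2) \<le> 1 - (norm r)\<^sup>2" by (rule *[OF y])
  show "norm (v$2 - v$3 * \<eta> - r * \<eta>\<^sup>2 * v$1) \<le> 1 - (norm r)\<^sup>2"
    using *[of _ "swap12 v"] analytic_disc_swap12[OF y] by simp
qed

text \<open>
  The Kobayashi metric (and the Caratheodory metric) of \<open>\<E>\<close> at the origin.
\<close>

definition metric0 :: "complex ^ 3 \<Rightarrow> real" where
  "metric0 v = max (norm (v$1)) (norm (v$2)) + norm (v$3)"

text \<open>
  Rotating \<open>\<eta>\<close> turns the bounds on \<open>v\<^sub>i - v\<^sub>3 \<eta>\<close> into bounds on \<open>\<bar>v\<^sub>i\<bar> + \<bar>v\<^sub>3\<bar>\<close>.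
\<close>

lemma norm_diff_rotate:
  obtains \<eta> where "norm \<eta> = 1" "norm (a - b * \<eta>) = norm a + norm (b::complex)"
proof (cases "a = 0 \<or> b = 0")
  case True
  then show ?thesis using that[of 1] by auto
next
  case False
  define \<eta> where "\<eta> = - (sgn a / sgn b)"
  have polar: "complex_of_real (norm z) * sgn z = z" if "z \<noteq> 0" for z
    using that by (simp add: sgn_eq)
  have "b * \<eta> = complex_of_real (norm b) * sgn b * \<eta>" using False polar by simp
  then have "b * \<eta> = - (norm b * sgn a)" using False by (simp add: \<eta>_def sgn_zero_iff)
  moreover have "a = norm a * sgn a" using False polar by simp
  ultimately have "a - b * \<eta> = (norm a + norm b) * sgn a" by (metis distrib_right diff_minus_eq_add of_real_add)
  then have "norm (a - b * \<eta>) = norm a + norm b"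
    using False by (simp add: norm_mult norm_sgn) (simp flip: of_real_add)
  moreover have "norm \<eta> = 1" using False by (simp add: \<eta>_def norm_divide norm_sgn)
  ultimately show ?thesis using that by blast
qed

lemma metric0_le_1:
  assumes y: "analytic_disc y 0 v" shows "metric0 v \<le> 1"
proof -
  have 0: "(0::complex^3) = \<phi> 0 0 0" by (simp add: vec3_eq_iff)
  note bd = analytic_disc_tangent_bound[OF y[unfolded 0]]
  have "norm a + norm (v$3) \<le> 1" if "\<And>\<eta>. norm \<eta> = 1 \<Longrightarrow> norm (a - v$3 * \<eta>) \<le> 1" for a
    using norm_diff_rotate[of a "v$3"] that by metis
  from this[of "v$1"] this[of "v$2"] show ?thesis
    using bd by (simp add: metric0_def)
qed

lemma metric0_scale: "metric0 (c *s v) = norm c * metric0 v"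
  by (simp add: metric0_def norm_mult max_mult_distrib_left distrib_left)

definition disc_moebius :: "complex \<Rightarrow> complex \<Rightarrow> complex \<Rightarrow> complex" where
  "disc_moebius c k z = (k * z + c) / (1 + cnj c * (k * z))"

lemma disc_moebius:
  assumes c: "norm c < 1" and k: "norm k \<le> 1"
  shows "disc_moebius c k holomorphic_on \<D>" "\<And>z. norm z < 1 \<Longrightarrow> norm (disc_moebius c k z) < 1"
    "disc_moebius c k 0 = c"
    "(disc_moebius c k has_field_derivative k * (1 - (norm c)\<^sup>2)) (at 0)"
proof -
  have kz: "norm (k * z) < 1" if "norm z < 1" for z
    using that k mult_left_le_one_le[of "norm z" "norm k"] by (simp add: norm_mult)
  have ne: "1 + cnj c * (k * z) \<noteq> 0" if z: "norm z < 1" for z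
  proof -
    have "norm (cnj c * (k * z)) < 1"
      using c kz[OF z] mult_strict_mono'[of "norm c" 1 "norm (k * z)" 1] by (simp add: norm_mult)
    then show ?thesis by (metis add.inverse_unique norm_minus_cancel norm_one less_irrefl)
  qed
  show "disc_moebius c k holomorphic_on \<D>"
    unfolding disc_moebius_def using ne by (intro holomorphic_intros) auto
  show "norm (disc_moebius c k z) < 1" if z: "norm z < 1" for z
  proof -
    have "(norm (1 + cnj c * (k * z)))\<^sup>2 - (norm (k * z + c))\<^sup>2 = (1 - (norm c)\<^sup>2) * (1 - (norm (k * z))\<^sup>2)"
      unfolding cmod_power2 by (simp add: power2_eq_square algebra_simps)
    also have "\<dots> > 0"
    proof (rule mult_pos_pos)
      show "0 < 1 - (norm c)\<^sup>2" using c by (simp add: abs_square_less_1)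
      show "0 < 1 - (norm (k * z))\<^sup>2" using kz[OF z] abs_square_less_1[of "norm (k * z)"] by simp
    qed
    finally have "(norm (k * z + c))\<^sup>2 < (norm (1 + cnj c * (k * z)))\<^sup>2" by simp
    then have "norm (k * z + c) < norm (1 + cnj c * (k * z))" by (rule power_less_imp_less_base) simp
    then show ?thesis using ne[OF z] by (simp add: disc_moebius_def norm_divide)
  qed
  show "disc_moebius c k 0 = c" by (simp add: disc_moebius_def)
  show "(disc_moebius c k has_field_derivative k * (1 - (norm c)\<^sup>2)) (at 0)"
    unfolding disc_moebius_def
    by (rule derivative_eq_intros refl | simp add: of_real_norm_power2 algebra_simps)+
qed

text \<open>
  The disc \<open>l \<mapsto> (l (a + cnj b m), b + cnj a m, l m)\<close>, with \<open>m\<close> a function from the disc to itself, is obtained from the leaf point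
  \<open>\<phi> a b (m l)\<close> by scaling two coordinates by \<open>l\<close>. It passes through the origin when \<open>m 0 = v\<^sub>3\<close> and
  \<open>b = - cnj a v\<^sub>3\<close>; its velocity then has first coordinate \<open>a (1 - \<bar>v\<^sub>3\<bar>\<^sup>2)\<close> and second coordinate \<open>cnj a\<close> times the derivative of \<open>m\<close>
  at \<open>0\<close>. The Schwarz-Pick bound on that derivative is \<open>\<bar>v\<^sub>2\<bar> \<le> \<bar>v\<^sub>1\<bar>\<close>, and \<open>\<bar>a\<bar> + \<bar>b\<bar> < 1\<close> is
  \<open>\<bar>v\<^sub>1\<bar> + \<bar>v\<^sub>3\<bar> < 1\<close>.
\<close>

lemma analytic_disc_through_0:
  assumes v: "metric0 v < 1" obtains y where "analytic_disc y 0 v"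
proof -
  have half: "\<exists>y. analytic_disc y 0 v" if "norm (v$2) \<le> norm (v$1)" "norm (v$1) + norm (v$3) < 1" for v
  proof -
    define c where "c = v$3"
    define k where "k = v$2 / cnj (v$1)"
    define s where "s = 1 - (norm c)\<^sup>2"
    define a where "a = v$1 / s"
    define b where "b = - cnj a * c"
    have c: "norm c < 1" using that(2) norm_ge_zero[of "v$1"] unfolding c_def by linarith
    have s: "s > 0" "s = (1 - norm c) * (1 + norm c)"
      using c by (simp_all add: s_def abs_square_less_1) (simp add: power2_eq_square algebra_simps)
    have k: "norm k \<le> 1" using that(1) by (simp add: k_def norm_divide divide_le_eq_1)
    have ab: "norm a + norm b < 1"
    proof -
      have "norm a = norm (v$1) / s" using s(1) by (simp add: a_def norm_divide)
      then have "norm a + norm b = norm (v$1) / s * (1 + norm c)"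
        by (simp add: b_def norm_mult distrib_left)
      also have "\<dots> = norm (v$1) / (1 - norm c)"
        unfolding s(2) using c by (simp add: divide_simps) (metis add_pos_nonneg less_irrefl norm_ge_zero zero_less_one)
      also have "\<dots> < 1" using c that(2) by (simp add: c_def)
      finally show ?thesis .
    qed
    note m = disc_moebius[OF c k]
    let ?m = "disc_moebius c k"
    define y where "y l = (vector [l * (a + cnj b * ?m l), b + cnj a * ?m l, l * ?m l] :: complex^3)" for l
    have v1: "a + cnj b * c = v$1"
    proof -
      have "a + cnj b * c = a * s" by (simp add: b_def s_def of_real_norm_power2 algebra_simps)
      moreover have "a * s = v$1" using s(1) by (simp add: a_def)
      ultimately show ?thesis by metis
    qed
    have v2: "cnj a * (k * s) = v$2"
      using s(1) that(1) by (cases "v$1 = 0") (simp_all add: a_def k_def)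
    have "analytic_disc y 0 v"
    proof (rule analytic_discI)
      show "y l \<in> \<E>" if "norm l < 1" for l
        using tetrablock_scale[OF beta_disc_in_tetrablock[OF ab m(2)[OF that]], of l] that
        by (simp add: y_def)
      show "y 0 = 0" by (simp add: y_def vec3_eq_iff m b_def)
      fix i :: 3
      consider "i = 1" | "i = 2" | "i = 3" using exhaust_3 by blast
      then show "(\<lambda>l. y l $ i) holomorphic_on \<D>"
        by cases (auto simp: y_def intro!: holomorphic_intros m)
      have dm: "(?m has_field_derivative k * s) (at 0)" using m(4) by (simp add: s_def)
      have "((\<lambda>l. l * (a + cnj b * ?m l)) has_field_derivative v$1) (at 0)"
        by (auto intro!: derivative_eq_intros dm simp: m(3) v1)
      moreover have "((\<lambda>l. b + cnj a * ?m l) has_field_derivative v$2) (at 0)"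
        by (auto intro!: derivative_eq_intros dm simp: v2[symmetric])
      moreover have "((\<lambda>l. l * ?m l) has_field_derivative v$3) (at 0)"
        by (auto intro!: derivative_eq_intros dm simp: m(3) c_def[symmetric])
      ultimately show "((\<lambda>l. y l $ i) has_field_derivative v $ i) (at 0)"
        using exhaust_3[of i] by (elim disjE) (simp_all add: y_def)
    qed
    then show ?thesis by blast
  qed
  consider "norm (v$2) \<le> norm (v$1)" | "norm (v$1) \<le> norm (v$2)" by linarith
  then show thesis
  proof cases
    case 1
    then show thesis using half[of v] v that by (auto simp: metric0_def)
  next
    case 2
    then obtain y where "analytic_disc y 0 (swap12 v)"
      using half[of "swap12 v"] v by (auto simp: metric0_def)
    moreover have "swap12 0 = 0" by (simp add: vec3_eq_iff)
    ultimately have "analytic_disc (\<lambda>l. swap12 (y l)) 0 v"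
      using analytic_disc_swap12 by fastforce
    then show thesis by (rule that)
  qed
qed

text \<open>
  Each \<open>\<Psi> \<eta>\<close> restricted to the disc is extremal in the Schwarz lemma, hence linear. For each point of the disc this
  gives a quadratic equation in \<open>\<eta>\<close> satisfied on the whole unit circle, so its coefficients vanish.
\<close>

lemma extremal_disc_unique:
  assumes y: "analytic_disc y 0 (vector [0, 0, b])" and b: "norm b = 1" and l: "norm l < 1"
  shows "y l = \<phi> 0 0 (b * l)"
proof (cases "l = 0")
  case True
  then show ?thesis using analytic_discD(3)[OF y] by (simp add: vec3_eq_iff)
next
  case False
  have 0: "(0::complex^3) = \<phi> 0 0 0" by (simp add: vec3_eq_iff)
  note y' = y[unfolded 0]
  have rel: "(b * l * y l $ 2) * \<eta>\<^sup>2 + (y l $ 3 - b * l) * \<eta> - y l $ 1 = 0" if \<eta>: "norm \<eta> = 1" for \<eta>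
  proof -
    note P = Psi_disc[OF y' \<eta>]
    have d: "deriv (\<lambda>l. \<Psi> \<eta> (y l)) 0 = - (b * \<eta>)" using DERIV_imp_deriv[OF P(4)] by simp
    then have "norm (deriv (\<lambda>l. \<Psi> \<eta> (y l)) 0) = 1" using b \<eta> by (simp add: norm_mult)
    then obtain a where a: "\<And>z. norm z < 1 \<Longrightarrow> \<Psi> \<eta> (y z) = a * z"
      using Schwarz_Lemma(3)[OF P(1) _ P(2) l] P(3) by auto
    have "((\<lambda>l. \<Psi> \<eta> (y l)) has_field_derivative a) (at 0)"
    proof (rule DERIV_cong_ev[THEN iffD2])
      show "\<forall>\<^sub>F x in nhds 0. \<Psi> \<eta> (y x) = a * x"
        using a by (intro eventually_nhds_in_open[of "\<D>", THEN eventually_mono]) auto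
      show "((*) a has_field_derivative a) (at 0)" by (rule derivative_eq_intros refl | simp)+
    qed auto
    then have "a = - (b * \<eta>)" using d DERIV_imp_deriv by metis
    then have e: "\<Psi> \<eta> (y l) = - (b * \<eta> * l)" using a[OF l] by simp
    have "norm (y l $ 1 - y l $ 3 * \<eta>) < norm (1 - y l $ 2 * \<eta>)"
      using tetrablock_norm_less[OF analytic_discD(1)[OF y l]] \<eta> by simp
    then have "y l $ 2 * \<eta> - 1 \<noteq> 0" by (metis eq_iff_diff_eq_0 norm_ge_zero norm_zero not_le)
    then have "y l $ 3 * \<eta> - y l $ 1 = - (b * \<eta> * l) * (y l $ 2 * \<eta> - 1)"
      using e unfolding Psi_def by (metis nonzero_mult_div_cancel_right times_divide_eq_left)
    then show ?thesis by (simp add: algebra_simps power2_eq_square)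
  qed
  have 1: "b * l * y l $ 2 + (y l $ 3 - b * l) - y l $ 1 = 0" using rel[of 1] by simp
  have 2: "b * l * y l $ 2 + (b * l - y l $ 3) - y l $ 1 = 0" using rel[of "-1"] by simp
  have "- (b * l * y l $ 2) + (y l $ 3 - b * l) * \<i> - y l $ 1 = 0" using rel[of \<i>] by simp
  moreover have "2 * (y l $ 3 - b * l)
      = (b * l * y l $ 2 + (y l $ 3 - b * l) - y l $ 1) - (b * l * y l $ 2 + (b * l - y l $ 3) - y l $ 1)"
    by (simp add: algebra_simps)
  then have "2 * (y l $ 3 - b * l) = 0" unfolding 1 2 by simp
  then have 3: "y l $ 3 = b * l" by simp
  ultimately have 4: "y l $ 1 = - (b * l * y l $ 2)" by simp
  then have "2 * (b * l * y l $ 2) = 0" using 1 3 by simp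
  then have "y l $ 2 = 0" using b False by auto
  then show ?thesis using 3 4 by (simp add: vec3_eq_iff)
qed

lemma leaf_disc:
  assumes r: "norm r < 1"
  shows "analytic_disc (\<lambda>l. \<phi> 0 0 (disc_moebius r 1 l)) (\<phi> 0 0 r) (vector [0, 0, complex_of_real (1 - (norm r)\<^sup>2)])"
proof (rule analytic_discI)
  note m = disc_moebius[OF r, of 1, simplified]
  show "\<phi> 0 0 (disc_moebius r 1 l) \<in> \<E>" if "norm l < 1" for l
    by (rule beta_disc_in_tetrablock) (use m that in auto)
  show "\<phi> 0 0 (disc_moebius r 1 0) = \<phi> 0 0 r" using m by simp
  fix i :: 3
  consider "i = 1" | "i = 2" | "i = 3" using exhaust_3 by blast
  then show "(\<lambda>l. \<phi> 0 0 (disc_moebius r 1 l) $ i) holomorphic_on \<D>"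
    "((\<lambda>l. \<phi> 0 0 (disc_moebius r 1 l) $ i) has_field_derivative vector [0, 0, complex_of_real (1 - (norm r)\<^sup>2)] $ i) (at 0)"
    by (cases; use m in simp)+
qed

text \<open>
  For \<open>\<omega> = 1\<close> these points form a copy of the symmetrized bidisc, the diagonal part \<open>x\<^sub>1 = x\<^sub>2\<close> of \<open>\<E>\<close>.
\<close>

lemma symmetrized_in_tetrablock:
  assumes z: "norm z < 1" and w: "norm w < 1" and \<omega>: "norm \<omega> = 1"
  shows "vector [\<omega> * ((z + w) / 2), cnj \<omega> * ((z + w) / 2), z * w] \<in> \<E>"
proof -
  define k where "k = (z + w) / 2 - cnj ((z + w) / 2) * (z * w)"
  have zw: "norm z * norm w < 1" using z w mult_strict_mono'[of "norm z" 1 "norm w" 1] by simp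
  have "2 * k = z * (1 - (norm w)\<^sup>2) + w * (1 - (norm z)\<^sup>2)"
    by (simp add: k_def of_real_norm_power2 field_simps)
  also have "norm \<dots> \<le> norm z * (1 - (norm w)\<^sup>2) + norm w * (1 - (norm z)\<^sup>2)"
  proof -
    have "norm (z * complex_of_real (1 - (norm w)\<^sup>2)) = norm z * (1 - (norm w)\<^sup>2)" 
      "norm (w * complex_of_real (1 - (norm z)\<^sup>2)) = norm w * (1 - (norm z)\<^sup>2)"
      unfolding norm_mult norm_of_real using power_le_one[of "norm w" 2] power_le_one[of "norm z" 2] z w by simp_all
    then show ?thesis using norm_triangle_ineq[of "z * complex_of_real (1 - (norm w)\<^sup>2)" "w * complex_of_real (1 - (norm z)\<^sup>2)"] by simp
  qed
  also have "\<dots> = (1 - norm z * norm w) * (norm z + norm w)" by (simp add: power2_eq_square algebra_simps)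
  also have "\<dots> < (1 - norm z * norm w) * (1 + norm z * norm w)"
  proof (rule mult_strict_left_mono)
    have "0 < (1 - norm z) * (1 - norm w)" using z w by simp
    then show "norm z + norm w < 1 + norm z * norm w" by (simp add: algebra_simps)
  qed (use zw in simp)
  also have "\<dots> = 1 - (norm (z * w))\<^sup>2" by (simp add: norm_mult power2_eq_square algebra_simps)
  finally have k: "2 * norm k < 1 - (norm (z * w))\<^sup>2" by (simp add: norm_mult)
  have "\<omega> * ((z + w) / 2) - cnj (cnj \<omega> * ((z + w) / 2)) * (z * w) = \<omega> * k"
       "cnj \<omega> * ((z + w) / 2) - cnj (\<omega> * ((z + w) / 2)) * (z * w) = cnj \<omega> * k"
    by (simp_all add: k_def right_diff_distrib mult_ac)
  then show ?thesis unfolding tetrablock_eq mem_Collect_eq vector_3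
    using k \<omega> zw by (simp add: norm_mult)
qed

text \<open>
  The points \<open>z = \<i> \<surd>r\<close> and \<open>w = - \<i> \<surd>r\<close> represent \<open>(0, 0, r)\<close>. Move them simultaneously along extremal
  discs, with conjugate directions proportional to \<open>1 + \<i> e\<close> and \<open>1 - \<i> e\<close>. As both have modulus
  \<open>\<surd>(1 + e\<^sup>2)\<close>, the length of the velocity changes only to second order in \<open>e\<close>.
\<close>

lemma symmetrized_disc:
  assumes r: "0 \<le> r" "r < 1" and \<omega>: "norm \<omega> = 1"
  obtains y where "analytic_disc y (\<phi> 0 0 (complex_of_real r))
    (complex_of_real ((1 - r) / sqrt (1 + e\<^sup>2)) *s vector [\<omega>, cnj \<omega>, 2 * sqrt r * e])"
proof -
  define s where "s = sqrt (1 + e\<^sup>2)"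
  have s: "s > 0" by (simp add: s_def add_pos_nonneg)
  define k where "k = Complex 1 e / s"
  have ck: "norm (Complex 1 e) = s" by (simp add: s_def cmod_def)
  have k: "norm k \<le> 1" "norm (cnj k) \<le> 1" using s by (simp_all add: k_def norm_divide ck)
  define c where "c = \<i> * sqrt r"
  have nc: "(norm c)\<^sup>2 = r" using r by (simp add: c_def norm_mult)
  have "(norm c)\<^sup>2 < 1\<^sup>2" using nc r by simp
  then have c: "norm c < 1" "norm (- c) < 1" using power2_less_imp_less[of "norm c" 1] by simp_all
  have cc: "- (c * c) = r"
  proof -
    have "complex_of_real (sqrt r) * complex_of_real (sqrt r) = r"
      using r unfolding of_real_mult[symmetric] by simp
    then show ?thesis by (simp add: c_def algebra_simps)
  qed
  note mz = disc_moebius[OF c(1) k(1)] and mw = disc_moebius[OF c(2) k(2)]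
  let ?z = "disc_moebius c k" and ?w = "disc_moebius (- c) (cnj k)"
  define y where "y l = (vector [\<omega> * ((?z l + ?w l) / 2), cnj \<omega> * ((?z l + ?w l) / 2), ?z l * ?w l] :: complex^3)" for l
  define v :: "complex^3" where "v = complex_of_real ((1 - r) / s) *s vector [\<omega>, cnj \<omega>, 2 * sqrt r * e]"
  have dz: "(?z has_field_derivative k * (1 - r)) (at 0)" using mz(4) by (simp add: nc)
  have dw: "(?w has_field_derivative cnj k * (1 - r)) (at 0)" using mw(4) by (simp add: nc)
  have kk: "k + cnj k = 2 / s" "cnj k - k = - 2 * \<i> * e / s"
    by (simp_all add: k_def complex_eq_iff)
  have sum: "(k * (1 - r) + cnj k * (1 - r)) / 2 = (1 - r) / s"
  proof -
    have "(k * (1 - r) + cnj k * (1 - r)) / 2 = (k + cnj k) * (1 - r) / 2" by (simp only: distrib_right)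
    also have "\<dots> = (1 - r) / s" unfolding kk using s by (simp add: divide_simps)
    finally show ?thesis .
  qed
  have prod: "k * (1 - r) * (- c) + cnj k * (1 - r) * c = (1 - r) / s * (2 * sqrt r * e)"
  proof -
    have "k * (1 - r) * (- c) + cnj k * (1 - r) * c = (cnj k - k) * c * (1 - r)" by (simp add: algebra_simps)
    also have "\<dots> = (1 - r) / s * (2 * sqrt r * e)"
      unfolding kk c_def using s by (simp add: divide_simps)
    finally show ?thesis .
  qed
  have "analytic_disc y (\<phi> 0 0 (complex_of_real r)) v"
  proof (rule analytic_discI)
    show "y l \<in> \<E>" if "norm l < 1" for l
      unfolding y_def by (rule symmetrized_in_tetrablock) (use mz mw that \<omega> in auto)
    show "y 0 = \<phi> 0 0 (complex_of_real r)" using cc by (simp add: y_def vec3_eq_iff mz mw)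
    fix i :: 3
    consider "i = 1" | "i = 2" | "i = 3" using exhaust_3 by blast
    then show "(\<lambda>l. y l $ i) holomorphic_on \<D>"
      by cases (auto simp: y_def intro!: holomorphic_intros mz mw)
    have "((\<lambda>l. (?z l + ?w l) / 2) has_field_derivative (k * (1 - r) + cnj k * (1 - r)) / 2) (at 0)"
      by (rule DERIV_cdivide[OF DERIV_add[OF dz dw]])
    then have S: "((\<lambda>l. (?z l + ?w l) / 2) has_field_derivative (1 - r) / s) (at 0)" unfolding sum .
    have "((\<lambda>l. ?z l * ?w l) has_field_derivative (k * (1 - r) * ?w 0 + cnj k * (1 - r) * ?z 0)) (at 0)"
      by (rule DERIV_mult[OF dz dw])
    then have P: "((\<lambda>l. ?z l * ?w l) has_field_derivative (1 - r) / s * (2 * sqrt r * e)) (at 0)"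
      unfolding mz(3) mw(3) prod .
    show "((\<lambda>l. y l $ i) has_field_derivative v $ i) (at 0)"
      using exhaust_3[of i] DERIV_cmult[OF S, of \<omega>] DERIV_cmult[OF S, of "cnj \<omega>"] P
      by (elim disjE) (simp_all add: y_def v_def mult.commute)
  qed
  then show thesis using that unfolding v_def s_def by blast
qed

section \<open>Derivatives of automorphisms\<close>

text \<open>
  An automorphism of \<open>\<E>\<close> together with its inverse. Values outside \<open>\<E>\<close> are arbitrary here, which avoids
  restrictions in compositions.
\<close>

definition inverse_automorphisms :: "(complex ^ 3 \<Rightarrow> complex ^ 3) \<Rightarrow> (complex ^ 3 \<Rightarrow> complex ^ 3) \<Rightarrow> bool" where
  "inverse_automorphisms f g \<longleftrightarrow>
     analytic_map_on f \<E> \<and> analytic_map_on g \<E> \<and> f ` \<E> \<subseteq> \<E> \<and> g ` \<E> \<subseteq> \<E> \<and>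
     (\<forall>x\<in>\<E>. g (f x) = x) \<and> (\<forall>x\<in>\<E>. f (g x) = x)"

lemma inverse_automorphisms_sym: "inverse_automorphisms f g \<Longrightarrow> inverse_automorphisms g f"
  by (auto simp: inverse_automorphisms_def)

lemma analytic_map_onE:
  assumes "analytic_map_on f S" "x \<in> S"
  obtains A where "(f has_derivative A) (at x within S)" "\<And>c u. A (c *s u) = c *s A u"
    "\<And>u v. A (u + v) = A u + A v"
  using assms unfolding analytic_map_on_def Vector_Spaces.linear_iff by blast

text \<open>
  As \<open>\<E>\<close> is open, the derivative of the identity of \<open>\<E>\<close> is unique.
\<close>

lemma inverse_automorphisms_derivatives:
  assumes fg: "inverse_automorphisms f g" and x: "x \<in> \<E>"
    and A: "(f has_derivative A) (at x within \<E>)" and B: "(g has_derivative B) (at (f x) within \<E>)"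
  shows "B (A u) = u"
proof -
  have "f ` \<E> \<subseteq> \<E>" using fg by (auto simp: inverse_automorphisms_def)
  then have "(g has_derivative B) (at (f x) within f ` \<E>)" using B by (rule has_derivative_subset[rotated])
  with A have "(g \<circ> f has_derivative B \<circ> A) (at x within \<E>)" by (rule diff_chain_within)
  then have "((\<lambda>x. x) has_derivative B \<circ> A) (at x within \<E>)"
    by (rule has_derivative_transform[OF x, rotated])
       (use fg in \<open>auto simp: inverse_automorphisms_def\<close>)
  then have "((\<lambda>x. x) has_derivative B \<circ> A) (at x)"
    using at_within_open[OF x open_tetrablock] by simp
  then have "B \<circ> A = (\<lambda>u. u)" using has_derivative_unique has_derivative_ident by blast
  then show ?thesis by (metis comp_apply)
qed

text \<open>
  What is known about the norm \<open>v \<mapsto> metric0 (B v)\<close> on tangent vectors at \<open>(0, 0, r)\<close> when \<open>B\<close> is the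
  derivative of an automorphism moving this point to the origin: upper bounds from discs through
  \<open>(0, 0, r)\<close>, and lower bounds from the functions \<open>\<Psi> \<eta>\<close>.
\<close>

definition transports_metric :: "complex \<Rightarrow> (complex ^ 3 \<Rightarrow> complex ^ 3) \<Rightarrow> bool" where
  "transports_metric r B \<longleftrightarrow>
     (\<forall>y v. analytic_disc y (\<phi> 0 0 r) v \<longrightarrow> metric0 (B v) \<le> 1) \<and>
     (\<forall>v \<eta>. norm \<eta> = 1 \<longrightarrow>
        norm (v$1 - v$3 * \<eta> - r * \<eta>\<^sup>2 * v$2) \<le> (1 - (norm r)\<^sup>2) * metric0 (B v) \<and>
        norm (v$2 - v$3 * \<eta> - r * \<eta>\<^sup>2 * v$1) \<le> (1 - (norm r)\<^sup>2) * metric0 (B v))"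

lemma leaf_point_in_tetrablock: "norm r < 1 \<Longrightarrow> \<phi> 0 0 r \<in> \<E>"
  by (simp add: beta_disc_in_tetrablock)

lemma zero_eq_beta_disc: "(0::complex^3) = \<phi> 0 0 0"
  by (simp add: vec3_eq_iff)

lemma zero_in_tetrablock: "0 \<in> \<E>"
  unfolding zero_eq_beta_disc by (rule leaf_point_in_tetrablock) simp

text \<open>
  Upper bound: push a disc through \<open>(0, 0, r)\<close> forward by \<open>g\<close>. Lower bound: a disc through the origin
  with velocity proportional to \<open>B v\<close> is pushed by \<open>f\<close> to a disc with velocity proportional to \<open>v\<close>, to which the
  Schwarz-Pick bound applies.
\<close>

lemma metric_transport:
  assumes fg: "inverse_automorphisms f g" and r: "norm r < 1" and f0: "f 0 = \<phi> 0 0 r"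
  obtains B A where "transports_metric r B"
    "\<And>u v. B (u + v) = B u + B v" "\<And>c u. B (c *s u) = c *s B u" "\<And>u. B (A u) = u"
    "\<And>y v. analytic_disc y (\<phi> 0 0 r) v \<Longrightarrow> analytic_disc (\<lambda>l. g (y l)) 0 (B v)"
proof -
  let ?p = "\<phi> 0 0 r"
  note an = fg[unfolded inverse_automorphisms_def]
  have p: "?p \<in> \<E>" using r by (rule leaf_point_in_tetrablock)
  have gp: "g ?p = 0" using an zero_in_tetrablock f0 by metis
  obtain A where A: "(f has_derivative A) (at 0 within \<E>)" "\<And>c u. A (c *s u) = c *s A u"
    using an zero_in_tetrablock by (metis analytic_map_onE)
  obtain B where B: "(g has_derivative B) (at ?p within \<E>)" "\<And>c u. B (c *s u) = c *s B u"
    "\<And>u v. B (u + v) = B u + B v"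
    using an p by (metis analytic_map_onE)
  have BA: "B (A u) = u" for u
    using inverse_automorphisms_derivatives[OF fg zero_in_tetrablock A(1)] B(1) f0 by simp
  have AB: "A (B u) = u" for u
    using inverse_automorphisms_derivatives[OF inverse_automorphisms_sym[OF fg] p B(1)] A(1) gp by simp
  have push: "analytic_disc (\<lambda>l. g (y l)) 0 (B v)" if "analytic_disc y ?p v" for y v
    using analytic_disc_compose[OF that _ _ B(1,2)] an gp by simp
  have upper: "metric0 (B v) \<le> 1" if "analytic_disc y ?p v" for y v
    using push[OF that] by (rule metric0_le_1)
  define \<rho> where "\<rho> = 1 - (norm r)\<^sup>2"
  have \<rho>: "\<rho> > 0" using r by (simp add: \<rho>_def abs_square_less_1)
  have lower: "norm (v$1 - v$3 * \<eta> - r * \<eta>\<^sup>2 * v$2) \<le> \<rho> * metric0 (B v) \<and>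
        norm (v$2 - v$3 * \<eta> - r * \<eta>\<^sup>2 * v$1) \<le> \<rho> * metric0 (B v)" if \<eta>: "norm \<eta> = 1" for v \<eta>
  proof -
    have *: "norm (v$1 - v$3 * \<eta> - r * \<eta>\<^sup>2 * v$2) / \<rho> \<le> s \<and> norm (v$2 - v$3 * \<eta> - r * \<eta>\<^sup>2 * v$1) / \<rho> \<le> s"
      if s: "metric0 (B v) < s" for s
    proof -
      have s0: "s > 0" using s norm_ge_zero[of "B v $ 1"] norm_ge_zero[of "B v $ 3"] unfolding metric0_def by linarith
      \<comment> \<open>rescaling \<open>B v\<close> to \<open>metric0\<close> less than \<open>1\<close>, so that a disc with this velocity exists\<close>
      define c where "c = complex_of_real (1 / s)"
      have nc: "norm c = 1 / s" using s0 by (simp add: c_def norm_divide)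
      have "metric0 (c *s B v) < 1" unfolding metric0_scale nc using s s0 by simp
      then obtain y where "analytic_disc y 0 (c *s B v)" by (rule analytic_disc_through_0)
      from analytic_disc_compose[OF this _ _ A] have "analytic_disc (\<lambda>l. f (y l)) ?p (c *s v)"
        using an f0 by (simp add: A(2) AB)
      note bd = analytic_disc_tangent_bound[OF this \<eta>]
      have "norm (c * (v$1 - v$3 * \<eta> - r * \<eta>\<^sup>2 * v$2)) \<le> \<rho>" "norm (c * (v$2 - v$3 * \<eta> - r * \<eta>\<^sup>2 * v$1)) \<le> \<rho>"
        using bd by (simp_all add: \<rho>_def right_diff_distrib mult_ac)
      then show ?thesis using s0 \<rho> unfolding norm_mult nc by (simp add: field_simps)
    qed
    have "norm (v$1 - v$3 * \<eta> - r * \<eta>\<^sup>2 * v$2) / \<rho> \<le> metric0 (B v)"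
         "norm (v$2 - v$3 * \<eta> - r * \<eta>\<^sup>2 * v$1) / \<rho> \<le> metric0 (B v)"
      by (rule dense_ge; use * in blast)+
    then show ?thesis using \<rho> by (simp add: field_simps)
  qed
  show thesis
    by (rule that[of B A]) (use upper lower push B BA in \<open>auto simp: transports_metric_def \<rho>_def\<close>)
qed

lemma nonpos_if_le_small_multiples:
  fixes a C :: real
  assumes "\<And>s. 0 < s \<Longrightarrow> s < 1 \<Longrightarrow> a \<le> s * C" shows "a \<le> 0"
proof (rule ccontr)
  assume a: "\<not> a \<le> 0"
  define t where "t = a + \<bar>C\<bar>"
  have t: "t > 0" "a \<le> t" using a by (simp_all add: t_def)
  define s where "s = a / (2 * t)"
  have s: "0 < s" "s < 1" using a t by (simp_all add: s_def field_simps)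
  have "s * C \<le> s * t" using s a by (intro mult_left_mono) (auto simp: t_def)
  also have "\<dots> = a / 2" using t by (simp add: s_def)
  finally show False using assms[OF s] a by simp
qed

lemma sqrt_one_plus_square_le: "sqrt (1 + x\<^sup>2) \<le> 1 + x\<^sup>2 / 2"
proof (rule real_le_lsqrt)
  have "(1 + x\<^sup>2 / 2)\<^sup>2 = 1 + x\<^sup>2 + (x\<^sup>2 / 2)\<^sup>2" by (simp add: power2_sum)
  then show "1 + x\<^sup>2 \<le> (1 + x\<^sup>2 / 2)\<^sup>2" by simp
qed simp

text \<open>
  The second symmetric difference of the norm at \<open>n\<close> in the real direction \<open>w\<close> is quadratically small: in this direction, the
  norm has no corner at \<open>n\<close>.
\<close>

definition flat_direction :: "complex ^ 3 \<Rightarrow> complex ^ 3 \<Rightarrow> bool" where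
  "flat_direction n w \<longleftrightarrow> (\<exists>K. \<forall>\<delta>. 0 < \<delta> \<longrightarrow> \<delta> < 1 \<longrightarrow>
     metric0 (n + complex_of_real \<delta> *s w) + metric0 (n - complex_of_real \<delta> *s w) \<le> 2 * metric0 n + K * \<delta>\<^sup>2)"

lemma flat_directionI:
  assumes "\<And>\<delta>. 0 < \<delta> \<Longrightarrow> \<delta> < 1 \<Longrightarrow>
     metric0 (n + complex_of_real \<delta> *s w) + metric0 (n - complex_of_real \<delta> *s w) \<le> 2 * metric0 n + K * \<delta>\<^sup>2"
  shows "flat_direction n w"
  using assms unfolding flat_direction_def by blast

text \<open>
  Suppose that \<open>n\<^sub>1 \<noteq> 0\<close> dominates \<open>n\<^sub>2\<close>; the opposite case is symmetric. Then \<open>metric0\<close> is flat at \<open>n\<close> in the direction that rotates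
  \<open>n\<^sub>1\<close> alone. By hypothesis this direction is parallel to \<open>n\<close>, so the other coordinates vanish. But then
  the second coordinate can be moved without changing the norm, and that direction is not parallel
  to \<open>n\<close>.
\<close>

lemma axis_of_flat_directions:
  assumes par: "\<And>w. flat_direction n w \<Longrightarrow> \<exists>\<kappa>. w = \<kappa> *s n"
  shows "n$1 = 0" "n$2 = 0"
proof -
  have *: "n$1 = 0" if n21: "norm (n$2) \<le> norm (n$1)"
    and par: "\<And>w. flat_direction n w \<Longrightarrow> \<exists>\<kappa>. w = \<kappa> *s n" for n
  proof (rule ccontr)
    assume n1: "n$1 \<noteq> 0"
    \<comment> \<open>rotation of the first coordinate alone\<close>
    define w :: "complex^3" where "w = vector [\<i> * n$1, 0, 0]"
    have "\<exists>\<kappa>. w = \<kappa> *s n"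
    proof (rule par, rule flat_directionI)
      fix \<delta> :: real assume "0 < \<delta>" "\<delta> < 1"
      have one: "metric0 (n + complex_of_real d *s w) \<le> metric0 n + norm (n$1) / 2 * \<delta>\<^sup>2" if "d\<^sup>2 = \<delta>\<^sup>2" for d
      proof -
        have "n$1 + d * (\<i> * n$1) = Complex 1 d * n$1"
          by (simp add: complex_eq_iff)
        moreover have "norm (Complex 1 d) = sqrt (1 + \<delta>\<^sup>2)" by (simp add: cmod_def that)
        ultimately have "norm (n$1 + d * (\<i> * n$1)) = sqrt (1 + \<delta>\<^sup>2) * norm (n$1)"
          by (simp only: norm_mult)
        also have "sqrt (1 + \<delta>\<^sup>2) \<le> 1 + \<delta>\<^sup>2 / 2"
          by (rule sqrt_one_plus_square_le)
        finally have "norm (n$1 + d * (\<i> * n$1)) \<le> norm (n$1) + norm (n$1) / 2 * \<delta>\<^sup>2"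
          by (simp add: mult_right_mono algebra_simps)
        moreover have "0 \<le> norm (n$1) / 2 * \<delta>\<^sup>2" by simp
        then have "norm (n$2) \<le> norm (n$1) + norm (n$1) / 2 * \<delta>\<^sup>2" using n21 by linarith
        ultimately show ?thesis using n21 by (simp add: metric0_def w_def)
      qed
      have m: "n - complex_of_real \<delta> *s w = n + complex_of_real (- \<delta>) *s w"
        by (simp add: vec3_eq_iff)
      show "metric0 (n + complex_of_real \<delta> *s w) + metric0 (n - complex_of_real \<delta> *s w) \<le> 2 * metric0 n + norm (n$1) * \<delta>\<^sup>2"
        unfolding m using one[of \<delta>] one[of "- \<delta>"] by simp
    qed
    then obtain \<kappa> where "w = \<kappa> *s n" by blast
    then have k: "\<i> * n$1 = \<kappa> * n$1" "\<kappa> * n$2 = 0" "\<kappa> * n$3 = 0"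
      by (simp_all add: vec3_eq_iff w_def)
    then have "\<kappa> = \<i>" using n1 by simp
    then have n23: "n$2 = 0" "n$3 = 0" using k by simp_all
    \<comment> \<open>movement of the second coordinate alone, which has room below \<open>\<bar>n\<^sub>1\<bar>\<close>\<close>
    define u :: "complex^3" where "u = vector [0, n$1, 0]"
    have "\<exists>\<kappa>. u = \<kappa> *s n"
    proof (rule par, rule flat_directionI)
      fix \<delta> :: real assume d: "0 < \<delta>" "\<delta> < 1"
      then have "norm (\<delta> * n$1) \<le> norm (n$1)" by (simp add: norm_mult mult_left_le_one_le)
      then show "metric0 (n + complex_of_real \<delta> *s u) + metric0 (n - complex_of_real \<delta> *s u) \<le> 2 * metric0 n + 0 * \<delta>\<^sup>2"
        by (simp add: metric0_def u_def n23)
    qed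
    then obtain \<kappa> where "u = \<kappa> *s n" by blast
    then show False using n1 n23 by (auto simp: vec3_eq_iff u_def)
  qed
  have sw: "metric0 (swap12 v) = metric0 v" for v by (simp add: metric0_def max.commute)
  have par': "\<exists>\<kappa>. w = \<kappa> *s swap12 n" if w: "flat_direction (swap12 n) w" for w
  proof -
    have e: "n + complex_of_real \<delta> *s swap12 w = swap12 (swap12 n + complex_of_real \<delta> *s w)"
      "n - complex_of_real \<delta> *s swap12 w = swap12 (swap12 n - complex_of_real \<delta> *s w)" for \<delta>
      by (simp_all add: vec3_eq_iff)
    have "\<exists>\<kappa>. swap12 w = \<kappa> *s n"
      by (rule par) (use w in \<open>simp add: flat_direction_def e sw\<close>)
    then show ?thesis by (auto simp: vec3_eq_iff)
  qed
  have "n$1 = 0 \<and> n$2 = 0"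
  proof (cases "norm (n$2) \<le> norm (n$1)")
    case True
    then show ?thesis using *[OF True par] by simp
  next
    case False
    then have "norm (swap12 n $ 2) \<le> norm (swap12 n $ 1)" by simp
    from *[OF this par'] have "n$2 = 0" by simp
    then show ?thesis using False by simp
  qed
  then show "n$1 = 0" "n$2 = 0" by blast+
qed

text \<open>
  Let \<open>n = B e\<^sub>3\<close>, let \<open>w = B v\<close> be a flat direction at \<open>n\<close>, and add the lower bounds for \<open>e\<^sub>3 + \<delta> v\<close> with \<open>\<eta>\<close> and
  for \<open>e\<^sub>3 - \<delta> v\<close> with \<open>- \<eta>\<close>. The terms with \<open>v\<^sub>3\<close> cancel and the terms with \<open>v\<^sub>1\<close> and
  \<open>v\<^sub>2\<close> add up, so their real part must vanish for all \<open>\<eta>\<close>. This forces \<open>v\<^sub>1 = v\<^sub>2 = 0\<close>, that is, \<open>w\<close>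
  is parallel to \<open>n\<close>, and \<open>axis_of_flat_directions\<close> applies.
\<close>

lemma transport_third_axis:
  assumes T: "transports_metric r B" and r: "norm r < 1"
    and add: "\<And>u v. B (u + v) = B u + B v" and scale: "\<And>c u. B (c *s u) = c *s B u" and BA: "\<And>u. B (A u) = u"
  obtains b where "B (vector [0, 0, 1]) = vector [0, 0, b]" "norm b = 1 / (1 - (norm r)\<^sup>2)"
proof -
  define \<rho> where "\<rho> = 1 - (norm r)\<^sup>2"
  have \<rho>: "\<rho> > 0" using r by (simp add: \<rho>_def abs_square_less_1)
  define e :: "complex^3" where "e = vector [0, 0, 1]"
  define n where "n = B e"
  have lower: "norm (v$1 - v$3 * \<eta> - r * \<eta>\<^sup>2 * v$2) \<le> \<rho> * metric0 (B v)"
    "norm (v$2 - v$3 * \<eta> - r * \<eta>\<^sup>2 * v$1) \<le> \<rho> * metric0 (B v)" if "norm \<eta> = 1" for v \<eta>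
    using T that unfolding transports_metric_def \<rho>_def by blast+
  have "metric0 (B (vector [0, 0, complex_of_real \<rho>])) \<le> 1"
    using T leaf_disc[OF r] unfolding transports_metric_def \<rho>_def by blast
  moreover have "vector [0, 0, complex_of_real \<rho>] = complex_of_real \<rho> *s e" by (simp add: vec3_eq_iff e_def)
  ultimately have "\<rho> * metric0 n \<le> 1" using \<rho> by (simp add: scale metric0_scale n_def)
  moreover have "1 \<le> \<rho> * metric0 n" using lower(1)[of 1 e] by (simp add: n_def e_def)
  ultimately have mn: "\<rho> * metric0 n = 1" by simp
  have flat: "\<exists>\<kappa>. w = \<kappa> *s n" if fl: "flat_direction n w" for w
  proof -
    obtain K where w: "\<And>\<delta>. 0 < \<delta> \<Longrightarrow> \<delta> < 1 \<Longrightarrow> metric0 (n + complex_of_real \<delta> *s w)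
        + metric0 (n - complex_of_real \<delta> *s w) \<le> 2 * metric0 n + K * \<delta>\<^sup>2"
      using fl unfolding flat_direction_def by blast
    define v where "v = A w"
    have Bv: "B v = w" by (simp add: v_def BA)
    have step: "Re (r * \<eta> * q - cnj \<eta> * p) \<le> 0"
      if \<eta>: "norm \<eta> = 1" and
        low: "\<And>\<delta> \<eta>. norm \<eta> = 1 \<Longrightarrow> norm (\<delta> * p - (1 + \<delta> * v$3) * \<eta> - r * \<eta>\<^sup>2 * (\<delta> * q)) \<le> \<rho> * metric0 (n + complex_of_real \<delta> *s w)"
      for \<eta> p q
    proof -
      have lo: "1 + \<delta> * (Re (v$3) + Re (r * \<eta> * q - cnj \<eta> * p)) \<le> \<rho> * metric0 (n + complex_of_real \<delta> *s w)"
        if \<eta>: "norm \<eta> = 1" for \<delta> \<eta>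
      proof -
        have "1 + \<delta> * (Re (v$3) + Re (r * \<eta> * q - cnj \<eta> * p))
            = Re (1 + complex_of_real \<delta> * (v$3 + (r * \<eta> * q - cnj \<eta> * p)))"
          by simp
        also have "1 + complex_of_real \<delta> * (v$3 + (r * \<eta> * q - cnj \<eta> * p))
            = - cnj \<eta> * (\<delta> * p - (1 + \<delta> * v$3) * \<eta> - r * \<eta>\<^sup>2 * (\<delta> * q))"
        proof -
          have "cnj \<eta> * \<eta> = 1" using mult_cnj_eq_1[OF \<eta>] by (simp add: mult.commute)
          moreover have "- cnj \<eta> * (\<delta> * p - (1 + \<delta> * v$3) * \<eta> - r * \<eta>\<^sup>2 * (\<delta> * q))
             = (cnj \<eta> * \<eta>) * (1 + \<delta> * v$3 + r * \<eta> * (\<delta> * q)) - cnj \<eta> * (\<delta> * p)"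
            by (simp add: algebra_simps power2_eq_square)
          ultimately show ?thesis by (simp add: algebra_simps)
        qed
        also have "Re \<dots> \<le> norm \<dots>" by (rule complex_Re_le_cmod)
        also have "\<dots> \<le> \<rho> * metric0 (n + complex_of_real \<delta> *s w)"
          using low[OF \<eta>, of \<delta>] \<eta> by (simp add: norm_mult)
        finally show ?thesis .
      qed
      have "Re (r * \<eta> * q - cnj \<eta> * p) \<le> \<delta> * (\<rho> * K / 2)" if d: "0 < \<delta>" "\<delta> < 1" for \<delta>
      proof -
        have m: "n - complex_of_real \<delta> *s w = n + complex_of_real (- \<delta>) *s w"
          by (simp add: vec3_eq_iff)
        have "2 + 2 * \<delta> * Re (r * \<eta> * q - cnj \<eta> * p)
            \<le> \<rho> * metric0 (n + complex_of_real \<delta> *s w) + \<rho> * metric0 (n - complex_of_real \<delta> *s w)"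
          using lo[of \<eta> \<delta>] lo[of "- \<eta>" "- \<delta>"] \<eta> unfolding m by (simp add: algebra_simps)
        also have "\<dots> \<le> \<rho> * (2 * metric0 n + K * \<delta>\<^sup>2)"
          using mult_left_mono[OF w[OF d], of \<rho>] \<rho> by (simp add: distrib_left)
        also have "\<dots> = 2 + \<delta> * (\<delta> * (\<rho> * K))" using mn by (simp add: algebra_simps power2_eq_square)
        finally have "2 * \<delta> * Re (r * \<eta> * q - cnj \<eta> * p) \<le> \<delta> * (\<delta> * (\<rho> * K))" by linarith
        then have "\<delta> * (2 * Re (r * \<eta> * q - cnj \<eta> * p)) \<le> \<delta> * (\<delta> * (\<rho> * K))"
          by (simp only: mult.assoc mult.left_commute[of 2])
        then show ?thesis using d by simp
      qed
      then show ?thesis by (rule nonpos_if_le_small_multiples)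
    qed
    have lin: "B (e + complex_of_real \<delta> *s v) = n + complex_of_real \<delta> *s w" for \<delta>
      by (simp add: add scale Bv n_def)
    have step1: "Re (r * \<eta> * v$2 - cnj \<eta> * v$1) \<le> 0" if "norm \<eta> = 1" for \<eta>
    proof (rule step[OF that])
      fix \<delta> :: real and \<eta> :: complex assume "norm \<eta> = 1"
      from lower(1)[OF this, of "e + complex_of_real \<delta> *s v"]
      show "norm (\<delta> * v$1 - (1 + \<delta> * v$3) * \<eta> - r * \<eta>\<^sup>2 * (\<delta> * v$2)) \<le> \<rho> * metric0 (n + complex_of_real \<delta> *s w)"
        unfolding lin by (simp add: e_def)
    qed
    have step2: "Re (r * \<eta> * v$1 - cnj \<eta> * v$2) \<le> 0" if "norm \<eta> = 1" for \<eta>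
    proof (rule step[OF that])
      fix \<delta> :: real and \<eta> :: complex assume "norm \<eta> = 1"
      from lower(2)[OF this, of "e + complex_of_real \<delta> *s v"]
      show "norm (\<delta> * v$2 - (1 + \<delta> * v$3) * \<eta> - r * \<eta>\<^sup>2 * (\<delta> * v$1)) \<le> \<rho> * metric0 (n + complex_of_real \<delta> *s w)"
        unfolding lin by (simp add: e_def)
    qed
    have conj: "p = cnj (r * q)" if "\<And>\<eta>. norm \<eta> = 1 \<Longrightarrow> Re (r * \<eta> * q - cnj \<eta> * p) \<le> 0" for p q
      using that[of 1] that[of "-1"] that[of \<i>] that[of "-\<i>"] by (simp add: complex_eq_iff)
    have c1: "v$1 = cnj (r * v$2)" and c2: "v$2 = cnj (r * v$1)"
      using conj step1 step2 by blast+
    have "norm (v$1) = norm r * norm (v$2)" using c1 by (metis complex_mod_cnj norm_mult)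
    also have "norm (v$2) = norm r * norm (v$1)" using c2 by (metis complex_mod_cnj norm_mult)
    finally have "\<rho> * norm (v$1) = 0" by (simp add: \<rho>_def power2_eq_square algebra_simps)
    then have "v$1 = 0" "v$2 = 0" using \<rho> c2 by auto
    then have "v = v$3 *s e" by (simp add: vec3_eq_iff e_def)
    then have "w = v$3 *s n" using Bv scale n_def by metis
    then show ?thesis by blast
  qed
  have n0: "n$1 = 0" "n$2 = 0" using axis_of_flat_directions[of n] flat by blast+
  have "n = vector [0, 0, n$3]" using n0 by (simp add: vec3_eq_iff)
  moreover have "norm (n$3) = 1 / \<rho>" using mn \<rho> n0 by (simp add: metric0_def field_simps)
  ultimately show thesis using that unfolding n_def e_def \<rho>_def by blast
qed

text \<open>
  The modulus has slope \<open>Re h / \<bar>h\<bar>\<close> along the real direction at \<open>h \<noteq> 0\<close>, and a corner at \<open>h = 0\<close>.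
\<close>

lemma imaginary_if_quadratic_growth:
  fixes h :: complex
  assumes "\<And>t::real. norm (h + t) \<le> norm h + K * t\<^sup>2"
  shows "h \<noteq> 0" "Re h = 0"
proof -
  have "False" if "h = 0"
  proof -
    have "1 \<le> s * K" if "0 < s" "s < 1" for s
      using assms[of s] that \<open>h = 0\<close> by (simp add: power2_eq_square mult.commute)
    from nonpos_if_le_small_multiples[OF this] show False by simp
  qed
  then show "h \<noteq> 0" by blast
  have bound: "t * (2 * Re h) \<le> t\<^sup>2 * (2 * norm h * K + K\<^sup>2)" if "\<bar>t\<bar> < 1" for t :: real
  proof -
    have t: "t\<^sup>2 \<le> 1" "t\<^sup>2 \<ge> 0" using that by (simp_all add: abs_square_le_1)
    have "(norm (h + t))\<^sup>2 \<le> (norm h + K * t\<^sup>2)\<^sup>2"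
      using assms by (intro power_mono) auto
    moreover have "(norm (h + t))\<^sup>2 = (norm h)\<^sup>2 + t * (2 * Re h) + t\<^sup>2"
      unfolding cmod_power2 by (simp add: power2_eq_square algebra_simps)
    moreover have "(norm h + K * t\<^sup>2)\<^sup>2 = (norm h)\<^sup>2 + t\<^sup>2 * (2 * norm h * K + t\<^sup>2 * K\<^sup>2)"
      by (simp add: power2_eq_square algebra_simps)
    moreover have "t\<^sup>2 * (t\<^sup>2 * K\<^sup>2) \<le> t\<^sup>2 * K\<^sup>2"
      using t mult_right_mono[of "t\<^sup>2" 1 "K\<^sup>2"] by (intro mult_left_mono) auto
    ultimately have "t * (2 * Re h) + t\<^sup>2 \<le> t\<^sup>2 * (2 * norm h * K) + t\<^sup>2 * K\<^sup>2"
      by (simp add: distrib_left)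
    then show ?thesis using t(2) unfolding distrib_left by linarith
  qed
  have "2 * Re h \<le> 0"
  proof (rule nonpos_if_le_small_multiples)
    fix s :: real assume "0 < s" "s < 1"
    then show "2 * Re h \<le> s * (2 * norm h * K + K\<^sup>2)"
      using bound[of s] by (simp add: power2_eq_square mult.assoc)
  qed
  moreover have "- (2 * Re h) \<le> 0"
  proof (rule nonpos_if_le_small_multiples)
    fix s :: real assume s: "0 < s" "s < 1"
    then have "s * (- (2 * Re h)) \<le> s * (s * (2 * norm h * K + K\<^sup>2))"
      using bound[of "- s"] by (simp add: power2_eq_square mult.assoc)
    then show "- (2 * Re h) \<le> s * (2 * norm h * K + K\<^sup>2)"
      using s(1) by (simp only: mult_le_cancel_left_pos)
  qed
  ultimately show "Re h = 0" by simp
qed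

lemma no_imaginary_trigonometric_form:
  fixes \<alpha> \<beta> :: complex
  assumes "\<And>\<omega>. norm \<omega> = 1 \<Longrightarrow> \<alpha> * \<omega> + \<beta> * cnj \<omega> \<noteq> 0 \<and> Re (\<alpha> * \<omega> + \<beta> * cnj \<omega>) = 0"
  shows False
proof -
  have \<beta>: "\<beta> = - cnj \<alpha>" using assms[of 1] assms[of \<i>] by (simp add: complex_eq_iff)
  \<comment> \<open>makes \<open>\<alpha> * \<omega>\<close> real, so that it cancels against \<open>\<beta> * cnj \<omega> = - cnj (\<alpha> * \<omega>)\<close>\<close>
  define \<omega> where "\<omega> = (if \<alpha> = 0 then 1 else cnj (sgn \<alpha>))"
  have "norm \<omega> = 1" by (simp add: \<omega>_def norm_sgn)
  moreover have "\<alpha> * \<omega> = norm \<alpha>"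
    by (auto simp: \<omega>_def sgn_eq divide_simps complex_norm_square[symmetric] power2_eq_square)
  then have "\<alpha> * \<omega> + \<beta> * cnj \<omega> = 0"
    unfolding \<beta> by (metis add.right_inverse complex_cnj_complex_of_real complex_cnj_mult mult_minus_left)
  ultimately show False using assms by blast
qed

text \<open>
  At \<open>(\<omega>, cnj \<omega>, 0)\<close> the lower bound of \<open>transports_metric\<close> and the upper bound given by \<open>symmetrized_disc\<close> both equal
  \<open>1 / (1 - r)\<close>. Adding a real multiple of \<open>e\<^sub>3\<close> changes the third coordinate of the image by a multiple of \<open>b\<close> and leaves
  the other two coordinates fixed, so the upper bounds control the growth of the modulus of the third coordinate.
\<close>

lemma origin_not_moved_up_leaf:
  assumes fg: "inverse_automorphisms f g" and r: "0 < r" "r < 1"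
  shows "f 0 \<noteq> \<phi> 0 0 (complex_of_real r)"
proof
  assume f0: "f 0 = \<phi> 0 0 (complex_of_real r)"
  have nr: "norm (complex_of_real r) < 1" using r by simp
  obtain B A where T: "transports_metric r B"
    and add: "\<And>u v. B (u + v) = B u + B v" and scale: "\<And>c u. B (c *s u) = c *s B u" and BA: "\<And>u. B (A u) = u"
    using metric_transport[OF fg nr f0] by metis
  obtain b where b: "B (vector [0, 0, 1]) = vector [0, 0, b]" "norm b = 1 / (1 - (norm (complex_of_real r))\<^sup>2)"
    using transport_third_axis[OF T nr add scale BA] by metis
  have \<rho>: "1 - r\<^sup>2 = (1 - r) * (1 + r)" by (simp add: power2_eq_square algebra_simps)
  have b0: "b \<noteq> 0" using b(2) r by (auto simp: \<rho>)
  define h where "h \<omega> = B (vector [\<omega>, cnj \<omega>, 0]) $ 3 / b" for \<omega>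
  have h_lin: "h \<omega> = (B (vector [1, 0, 0]) $ 3 / b) * \<omega> + (B (vector [0, 1, 0]) $ 3 / b) * cnj \<omega>" for \<omega>
  proof -
    have "vector [\<omega>, cnj \<omega>, 0] = \<omega> *s vector [1, 0, 0] + cnj \<omega> *s (vector [0, 1, 0] :: complex^3)"
      by (simp add: vec3_eq_iff)
    then show ?thesis by (simp add: h_def add scale add_divide_distrib mult.commute)
  qed
  have "h \<omega> \<noteq> 0 \<and> Re (h \<omega>) = 0" if \<omega>: "norm \<omega> = 1" for \<omega>
  proof -
    define m where "m = B (vector [\<omega>, cnj \<omega>, 0])"
    define M where "M = max (norm (m$1)) (norm (m$2))"
    have m3: "m$3 = h \<omega> * b" using b0 by (simp add: h_def m_def)
    have low: "1 \<le> (1 - r) * (M + norm (m$3))"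
    proof -
      \<comment> \<open>\<open>\<eta> = \<i> \<omega>\<close> makes both terms of the lower bound point in the same direction\<close>
      have i\<omega>: "norm (\<i> * \<omega>) = 1" using \<omega> by (simp add: norm_mult)
      have "\<omega> - complex_of_real r * (\<i> * \<omega>)\<^sup>2 * cnj \<omega> = (1 + complex_of_real r) * \<omega>"
      proof -
        have "\<omega> - complex_of_real r * (\<i> * \<omega>)\<^sup>2 * cnj \<omega> = \<omega> + complex_of_real r * \<omega> * (\<omega> * cnj \<omega>)"
          by (simp add: power2_eq_square algebra_simps)
        then show ?thesis using mult_cnj_eq_1[OF \<omega>] by (simp add: algebra_simps)
      qed
      moreover have "norm ((1 + complex_of_real r) * \<omega>) = 1 + r"
        using r \<omega> unfolding norm_mult by (metis abs_of_pos add_pos_pos mult.right_neutral norm_of_real of_real_1 of_real_add zero_less_one)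
      moreover have "norm (\<omega> - complex_of_real r * (\<i> * \<omega>)\<^sup>2 * cnj \<omega>) \<le> (1 - (norm (complex_of_real r))\<^sup>2) * metric0 m"
        using T[unfolded transports_metric_def, THEN conjunct2, rule_format, OF i\<omega>, of "vector [\<omega>, cnj \<omega>, 0]"]
        by (simp add: m_def)
      ultimately have "(1 + r) * 1 \<le> (1 + r) * ((1 - r) * metric0 m)"
        using r by (simp add: \<rho> mult_ac)
      then have "1 \<le> (1 - r) * metric0 m" using r by (simp only: mult_le_cancel_left_pos)
      then show ?thesis by (simp add: metric0_def M_def)
    qed
    have growth: "norm (h \<omega> + t) \<le> norm (h \<omega>) + (1 / (8 * r * (1 - r) * norm b)) * t\<^sup>2" for t :: real
    proof -
      define e where "e = t / (2 * sqrt r)"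
      define c where "c = (1 - r) / sqrt (1 + e\<^sup>2)"
      have e: "2 * sqrt r * e = t" "e\<^sup>2 = t\<^sup>2 / (4 * r)"
        using r by (simp_all add: e_def power_divide power_mult_distrib)
      have c: "c > 0" using r by (simp add: c_def add_pos_nonneg)
      obtain y where "analytic_disc y (\<phi> 0 0 (complex_of_real r)) (complex_of_real c *s vector [\<omega>, cnj \<omega>, 2 * sqrt r * e])"
        using symmetrized_disc[OF _ r(2) \<omega>, of e] r unfolding c_def by auto
      then have "metric0 (B (complex_of_real c *s vector [\<omega>, cnj \<omega>, 2 * sqrt r * e])) \<le> 1"
        using T unfolding transports_metric_def by blast
      moreover have "vector [\<omega>, cnj \<omega>, complex_of_real (2 * sqrt r * e)] = vector [\<omega>, cnj \<omega>, 0] + complex_of_real t *s (vector [0, 0, 1] :: complex^3)"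
        unfolding e by (simp add: vec3_eq_iff)
      ultimately have "c * metric0 (m + t *s vector [0, 0, b]) \<le> 1"
        using c by (simp add: scale add metric0_scale m_def b(1))
      then have "c * (M + norm (m$3 + t * b)) \<le> 1"
        by (simp add: metric0_def M_def)
      then have "(1 - r) * (M + norm (m$3 + t * b)) \<le> sqrt (1 + e\<^sup>2)"
        by (simp add: c_def divide_le_eq add_pos_nonneg)
      also have "\<dots> \<le> 1 + e\<^sup>2 / 2"
        by (rule sqrt_one_plus_square_le)
      finally have "(1 - r) * norm (m$3 + t * b) \<le> (1 - r) * norm (m$3) + e\<^sup>2 / 2"
        using low by (simp add: distrib_left)
      also have "m$3 + t * b = (h \<omega> + t) * b" by (simp add: m3 distrib_right)
      finally have "((1 - r) * norm b) * norm (h \<omega> + t) \<le> ((1 - r) * norm b) * norm (h \<omega>) + e\<^sup>2 / 2"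
        by (simp add: m3 norm_mult mult_ac)
      also have "\<dots> = ((1 - r) * norm b) * (norm (h \<omega>) + (1 / (8 * r * (1 - r) * norm b)) * t\<^sup>2)"
        using r b0 by (simp add: e(2) distrib_left)
      finally show ?thesis
        by (rule mult_left_le_imp_le) (use r b0 in simp)
    qed
    show ?thesis using imaginary_if_quadratic_growth[OF growth] by blast
  qed
  then show False unfolding h_lin by (rule no_imaginary_trigonometric_form)
qed

lemma automorphism_fixing_origin:
  assumes fg: "inverse_automorphisms f g" and f0: "f 0 = 0"
  obtains b where "norm b = 1" "\<And>l. norm l < 1 \<Longrightarrow> f (\<phi> 0 0 l) = \<phi> 0 0 (b * l)"
proof -
  have "g 0 = \<phi> 0 0 0"
    using fg f0 zero_in_tetrablock unfolding inverse_automorphisms_def zero_eq_beta_disc[symmetric] by metis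
  note g0 = this
  have n0: "norm (0::complex) < 1" by simp
  obtain B A where T: "transports_metric 0 B"
    and add: "\<And>u v. B (u + v) = B u + B v" and scale: "\<And>c u. B (c *s u) = c *s B u" and BA: "\<And>u. B (A u) = u"
    and push: "\<And>y v. analytic_disc y (\<phi> 0 0 0) v \<Longrightarrow> analytic_disc (\<lambda>l. f (y l)) 0 (B v)"
    by (rule metric_transport[OF inverse_automorphisms_sym[OF fg] n0 g0]) blast
  obtain b where "B (vector [0, 0, 1]) = vector [0, 0, b]" "norm b = 1 / (1 - (norm (0::complex))\<^sup>2)"
    by (rule transport_third_axis[OF T n0 add scale BA])
  then have b: "B (vector [0, 0, 1]) = vector [0, 0, b]" "norm b = 1" by simp_all
  have "analytic_disc (\<lambda>l. f (\<phi> 0 0 l)) 0 (vector [0, 0, b])"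
    using push[OF leaf_disc[of 0]] b(1) by (simp add: disc_moebius_def)
  from extremal_disc_unique[OF this b(2)] show thesis using that[of b] b(2) by blast
qed

section \<open>Automorphisms map leaves to leaves\<close>

text \<open>
  Complex differentiability of one component, in a form that composes by the usual rules of calculus.
\<close>

definition cdiff_at :: "(complex ^ 'n \<Rightarrow> complex) \<Rightarrow> complex ^ 'n \<Rightarrow> (complex ^ 'n) set \<Rightarrow> bool" where
  "cdiff_at F x S \<longleftrightarrow> (\<exists>D. (F has_derivative D) (at x within S) \<and> (\<forall>c h. D (c *s h) = c * D h))"

lemma cdiff_atI:
  "(F has_derivative D) (at x within S) \<Longrightarrow> (\<And>c h. D (c *s h) = c * D h) \<Longrightarrow> cdiff_at F x S"
  unfolding cdiff_at_def by blast

lemma cdiff_at_const: "cdiff_at (\<lambda>x. a) x S"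
  by (rule cdiff_atI, rule has_derivative_const) simp

lemma cdiff_at_nth: "cdiff_at (\<lambda>x. x $ i) x S"
  by (rule cdiff_atI, rule has_derivative_vec_nth, rule has_derivative_ident) simp

lemma cdiff_at_diff:
  assumes "cdiff_at F x S" "cdiff_at G x S" shows "cdiff_at (\<lambda>x. F x - G x) x S"
proof -
  obtain D E where DE: "(F has_derivative D) (at x within S)" "(G has_derivative E) (at x within S)"
    and "\<And>c h. D (c *s h) = c * D h" "\<And>c h. E (c *s h) = c * E h"
    using assms unfolding cdiff_at_def by blast
  then show ?thesis
    by (intro cdiff_atI[OF has_derivative_diff[OF DE]]) (simp add: algebra_simps)
qed

lemma cdiff_at_mult:
  assumes "cdiff_at F x S" "cdiff_at G x S" shows "cdiff_at (\<lambda>x. F x * G x) x S"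
proof -
  obtain D E where DE: "(F has_derivative D) (at x within S)" "(G has_derivative E) (at x within S)"
    and "\<And>c h. D (c *s h) = c * D h" "\<And>c h. E (c *s h) = c * E h"
    using assms unfolding cdiff_at_def by blast
  then show ?thesis
    by (intro cdiff_atI[OF has_derivative_mult[OF DE]]) (simp add: algebra_simps)
qed

lemma cdiff_at_divide:
  assumes "cdiff_at F x S" "cdiff_at G x S" "G x \<noteq> 0" shows "cdiff_at (\<lambda>x. F x / G x) x S"
proof -
  obtain D E where DE: "(F has_derivative D) (at x within S)" "(G has_derivative E) (at x within S)"
    and "\<And>c h. D (c *s h) = c * D h" "\<And>c h. E (c *s h) = c * E h"
    using assms unfolding cdiff_at_def by blast
  then show ?thesis
    by (intro cdiff_atI[OF has_derivative_divide[OF DE assms(3)]]) (simp add: algebra_simps)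
qed

lemmas cdiff_at_intros = cdiff_at_const cdiff_at_nth cdiff_at_diff cdiff_at_mult cdiff_at_divide

lemma analytic_map_onI:
  fixes f :: "complex ^ 'n \<Rightarrow> complex ^ 'm"
  assumes "\<And>i x. x \<in> S \<Longrightarrow> cdiff_at (\<lambda>x. f x $ i) x S"
  shows "analytic_map_on f S"
  unfolding analytic_map_on_def
proof
  fix x assume "x \<in> S"
  then have "\<forall>i. \<exists>D. ((\<lambda>x. f x $ i) has_derivative D) (at x within S) \<and> (\<forall>c h. D (c *s h) = c * D h)"
    using assms unfolding cdiff_at_def by blast
  then obtain D where D: "\<And>i. ((\<lambda>x. f x $ i) has_derivative D i) (at x within S)"
    "\<And>i c h. D i (c *s h) = c * D i h" by metis
  define f' where "f' h = (\<chi> i. D i h)" for h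
  have f': "(f has_derivative f') (at x within S)"
    by (rule has_derivative_vec_nthI) (simp add: f'_def D)
  then have "linear f'" by (rule has_derivative_linear)
  then have "f' (u + v) = f' u + f' v" for u v by (rule linear_add)
  moreover have "f' (c *s u) = c *s f' u" for c u by (simp add: f'_def D vec_eq_iff)
  ultimately have "Vector_Spaces.linear (*s) (*s) f'"
    unfolding Vector_Spaces.linear_iff by (simp add: vec.vector_space_axioms)
  then show "\<exists>f'. Vector_Spaces.linear (*s) (*s) f' \<and> (f has_derivative f') (at x within S)"
    using f' by blast
qed

lemma analytic_map_on_cong:
  assumes "analytic_map_on f S" "\<And>x. x \<in> S \<Longrightarrow> g x = f x" shows "analytic_map_on g S"
  using assms unfolding analytic_map_on_def by (meson has_derivative_transform)

lemma analytic_map_on_compose: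
  assumes f: "analytic_map_on f S" and g: "analytic_map_on g T" and sub: "f ` S \<subseteq> T"
  shows "analytic_map_on (g \<circ> f) S"
  unfolding analytic_map_on_def
proof
  fix x assume x: "x \<in> S"
  obtain A where A: "Vector_Spaces.linear (*s) (*s) A" "(f has_derivative A) (at x within S)"
    using f x unfolding analytic_map_on_def by blast
  obtain B where B: "Vector_Spaces.linear (*s) (*s) B" "(g has_derivative B) (at (f x) within T)"
    using g x sub unfolding analytic_map_on_def by blast
  have "(g \<circ> f has_derivative B \<circ> A) (at x within S)"
    using A(2) has_derivative_subset[OF B(2) sub] by (rule diff_chain_within)
  moreover have "Vector_Spaces.linear (*s) (*s) (B \<circ> A)"
    using A(1) B(1) by (simp add: Vector_Spaces.linear_iff)
  ultimately show "\<exists>C. Vector_Spaces.linear (*s) (*s) C \<and> (g \<circ> f has_derivative C) (at x within S)"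
    by blast
qed

text \<open>
  Automorphisms already known to permute the leaves. The maps built from the left and right actions are of
  this kind, and they normalise an arbitrary automorphism.
\<close>

definition leaf_automorphisms :: "(complex ^ 3 \<Rightarrow> complex ^ 3) \<Rightarrow> (complex ^ 3 \<Rightarrow> complex ^ 3) \<Rightarrow> bool" where
  "leaf_automorphisms f g \<longleftrightarrow>
     inverse_automorphisms f g \<and> (\<forall>L\<in>beta_leaves. f ` L \<in> beta_leaves \<and> g ` L \<in> beta_leaves)"

lemma leaf_automorphisms_sym: "leaf_automorphisms f g \<Longrightarrow> leaf_automorphisms g f"
  by (auto simp: leaf_automorphisms_def inverse_automorphisms_sym)

lemma inverse_automorphisms_compose:
  assumes "inverse_automorphisms f g" "inverse_automorphisms f' g'"
  shows "inverse_automorphisms (f' \<circ> f) (g \<circ> g')"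
proof -
  note a = assms[unfolded inverse_automorphisms_def]
  have "analytic_map_on (f' \<circ> f) \<E>"
    by (rule analytic_map_on_compose[where T = \<E>]) (use a in blast)+
  moreover have "analytic_map_on (g \<circ> g') \<E>"
    by (rule analytic_map_on_compose[where T = \<E>]) (use a in blast)+
  moreover have mem: "f x \<in> \<E>" "g x \<in> \<E>" "f' x \<in> \<E>" "g' x \<in> \<E>" if "x \<in> \<E>" for x
    using a that by blast+
  moreover have "(g \<circ> g') ((f' \<circ> f) x) = x" "(f' \<circ> f) ((g \<circ> g') x) = x" if "x \<in> \<E>" for x
    using a mem[OF that] that by simp_all
  ultimately show ?thesis unfolding inverse_automorphisms_def image_subset_iff by simp
qed

lemma leaf_automorphisms_compose:
  assumes "leaf_automorphisms f g" "leaf_automorphisms f' g'"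
  shows "leaf_automorphisms (f' \<circ> f) (g \<circ> g')"
  using assms inverse_automorphisms_compose unfolding leaf_automorphisms_def image_comp[symmetric] by simp

lemma beta_leaves_iff: "L \<in> beta_leaves \<longleftrightarrow> (\<exists>a b. norm a + norm b < 1 \<and> L = \<phi> a b ` \<D>)"
  by (auto simp: beta_leaves_def)

lemma leaf_subset_tetrablock: "L \<in> beta_leaves \<Longrightarrow> L \<subseteq> \<E>"
  by (auto simp: beta_leaves_iff beta_disc_in_tetrablock)

lemma analytic_left_moebius:
  assumes \<alpha>: "norm \<alpha> < 1" shows "analytic_map_on (left_moebius \<omega> \<alpha>) \<E>"
proof (rule analytic_map_onI)
  fix i :: 3 and x assume x: "x \<in> \<E>"
  have d: "1 - cnj \<alpha> * x$1 \<noteq> 0"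
    by (rule one_minus_mult_nonzero) (use \<alpha> tetrablock_coord_less[OF x] in auto)
  consider "i = 1" | "i = 2" | "i = 3" using exhaust_3 by blast
  then show "cdiff_at (\<lambda>x. left_moebius \<omega> \<alpha> x $ i) x \<E>"
    by cases (use d in \<open>auto intro!: cdiff_at_intros\<close>)
qed

lemma left_moebius_automorphism:
  assumes \<omega>: "norm \<omega> = 1" and \<alpha>: "norm \<alpha> < 1"
  shows "leaf_automorphisms (left_moebius \<omega> \<alpha>) (left_moebius (cnj \<omega>) (\<omega> * \<alpha>))"
proof -
  have \<omega>': "norm (cnj \<omega>) = 1" "norm (\<omega> * \<alpha>) < 1" using \<omega> \<alpha> by (simp_all add: norm_mult)
  have e: "cnj \<omega> * (\<omega> * \<alpha>) = \<alpha>"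
    using mult_cnj_eq_1[OF \<omega>] by (metis mult.assoc mult.commute mult_1)
  have "left_moebius \<omega> \<alpha> (left_moebius (cnj \<omega>) (\<omega> * \<alpha>) x) = x" if "x \<in> \<E>" for x
    using left_moebius_inverse[OF that \<omega>'] unfolding complex_cnj_cnj e .
  then have "inverse_automorphisms (left_moebius \<omega> \<alpha>) (left_moebius (cnj \<omega>) (\<omega> * \<alpha>))"
    unfolding inverse_automorphisms_def
    using analytic_left_moebius \<alpha> \<omega>' left_moebius_in_tetrablock \<omega> left_moebius_inverse by blast
  moreover have "left_moebius \<omega> \<alpha> ` L \<in> beta_leaves" if L: "L \<in> beta_leaves" and "norm \<omega> = 1" "norm \<alpha> < 1" for \<omega> \<alpha> L
  proof -
    obtain a b where ab: "norm a + norm b < 1" "L = \<phi> a b ` \<D>" using L by (auto simp: beta_leaves_iff)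
    then show ?thesis
      using left_moebius_leaf[OF ab(1) that(2,3)] left_moebius_beta_disc(3)[OF ab(1) that(2,3), of 0]
      by (auto simp: beta_leaves_iff)
  qed
  ultimately show ?thesis unfolding leaf_automorphisms_def using \<omega> \<alpha> \<omega>' by blast
qed

lemma swap12_automorphism: "leaf_automorphisms swap12 swap12"
proof -
  have "analytic_map_on swap12 \<E>"
  proof (rule analytic_map_onI)
    fix i :: 3 and x :: "complex^3"
    consider "i = 1" | "i = 2" | "i = 3" using exhaust_3 by blast
    then show "cdiff_at (\<lambda>x. swap12 x $ i) x \<E>"
      by cases (auto intro!: cdiff_at_intros)
  qed
  moreover have "swap12 ` L \<in> beta_leaves" if "L \<in> beta_leaves" for L
  proof -
    obtain a b where ab: "norm a + norm b < 1" "L = \<phi> a b ` \<D>" using \<open>L \<in> beta_leaves\<close> by (auto simp: beta_leaves_iff)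
    then have "swap12 ` L = \<phi> b a ` \<D>" by (simp add: image_image)
    then show ?thesis using ab(1) unfolding beta_leaves_iff by (metis add.commute)
  qed
  ultimately show ?thesis by (auto simp: leaf_automorphisms_def inverse_automorphisms_def)
qed

lemma right_moebius_automorphism:
  assumes "norm \<zeta> = 1" and "norm \<theta> < 1"
  obtains g where "leaf_automorphisms (right_moebius \<zeta> \<theta>) g"
proof -
  have "leaf_automorphisms (left_moebius \<zeta> (cnj (\<zeta> * \<theta>))) (left_moebius (cnj \<zeta>) (\<zeta> * cnj (\<zeta> * \<theta>)))"
    by (rule left_moebius_automorphism) (use assms in \<open>auto simp: norm_mult\<close>)
  from leaf_automorphisms_compose[OF leaf_automorphisms_compose[OF swap12_automorphism this] swap12_automorphism]
  have "\<exists>g. leaf_automorphisms (\<lambda>x. swap12 (left_moebius \<zeta> (cnj (\<zeta> * \<theta>)) (swap12 x))) g"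
    unfolding o_def by blast
  then show ?thesis using that unfolding right_moebius_def[abs_def] by blast
qed

lemma tanh_artanh:
  fixes x :: real assumes "\<bar>x\<bar> < 1" shows "tanh (artanh x) = x"
proof -
  have x: "1 + x > 0" "1 - x > 0" using assms by auto
  have "exp (- 2 * artanh x) = (1 - x) / (1 + x)"
    using x by (simp add: artanh_def exp_minus)
  then have "tanh (artanh x) = (1 - (1 - x) / (1 + x)) / (1 + (1 - x) / (1 + x))"
    by (simp only: tanh_real_altdef)
  also have "\<dots> = x" using x by (simp add: divide_simps)
  finally show ?thesis .
qed

text \<open>
  If \<open>A = tanh (u + v)\<close> and \<open>T = tanh (u - v)\<close>, then \<open>p + q = tanh (2 u)\<close> and \<open>p - q = tanh (2 v)\<close> are
  given by the addition theorem in terms of \<open>A\<close> and \<open>T\<close>. Half the sum and half the difference give \<open>p\<close> and \<open>q\<close>.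
\<close>

lemma tanh_half_sum_identities:
  fixes p q :: real
  assumes "0 \<le> p" "0 \<le> q" "p + q < 1"
  defines "A \<equiv> tanh (1/2 * artanh (p + q) + 1/2 * artanh (p - q))"
    and "T \<equiv> tanh (1/2 * artanh (p + q) - 1/2 * artanh (p - q))"
  shows "\<bar>A\<bar> < 1" "\<bar>T\<bar> < 1" "A * (1 - T\<^sup>2) = p * (1 - A\<^sup>2 * T\<^sup>2)" "T * (1 - A\<^sup>2) = q * (1 - A\<^sup>2 * T\<^sup>2)"
proof -
  show A: "\<bar>A\<bar> < 1" and T: "\<bar>T\<bar> < 1"
    unfolding A_def T_def by (simp_all add: abs_less_iff tanh_real_lt_1 tanh_real_gt_neg1 minus_less_iff)
  have AT: "\<bar>A * T\<bar> < 1" using A T mult_strict_mono'[of "\<bar>A\<bar>" 1 "\<bar>T\<bar>" 1] by (simp add: abs_mult)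
  have ne: "1 + A * T \<noteq> 0" "1 - A * T \<noteq> 0" using AT by auto
  define u where "u = 1/2 * artanh (p + q)"
  define v where "v = 1/2 * artanh (p - q)"
  have "p + q = tanh (artanh (p + q))" using assms by (simp add: tanh_artanh)
  also have "artanh (p + q) = (u + v) + (u - v)" by (simp add: u_def v_def)
  also have "tanh \<dots> = (A + T) / (1 + A * T)"
    unfolding A_def T_def u_def v_def by (rule tanh_add) auto
  finally have 1: "A + T = (p + q) * (1 + A * T)" using ne by (simp add: field_simps)
  have "p - q = tanh (artanh (p - q))" using assms by (simp add: tanh_artanh abs_less_iff)
  also have "artanh (p - q) = (u + v) + (- (u - v))" by (simp add: u_def v_def)
  also have "tanh \<dots> = (A + (- T)) / (1 + A * (- T))"
    unfolding A_def T_def u_def v_def tanh_minus[symmetric] by (rule tanh_add) auto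
  finally have 2: "A - T = (p - q) * (1 - A * T)" using ne by (simp add: field_simps)
  have "2 * (A * (1 - T\<^sup>2)) = (A + T) * (1 - A * T) + (A - T) * (1 + A * T)"
    by (simp add: power2_eq_square algebra_simps)
  also have "\<dots> = 2 * (p * (1 - A\<^sup>2 * T\<^sup>2))"
    unfolding 1 2 by (simp add: power2_eq_square algebra_simps)
  finally show "A * (1 - T\<^sup>2) = p * (1 - A\<^sup>2 * T\<^sup>2)" by simp
  have "2 * (T * (1 - A\<^sup>2)) = (A + T) * (1 - A * T) - (A - T) * (1 + A * T)"
    by (simp add: power2_eq_square algebra_simps)
  also have "\<dots> = 2 * (q * (1 - A\<^sup>2 * T\<^sup>2))"
    unfolding 1 2 by (simp add: power2_eq_square algebra_simps)
  finally show "T * (1 - A\<^sup>2) = q * (1 - A\<^sup>2 * T\<^sup>2)" by simp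
qed

text \<open>
  The right action moves the central leaf to the leaf with parameters \<open>0\<close>, \<open>cnj \<theta>\<close>, and then the left action
  moves this one to the leaf with parameters \<open>\<alpha> (1 - \<bar>\<theta>\<bar>\<^sup>2) / (1 - \<bar>\<alpha> \<theta>\<bar>\<^sup>2)\<close> and \<open>cnj \<theta> (1 - \<bar>\<alpha>\<bar>\<^sup>2) / (1 - \<bar>\<alpha> \<theta>\<bar>\<^sup>2)\<close>.
\<close>

lemma beta_leaf_from_central_leaf:
  assumes ab: "norm a + norm b < 1" and \<xi>: "norm \<xi>\<^sub>1 = 1" "norm \<xi>\<^sub>2 = 1"
    and a: "a = complex_of_real (norm a) * \<xi>\<^sub>1" and b: "cnj b = complex_of_real (norm b) * \<xi>\<^sub>2"
    and \<alpha>: "\<alpha> = \<xi>\<^sub>1 * complex_of_real (tanh (1/2 * artanh (norm a + norm b) + 1/2 * artanh (norm a - norm b)))"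
    and \<theta>: "\<theta> = \<xi>\<^sub>2 * complex_of_real (tanh (1/2 * artanh (norm a + norm b) - 1/2 * artanh (norm a - norm b)))"
  shows "norm \<alpha> < 1" "norm \<theta> < 1" "left_moebius 1 \<alpha> ` right_moebius 1 \<theta> ` \<phi> 0 0 ` \<D> = \<phi> a b ` \<D>"
proof -
  define A where "A = tanh (1/2 * artanh (norm a + norm b) + 1/2 * artanh (norm a - norm b))"
  define T where "T = tanh (1/2 * artanh (norm a + norm b) - 1/2 * artanh (norm a - norm b))"
  note AT = tanh_half_sum_identities[OF norm_ge_zero norm_ge_zero ab, folded A_def T_def]
  have \<alpha>A: "\<alpha> = \<xi>\<^sub>1 * complex_of_real A" and \<theta>T: "\<theta> = \<xi>\<^sub>2 * complex_of_real T"
    using \<alpha> \<theta> by (simp_all only: A_def T_def)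
  have n: "norm \<alpha> = \<bar>A\<bar>" "norm \<theta> = \<bar>T\<bar>" using \<xi> by (simp_all add: \<alpha>A \<theta>T norm_mult)
  show \<alpha>1: "norm \<alpha> < 1" and \<theta>1: "norm \<theta> < 1" unfolding n using AT by blast+
  define d where "d = complex_of_real (1 - A\<^sup>2 * T\<^sup>2)"
  have "1 - A\<^sup>2 * T\<^sup>2 \<noteq> 0"
  proof -
    have "\<bar>A * T\<bar> < 1" using AT(1,2) mult_strict_mono'[of "\<bar>A\<bar>" 1 "\<bar>T\<bar>" 1] by (simp add: abs_mult)
    then show ?thesis using abs_square_less_1[of "A * T"] by (simp add: power_mult_distrib)
  qed
  then have d: "d \<noteq> 0" unfolding d_def of_real_eq_0_iff .
  have den: "complex_of_real ((norm (1 - cnj \<alpha> * 0))\<^sup>2 - (norm (\<alpha> * cnj \<theta>))\<^sup>2) = d"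
    by (simp add: norm_mult n d_def power_mult_distrib)
  have "left_beta1 1 \<alpha> 0 (cnj \<theta>) = \<alpha> * complex_of_real (1 - T\<^sup>2) / d"
    unfolding left_beta1_def den by (simp add: n)
  also have "\<alpha> * complex_of_real (1 - T\<^sup>2) = \<xi>\<^sub>1 * complex_of_real (A * (1 - T\<^sup>2))"
    by (simp add: \<alpha>A)
  also have "\<dots> = a * d" unfolding AT(3) d_def by (subst (2) a) (simp add: mult_ac)
  finally have b1: "left_beta1 1 \<alpha> 0 (cnj \<theta>) = a" using d by simp
  have b': "b = complex_of_real (norm b) * cnj \<xi>\<^sub>2" using arg_cong[OF b, of cnj] by simp
  have "left_beta2 \<alpha> 0 (cnj \<theta>) = cnj \<theta> * complex_of_real (1 - A\<^sup>2) / d"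
    unfolding left_beta2_def den by (simp add: n)
  also have "cnj \<theta> * complex_of_real (1 - A\<^sup>2) = cnj \<xi>\<^sub>2 * complex_of_real (T * (1 - A\<^sup>2))"
    by (simp add: \<theta>T)
  also have "\<dots> = b * d" unfolding AT(4) d_def by (subst (2) b') (simp add: mult_ac)
  finally have b2: "left_beta2 \<alpha> 0 (cnj \<theta>) = b" using d by simp
  have "right_moebius 1 \<theta> ` \<phi> 0 0 ` \<D> = \<phi> 0 (cnj \<theta>) ` \<D>"
    using right_moebius_leaf[of 0 0 1 \<theta>] \<theta>1 by (simp add: left_beta1_def left_beta2_def)
  then have "left_moebius 1 \<alpha> ` right_moebius 1 \<theta> ` \<phi> 0 0 ` \<D> = left_moebius 1 \<alpha> ` \<phi> 0 (cnj \<theta>) ` \<D>"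
    by simp
  also have "\<dots> = \<phi> a b ` \<D>"
    using left_moebius_leaf[of 0 "cnj \<theta>" 1 \<alpha>] \<alpha>1 \<theta>1 by (simp add: b1 b2)
  finally show "left_moebius 1 \<alpha> ` right_moebius 1 \<theta> ` \<phi> 0 0 ` \<D> = \<phi> a b ` \<D>" .
qed

lemma unimodular_factor:
  obtains \<xi> where "norm \<xi> = 1" "z = complex_of_real (norm z) * \<xi>"
proof (cases "z = 0")
  case True
  then show thesis using that[of 1] by simp
next
  case False
  then have "norm (sgn z) = 1" "z = complex_of_real (norm z) * sgn z"
    by (simp add: norm_sgn, simp add: sgn_eq)
  then show thesis by (rule that)
qed

lemma leaf_automorphism_to_leaf:
  assumes "norm a + norm b < 1"
  obtains f g where "leaf_automorphisms f g" "f ` \<phi> 0 0 ` \<D> = \<phi> a b ` \<D>"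
proof -
  obtain \<xi>\<^sub>1 where 1: "norm \<xi>\<^sub>1 = 1" "a = complex_of_real (norm a) * \<xi>\<^sub>1" by (rule unimodular_factor)
  obtain \<xi>\<^sub>2 where 2: "norm \<xi>\<^sub>2 = 1" "cnj b = complex_of_real (norm (cnj b)) * \<xi>\<^sub>2" by (rule unimodular_factor)
  define \<alpha> where "\<alpha> = \<xi>\<^sub>1 * complex_of_real (tanh (1/2 * artanh (norm a + norm b) + 1/2 * artanh (norm a - norm b)))"
  define \<theta> where "\<theta> = \<xi>\<^sub>2 * complex_of_real (tanh (1/2 * artanh (norm a + norm b) - 1/2 * artanh (norm a - norm b)))"
  note L = beta_leaf_from_central_leaf[OF assms 1(1) 2(1) 1(2) 2(2)[unfolded complex_mod_cnj] \<alpha>_def \<theta>_def]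
  obtain g where g: "leaf_automorphisms (right_moebius 1 \<theta>) g"
    using right_moebius_automorphism[of 1 \<theta>] L(2) by auto
  have "leaf_automorphisms (left_moebius 1 \<alpha>) (left_moebius (cnj 1) (1 * \<alpha>))"
    using L(1) by (intro left_moebius_automorphism) auto
  from leaf_automorphisms_compose[OF g this] show thesis
    by (rule that) (use L(3) in \<open>simp add: image_image\<close>)
qed

text \<open>
  Move the leaf through \<open>x\<close> to the central leaf, and rotate the central leaf.
\<close>

lemma leaf_automorphism_to_normal_form:
  assumes x: "x \<in> \<E>"
  obtains f g r where "leaf_automorphisms f g" "0 \<le> r" "r < 1" "f x = \<phi> 0 0 (complex_of_real r)"
proof -
  obtain a b where ab: "norm a + norm b < 1" "norm (x$3) < 1" "x = \<phi> a b (x$3)"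
    using x by (rule tetrablock_param)
  obtain f g where fg: "leaf_automorphisms f g" "f ` \<phi> 0 0 ` \<D> = \<phi> a b ` \<D>"
    using ab(1) by (rule leaf_automorphism_to_leaf)
  have "x \<in> f ` \<phi> 0 0 ` \<D>" unfolding fg(2) using ab(2,3) by (metis imageI mem_ball_0)
  then obtain l where l: "norm l < 1" "x = f (\<phi> 0 0 l)" by auto
  have gx: "g x = \<phi> 0 0 l"
    using fg(1) l leaf_point_in_tetrablock[OF l(1)] by (simp add: leaf_automorphisms_def inverse_automorphisms_def)
  obtain \<xi> where \<xi>: "norm \<xi> = 1" "l = complex_of_real (norm l) * \<xi>" by (rule unimodular_factor)
  \<comment> \<open>the sign compensates for \<open>left_moebius 1 0\<close> being \<open>z \<mapsto> - z\<close> on the central leaf\<close>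
  define \<omega> where "\<omega> = - cnj \<xi>"
  have "norm \<omega> = 1" using \<xi> by (simp add: \<omega>_def)
  then have L: "leaf_automorphisms (left_moebius \<omega> 0) (left_moebius (cnj \<omega>) (\<omega> * 0))"
    by (rule left_moebius_automorphism) simp
  have "cnj \<xi> * l = norm l * (\<xi> * cnj \<xi>)" by (subst \<xi>(2)) (simp add: mult_ac)
  then have "cnj \<xi> * l = norm l" using mult_cnj_eq_1[OF \<xi>(1)] by simp
  then have "(left_moebius \<omega> 0 \<circ> g) x = \<phi> 0 0 (complex_of_real (norm l))"
    by (simp add: gx vec3_eq_iff \<omega>_def)
  then show thesis
    using that[OF leaf_automorphisms_compose[OF leaf_automorphisms_sym[OF fg(1)] L] _ l(1)] by simp
qed

text \<open>
  With \<open>h\<close> moving the central leaf to \<open>L\<close> and \<open>p\<close> moving \<open>f (h 0)\<close> to its normal form \<open>(0, 0, r)\<close>, the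
  automorphism \<open>p \<circ> f \<circ> h\<close> takes the origin to \<open>(0, 0, r)\<close>. So \<open>r = 0\<close> and the central leaf is preserved.
\<close>

lemma automorphism_maps_leaf_to_leaf:
  assumes fg: "inverse_automorphisms f g" and L: "L \<in> beta_leaves"
  shows "f ` L \<in> beta_leaves"
proof -
  obtain a b where ab: "norm a + norm b < 1" "L = \<phi> a b ` \<D>" using L by (auto simp: beta_leaves_iff)
  obtain h k where hk: "leaf_automorphisms h k" "h ` \<phi> 0 0 ` \<D> = L"
    unfolding ab(2) using ab(1) by (rule leaf_automorphism_to_leaf)
  have hk': "inverse_automorphisms h k" using hk(1) by (simp add: leaf_automorphisms_def)
  have "f (h 0) \<in> \<E>"
    using fg hk' zero_in_tetrablock by (auto simp: inverse_automorphisms_def)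
  then obtain p q r where pq: "leaf_automorphisms p q" and r: "0 \<le> r" "r < 1"
    and p0: "p (f (h 0)) = \<phi> 0 0 (complex_of_real r)"
    by (rule leaf_automorphism_to_normal_form)
  have pq': "inverse_automorphisms p q" using pq by (simp add: leaf_automorphisms_def)
  note F = inverse_automorphisms_compose[OF inverse_automorphisms_compose[OF hk' fg] pq']
  let ?F = "p \<circ> (f \<circ> h)"
  have "r = 0" using origin_not_moved_up_leaf[OF F, of r] r p0 by fastforce
  then have "?F 0 = 0" using p0 by (simp add: zero_eq_beta_disc)
  then obtain c where c: "norm c = 1" "\<And>l. norm l < 1 \<Longrightarrow> ?F (\<phi> 0 0 l) = \<phi> 0 0 (c * l)"
    using automorphism_fixing_origin[OF F] by blast
  have "?F ` \<phi> 0 0 ` \<D> = \<phi> 0 0 ` \<D>"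
  proof (intro subset_antisym subsetI)
    fix y assume "y \<in> ?F ` \<phi> 0 0 ` \<D>"
    then obtain l where l: "norm l < 1" "y = \<phi> 0 0 (c * l)" using c(2) by auto
    then have "c * l \<in> \<D>" using c(1) by (simp add: norm_mult)
    then show "y \<in> \<phi> 0 0 ` \<D>" using l(2) by blast
  next
    fix y assume "y \<in> \<phi> 0 0 ` \<D>"
    then obtain l where l: "norm l < 1" "y = \<phi> 0 0 l" by auto
    have n: "norm (cnj c * l) < 1" using l c(1) by (simp add: norm_mult)
    have "c * (cnj c * l) = l" using mult_cnj_eq_1[OF c(1)] by (simp flip: mult.assoc)
    then have "y = ?F (\<phi> 0 0 (cnj c * l))" unfolding c(2)[OF n] l(2) by (rule arg_cong[OF sym])
    moreover have "cnj c * l \<in> \<D>" using n by simp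
    ultimately show "y \<in> ?F ` \<phi> 0 0 ` \<D>" by blast
  qed
  then have pf: "p ` f ` L = \<phi> 0 0 ` \<D>" unfolding hk(2)[symmetric] by (simp add: image_image)
  have "f ` L \<subseteq> \<E>"
    using leaf_subset_tetrablock[OF L] fg by (auto simp: inverse_automorphisms_def)
  then have "q ` p ` f ` L = f ` L"
    using pq' by (force simp: inverse_automorphisms_def image_image)
  then have "f ` L = q ` \<phi> 0 0 ` \<D>" unfolding pf by simp
  moreover have "\<phi> 0 0 ` \<D> \<in> beta_leaves" unfolding beta_leaves_iff by (intro exI[of _ 0]) simp
  ultimately show ?thesis using pq by (simp add: leaf_automorphisms_def)
qed

section \<open>The action on the set of leaves and the explicit formulas\<close>

lemma inv_into_eqI:
  assumes "\<And>x. x \<in> S \<Longrightarrow> g (f x) = x" "f ` S \<subseteq> S" "g ` S \<subseteq> S" "\<And>x. x \<in> S \<Longrightarrow> f (g x) = x" "x \<in> S"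
  shows "inv_into S f x = g x"
  using assms by (intro inv_into_f_eq inj_on_inverseI[of S g f]) auto

lemma carrier_Aut_tetrablockD:
  assumes "f \<in> carrier Aut_tetrablock"
  shows "f \<in> Bij \<E>" "inverse_automorphisms f (inv_into \<E> f)"
proof -
  show B: "f \<in> Bij \<E>" using assms by (simp add: Aut_tetrablock_def Aut_group_def)
  then have "bij_betw f \<E> \<E>" by (simp add: Bij_def)
  then have "f ` \<E> = \<E>" "inv_into \<E> f ` \<E> = \<E>" "\<And>x. x \<in> \<E> \<Longrightarrow> inv_into \<E> f (f x) = x"
    "\<And>x. x \<in> \<E> \<Longrightarrow> f (inv_into \<E> f x) = x"
    using bij_betw_imp_surj_on bij_betw_inv_into bij_betw_inv_into_left bij_betw_inv_into_right by metis+
  then show "inverse_automorphisms f (inv_into \<E> f)"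
    using assms by (simp add: inverse_automorphisms_def Aut_tetrablock_def Aut_group_def)
qed

lemma carrier_Aut_tetrablockI:
  assumes fg: "inverse_automorphisms f g" and e: "f \<in> extensional \<E>"
  shows "f \<in> carrier Aut_tetrablock"
proof -
  note a = fg[unfolded inverse_automorphisms_def]
  have "bij_betw f \<E> \<E>" by (rule bij_betw_byWitness[where f' = g]) (use a in blast)+
  moreover have "analytic_map_on (inv_into \<E> f) \<E>"
  proof (rule analytic_map_on_cong)
    show "analytic_map_on g \<E>" using a by blast
    show "inv_into \<E> f x = g x" if "x \<in> \<E>" for x
      by (rule inv_into_eqI[OF _ _ _ _ that]) (use a in blast)+
  qed
  ultimately show ?thesis using a e by (simp add: Aut_tetrablock_def Aut_group_def Bij_def)
qed

lemma inverse_automorphisms_cong: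
  assumes "inverse_automorphisms f g" "\<And>x. x \<in> \<E> \<Longrightarrow> f' x = f x" "\<And>x. x \<in> \<E> \<Longrightarrow> g' x = g x"
  shows "inverse_automorphisms f' g'"
proof -
  note a = assms(1)[unfolded inverse_automorphisms_def image_subset_iff]
  have "analytic_map_on f' \<E>" by (rule analytic_map_on_cong[OF _ assms(2)]) (use a in blast)
  moreover have "analytic_map_on g' \<E>" by (rule analytic_map_on_cong[OF _ assms(3)]) (use a in blast)
  ultimately show ?thesis
    unfolding inverse_automorphisms_def image_subset_iff using a by (simp add: assms(2,3))
qed

lemma Aut_tetrablock_update:
  "Aut_tetrablock = (BijGroup \<E>)\<lparr>carrier := carrier Aut_tetrablock\<rparr>"
  by (simp add: Aut_tetrablock_def Aut_group_def)

lemma mult_Aut_tetrablock: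
  "f \<in> carrier Aut_tetrablock \<Longrightarrow> g \<in> carrier Aut_tetrablock \<Longrightarrow> f \<otimes>\<^bsub>Aut_tetrablock\<^esub> g = compose \<E> f g"
  using carrier_Aut_tetrablockD(1)[of f] carrier_Aut_tetrablockD(1)[of g]
  by (subst Aut_tetrablock_update) (simp add: BijGroup_def)

lemma subgroup_Aut_tetrablock: "subgroup (carrier Aut_tetrablock) (BijGroup \<E>)"
proof
  show "carrier Aut_tetrablock \<subseteq> carrier (BijGroup \<E>)"
    using carrier_Aut_tetrablockD(1) by (auto simp: BijGroup_def)
  fix f assume f: "f \<in> carrier Aut_tetrablock"
  note f' = carrier_Aut_tetrablockD[OF f]
  show "f \<otimes>\<^bsub>BijGroup \<E>\<^esub> g \<in> carrier Aut_tetrablock" if g: "g \<in> carrier Aut_tetrablock" for g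
  proof -
    note g' = carrier_Aut_tetrablockD[OF g]
    have "compose \<E> f g \<in> carrier Aut_tetrablock"
    proof (rule carrier_Aut_tetrablockI)
      show "inverse_automorphisms (compose \<E> f g) (inv_into \<E> g \<circ> inv_into \<E> f)"
        by (rule inverse_automorphisms_cong[OF inverse_automorphisms_compose[OF g'(2) f'(2)]])
          (simp_all add: compose_def)
    qed simp
    then show ?thesis using f' g' by (simp add: BijGroup_def)
  qed
  have "restrict (inv_into \<E> f) \<E> \<in> carrier Aut_tetrablock"
    by (rule carrier_Aut_tetrablockI[where g = f])
      (auto intro: inverse_automorphisms_cong[OF inverse_automorphisms_sym[OF f'(2)]])
  then show "inv\<^bsub>BijGroup \<E>\<^esub> f \<in> carrier Aut_tetrablock"
    using inv_BijGroup[OF f'(1)] by simp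
next
  have "inverse_automorphisms swap12 swap12"
    using swap12_automorphism by (simp add: leaf_automorphisms_def)
  from inverse_automorphisms_compose[OF this this]
  have "inverse_automorphisms (\<lambda>x\<in>\<E>. x) (\<lambda>x\<in>\<E>. x)"
    by (rule inverse_automorphisms_cong) auto
  then show "\<one>\<^bsub>BijGroup \<E>\<^esub> \<in> carrier Aut_tetrablock"
    using carrier_Aut_tetrablockI by (simp add: BijGroup_def)
qed

lemma group_Aut_tetrablock: "group Aut_tetrablock"
  using subgroup.subgroup_is_group[OF subgroup_Aut_tetrablock group_BijGroup] Aut_tetrablock_update by simp

lemma transitive_action_on_leaves:
  "transitive_action Aut_tetrablock beta_leaves (\<lambda>f. \<lambda>L\<in>beta_leaves. f ` L)"
proof -
  let ?act = "\<lambda>f. \<lambda>L\<in>beta_leaves. f ` L"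
  have act_Bij: "?act f \<in> Bij beta_leaves" if f: "f \<in> carrier Aut_tetrablock" for f
  proof -
    note fg = carrier_Aut_tetrablockD(2)[OF f]
    have "f ` L \<in> beta_leaves \<and> inv_into \<E> f ` L \<in> beta_leaves" if "L \<in> beta_leaves" for L
      using automorphism_maps_leaf_to_leaf fg inverse_automorphisms_sym that by blast
    moreover have "inv_into \<E> f ` f ` L = L \<and> f ` inv_into \<E> f ` L = L" if "L \<in> beta_leaves" for L
    proof -
      have "\<And>x. x \<in> L \<Longrightarrow> inv_into \<E> f (f x) = x \<and> f (inv_into \<E> f x) = x"
        using fg leaf_subset_tetrablock[OF that] unfolding inverse_automorphisms_def by blast
      then show ?thesis by (simp add: image_image)
    qed
    ultimately have "bij_betw (?act f) beta_leaves beta_leaves"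
      by (intro bij_betw_byWitness[where f' = "\<lambda>L. inv_into \<E> f ` L"]) (simp_all add: image_subset_iff)
    then show ?thesis by (simp add: Bij_def)
  qed
  have act_mult: "?act (f \<otimes>\<^bsub>Aut_tetrablock\<^esub> g) = ?act f \<otimes>\<^bsub>BijGroup beta_leaves\<^esub> ?act g"
    if f: "f \<in> carrier Aut_tetrablock" and g: "g \<in> carrier Aut_tetrablock" for f g
  proof -
    have "compose \<E> f g ` L = f ` g ` L" if "L \<in> beta_leaves" for L
      using leaf_subset_tetrablock[OF that] by (auto simp: compose_def image_image intro!: image_cong)
    moreover have "g ` L \<in> beta_leaves" if "L \<in> beta_leaves" for L
      using automorphism_maps_leaf_to_leaf[OF carrier_Aut_tetrablockD(2)[OF g] that] .
    ultimately have "?act (compose \<E> f g) = compose beta_leaves (?act f) (?act g)"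
      by (auto simp: compose_def fun_eq_iff)
    then show ?thesis
      using act_Bij[OF f] act_Bij[OF g] by (simp add: BijGroup_def mult_Aut_tetrablock[OF f g])
  qed
  have "?act \<in> hom Aut_tetrablock (BijGroup beta_leaves)"
    using act_Bij act_mult by (intro homI) (simp_all add: BijGroup_def)
  then have "group_hom Aut_tetrablock (BijGroup beta_leaves) ?act"
    by (intro group_hom.intro group_hom_axioms.intro group_Aut_tetrablock group_BijGroup)
  moreover have "\<exists>f\<in>carrier Aut_tetrablock. ?act f L = M" if L: "L \<in> beta_leaves" and M: "M \<in> beta_leaves" for L M
  proof -
    obtain a b c d where ab: "norm a + norm b < 1" "L = \<phi> a b ` \<D>" and cd: "norm c + norm d < 1" "M = \<phi> c d ` \<D>"
      using L M unfolding beta_leaves_iff by blast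
    obtain f g where fg: "leaf_automorphisms f g" "f ` \<phi> 0 0 ` \<D> = L"
      unfolding ab(2) using ab(1) by (rule leaf_automorphism_to_leaf)
    obtain h k where hk: "leaf_automorphisms h k" "h ` \<phi> 0 0 ` \<D> = M"
      unfolding cd(2) using cd(1) by (rule leaf_automorphism_to_leaf)
    have "inverse_automorphisms (h \<circ> g) (f \<circ> k)"
      using leaf_automorphisms_compose[OF leaf_automorphisms_sym[OF fg(1)] hk(1)]
      by (simp add: leaf_automorphisms_def)
    then have "inverse_automorphisms (restrict (h \<circ> g) \<E>) (f \<circ> k)"
      by (rule inverse_automorphisms_cong) auto
    then have F: "restrict (h \<circ> g) \<E> \<in> carrier Aut_tetrablock"
      by (rule carrier_Aut_tetrablockI) simp
    have "g (f (\<phi> 0 0 l)) = \<phi> 0 0 l" if "l \<in> \<D>" for l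
      using fg(1) leaf_point_in_tetrablock that by (simp add: leaf_automorphisms_def inverse_automorphisms_def)
    then have "g ` L = \<phi> 0 0 ` \<D>"
      unfolding fg(2)[symmetric] image_image by (rule image_cong[OF refl])
    moreover have "restrict (h \<circ> g) \<E> ` L = h ` g ` L"
      using leaf_subset_tetrablock[OF L] by (auto simp: image_image intro!: image_cong)
    ultimately have "restrict (h \<circ> g) \<E> ` L = M" using hk(2) by simp
    then show ?thesis using F L by (intro bexI[of _ "restrict (h \<circ> g) \<E>"]) auto
  qed
  ultimately show ?thesis
    by (intro transitive_action.intro group_action.intro transitive_action_axioms.intro)
qed

lemma closure_tetrablock_norm_le:
  assumes "t \<in> closure \<E>" shows "norm (t$2) \<le> 1"
proof -
  have "closure \<E> \<subseteq> {x. norm (x$2) \<le> 1}"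
  proof (rule closure_minimal)
    show "\<E> \<subseteq> {x. norm (x$2) \<le> 1}" using tetrablock_coord_less(2) by (auto intro: less_imp_le)
    show "closed {x :: complex^3. norm (x$2) \<le> 1}" by (intro closed_Collect_le continuous_intros)
  qed
  then show ?thesis using assms by blast
qed

text \<open>
  The vector is a limit of the points \<open>\<phi> (\<omega> \<alpha>) 0 (s \<omega>)\<close> as \<open>s\<close> tends to \<open>1\<close> from below. Any other candidate \<open>t\<close> satisfies
  \<open>\<bar>t\<^sub>2\<bar> \<le> 1\<close>, so both fractions have nonvanishing denominators on the disc; clearing them and comparing the values at
  \<open>0\<close> and \<open>\<plusminus> 1/2\<close> determines \<open>t\<close>.
\<close>

lemma tau_eq:
  assumes \<omega>: "norm \<omega> = 1" and \<alpha>: "norm \<alpha> < 1"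
    and \<upsilon>: "\<And>z. norm z < 1 \<Longrightarrow> \<upsilon> z = \<omega> * ((z - \<alpha>) / (cnj \<alpha> * z - 1))"
  shows "\<tau> \<upsilon> = vector [\<omega> * \<alpha>, cnj \<alpha>, \<omega>]"
  unfolding tau_def
proof (rule the_equality, intro conjI ballI)
  let ?t = "vector [\<omega> * \<alpha>, cnj \<alpha>, \<omega>] :: complex^3"
  have ne: "cnj \<alpha> * z - 1 \<noteq> 0" if "norm z < 1" for z
    using one_minus_mult_nonzero(1)[of "cnj \<alpha>" z] \<alpha> that by (metis complex_mod_cnj less_imp_le minus_diff_eq neg_equal_0_iff_equal)
  show "?t \<in> closure \<E>"
  proof -
    define s where "s n = 1 - 1 / real (Suc n)" for n :: nat
    have s: "s n < 1" "s n \<ge> 0" for n :: nat by (simp_all add: s_def)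
    have "(\<lambda>n. vector [\<omega> * \<alpha>, s n * cnj \<alpha>, s n * \<omega>] :: complex^3) \<longlonglongrightarrow> ?t"
    proof (rule vec_tendstoI)
      fix i :: 3
      have "s \<longlonglongrightarrow> 1 - 0" unfolding s_def by (intro tendsto_intros LIMSEQ_Suc lim_1_over_n)
      then have "(\<lambda>n. complex_of_real (s n) * c) \<longlonglongrightarrow> complex_of_real 1 * c" for c
        by (intro tendsto_intros) simp
      then show "(\<lambda>n. vector [\<omega> * \<alpha>, s n * cnj \<alpha>, s n * \<omega>] $ i) \<longlonglongrightarrow> ?t $ i"
        using exhaust_3[of i] by (elim disjE) simp_all
    qed
    moreover have "vector [\<omega> * \<alpha>, s n * cnj \<alpha>, s n * \<omega>] \<in> \<E>" for n
    proof -
      have "vector [\<omega> * \<alpha>, s n * cnj \<alpha>, s n * \<omega>] = \<phi> (\<omega> * \<alpha>) 0 (s n * \<omega>)"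
        using mult_cnj_eq_1[OF \<omega>] by (simp add: vec3_eq_iff mult_ac)
      also have "\<dots> \<in> \<E>"
        by (rule beta_disc_in_tetrablock) (use \<omega> \<alpha> s[of n] in \<open>simp_all add: norm_mult\<close>)
      finally show ?thesis .
    qed
    ultimately show ?thesis
      unfolding closure_sequential
      by (intro exI[of _ "\<lambda>n. vector [\<omega> * \<alpha>, s n * cnj \<alpha>, s n * \<omega>]"]) simp
  qed
  show "\<upsilon> z = \<Psi> z ?t" if "z \<in> \<D>" for z
    using \<upsilon>[of z] that by (simp add: Psi_def right_diff_distrib)
  fix t assume "t \<in> closure \<E> \<and> (\<forall>z\<in>\<D>. \<upsilon> z = \<Psi> z t)"
  then have t: "t \<in> closure \<E>" and eq: "\<And>z. norm z < 1 \<Longrightarrow> \<upsilon> z = \<Psi> z t" by auto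
  have ne': "t$2 * z - 1 \<noteq> 0" if "norm z < 1" for z
    using one_minus_mult_nonzero(2)[of z "t$2"] closure_tetrablock_norm_le[OF t] that
    by (metis minus_diff_eq neg_equal_0_iff_equal)
  have t1: "t$1 = \<omega> * \<alpha>" using eq[of 0] \<upsilon>[of 0] by (simp add: Psi_def)
  have rel: "(t$3 * cnj \<alpha> - \<omega> * t$2) * z\<^sup>2 + (\<omega> + \<omega> * \<alpha> * t$2 - t$3 - \<omega> * \<alpha> * cnj \<alpha>) * z = 0" if z: "norm z < 1" for z
  proof -
    have "\<omega> * (z - \<alpha>) / (cnj \<alpha> * z - 1) = (t$3 * z - t$1) / (t$2 * z - 1)"
      using eq[OF z] \<upsilon>[OF z] by (simp add: Psi_def)
    then have "\<omega> * (z - \<alpha>) * (t$2 * z - 1) = (t$3 * z - t$1) * (cnj \<alpha> * z - 1)"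
      using ne[OF z] ne'[OF z] by (simp add: frac_eq_eq)
    then show ?thesis unfolding t1 by (simp add: algebra_simps power2_eq_square)
  qed
  define P Q where "P = t$3 * cnj \<alpha> - \<omega> * t$2" and "Q = \<omega> + \<omega> * \<alpha> * t$2 - t$3 - \<omega> * \<alpha> * cnj \<alpha>"
  have PQ: "P * z\<^sup>2 + Q * z = 0" if "norm z < 1" for z using rel[OF that] by (simp only: P_def Q_def)
  have "P / 4 + Q / 2 = 0" "P / 4 - Q / 2 = 0" using PQ[of "1/2"] PQ[of "-1/2"] by (simp_all add: power2_eq_square)
  then have "P / 4 = 0 \<and> Q / 2 = 0" by (metis add_cancel_left_left add_diff_cancel diff_0 eq_neg_iff_add_eq_0 diff_eq_diff_eq eq_iff_diff_eq_0 mult_2 mult_eq_0_iff zero_neq_numeral)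
  then have P0: "t$3 * cnj \<alpha> = \<omega> * t$2" and Q0: "Q = 0" by (simp_all add: P_def)
  have r: "1 - \<alpha> * cnj \<alpha> \<noteq> 0" by (rule one_minus_mult_nonzero) (use \<alpha> in auto)
  have "Q = (\<omega> - t$3) * (1 - \<alpha> * cnj \<alpha>) + \<alpha> * (\<omega> * t$2 - t$3 * cnj \<alpha>)"
    by (simp add: Q_def algebra_simps)
  then have t3: "t$3 = \<omega>" using Q0 P0 r by simp
  have "\<omega> \<noteq> 0" using \<omega> by auto
  then have "t$2 = cnj \<alpha>" using P0 t3 by simp
  then show "t = ?t" using t1 t3 by (simp add: vec3_eq_iff)
qed

lemma left_act_eq:
  assumes "norm \<omega> = 1" and "norm \<alpha> < 1"
    and "\<And>z. norm z < 1 \<Longrightarrow> \<upsilon> z = \<omega> * ((z - \<alpha>) / (cnj \<alpha> * z - 1))"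
  shows "left_act \<upsilon> x = left_moebius \<omega> \<alpha> x"
proof -
  have t: "\<tau> \<upsilon> = vector [\<omega> * \<alpha>, cnj \<alpha>, \<omega>]" using assms by (rule tau_eq)
  have e: "\<omega> * (\<alpha> - x$1) = \<omega> * \<alpha> - \<omega> * x$1" "\<omega> * (\<alpha> * x$2 - x$3) = \<omega> * \<alpha> * x$2 - \<omega> * x$3"
    by (simp_all add: right_diff_distrib mult.assoc)
  show ?thesis
    unfolding left_act_def t vec3_eq_iff left_moebius_nth e by (simp add: diamond_def)
qed

lemma right_act_eq:
  assumes \<zeta>: "norm \<zeta> = 1" and "norm \<theta> < 1"
    and "\<And>z. norm z < 1 \<Longrightarrow> \<eta> z = \<zeta> * ((z - \<theta>) / (cnj \<theta> * z - 1))"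
  shows "right_act x \<eta> = right_moebius \<zeta> \<theta> x"
proof -
  have e: "\<zeta> * (cnj \<zeta> * c) = c" for c using mult_cnj_eq_1[OF \<zeta>] by (simp flip: mult.assoc)
  have e': "\<zeta> * (cnj (\<zeta> * \<theta>) - x$2) = cnj \<theta> - \<zeta> * x$2" "\<zeta> * (cnj (\<zeta> * \<theta>) * x$1 - x$3) = cnj \<theta> * x$1 - \<zeta> * x$3"
    by (simp_all add: right_diff_distrib e mult.assoc)
  have t: "\<tau> \<eta> = vector [\<zeta> * \<theta>, cnj \<theta>, \<zeta>]" using assms by (rule tau_eq)
  show ?thesis
    unfolding right_act_def t vec3_eq_iff right_moebius_def swap12_nth left_moebius_nth e'
    by (simp add: diamond_def mult_ac)
qed

text \<open>
  The operation \<open>inv\<close> is a definite description, so its value at \<open>\<upsilon>\<close> is found by showing that \<open>\<upsilon>\<close> is the only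
  inverse of \<open>\<upsilon>\<close> among the extensional bijections of the disc.
\<close>

lemma inv_Aut_disc_involution:
  assumes \<upsilon>: "\<upsilon> \<in> carrier Aut_disc" and inv: "\<And>z. z \<in> \<D> \<Longrightarrow> \<upsilon> (\<upsilon> z) = z"
  shows "inv\<^bsub>Aut_disc\<^esub> \<upsilon> = \<upsilon>"
proof -
  have B: "f \<in> Bij \<D>" if "f \<in> carrier Aut_disc" for f
    using that by (simp add: Aut_disc_def Aut_group_def)
  have mult: "f \<otimes>\<^bsub>Aut_disc\<^esub> g = compose \<D> f g" if "f \<in> carrier Aut_disc" "g \<in> carrier Aut_disc" for f g
    using B[OF that(1)] B[OF that(2)] by (simp add: Aut_disc_def Aut_group_def BijGroup_def)
  have one: "\<one>\<^bsub>Aut_disc\<^esub> = (\<lambda>z\<in>\<D>. z)" by (simp add: Aut_disc_def Aut_group_def BijGroup_def)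
  have cc: "compose \<D> \<upsilon> \<upsilon> = (\<lambda>z\<in>\<D>. z)" using inv by (auto simp: compose_def fun_eq_iff)
  show ?thesis unfolding m_inv_def
  proof (rule the_equality)
    show "\<upsilon> \<in> carrier Aut_disc \<and> \<upsilon> \<otimes>\<^bsub>Aut_disc\<^esub> \<upsilon> = \<one>\<^bsub>Aut_disc\<^esub> \<and> \<upsilon> \<otimes>\<^bsub>Aut_disc\<^esub> \<upsilon> = \<one>\<^bsub>Aut_disc\<^esub>"
      using \<upsilon> cc by (simp add: mult one)
    fix y assume y: "y \<in> carrier Aut_disc \<and> \<upsilon> \<otimes>\<^bsub>Aut_disc\<^esub> y = \<one>\<^bsub>Aut_disc\<^esub> \<and> y \<otimes>\<^bsub>Aut_disc\<^esub> \<upsilon> = \<one>\<^bsub>Aut_disc\<^esub>"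
    then have c: "compose \<D> \<upsilon> y = (\<lambda>z\<in>\<D>. z)" using mult[OF \<upsilon>, of y] one by metis
    have yB: "y \<in> Bij \<D>" using y B by blast
    show "y = \<upsilon>"
    proof (rule extensionalityI[of _ \<D>])
      show "y \<in> extensional \<D>" "\<upsilon> \<in> extensional \<D>"
        using yB B[OF \<upsilon>] by (simp_all add: Bij_def)
      fix z assume z: "z \<in> \<D>"
      then have "y z \<in> \<D>" using Bij_imp_funcset[OF yB] by blast
      moreover have "\<upsilon> (y z) = z" using fun_cong[OF c, of z] z by (simp add: compose_def)
      ultimately show "y z = \<upsilon> z" using inv by metis
    qed
  qed
qed

lemma moebius_involution:
  assumes \<alpha>: "norm \<alpha> < 1" and z: "norm z < 1"
  defines "m \<equiv> \<lambda>z. (z - \<alpha>) / (cnj \<alpha> * z - 1)"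
  shows "m (m z) = z"
proof -
  define d where "d = cnj \<alpha> * z - 1"
  have "1 - cnj \<alpha> * z \<noteq> 0" by (rule one_minus_mult_nonzero) (use \<alpha> z in auto)
  then have d: "d \<noteq> 0" by (simp add: d_def)
  have r: "1 - \<alpha> * cnj \<alpha> \<noteq> 0" by (rule one_minus_mult_nonzero) (use \<alpha> in auto)
  have "z - \<alpha> - \<alpha> * d = z * (1 - \<alpha> * cnj \<alpha>)" "cnj \<alpha> * (z - \<alpha>) - d = 1 - \<alpha> * cnj \<alpha>"
    by (simp_all add: d_def algebra_simps)
  then have "(z - \<alpha>) / d - \<alpha> = z * (1 - \<alpha> * cnj \<alpha>) / d" "cnj \<alpha> * ((z - \<alpha>) / d) - 1 = (1 - \<alpha> * cnj \<alpha>) / d"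
    using d by (simp_all add: divide_diff_eq_iff)
  then show ?thesis using d r unfolding m_def d_def[symmetric] by simp
qed

text \<open>
  \<open>\<gamma>\<^sub>1\<close> and \<open>\<gamma>\<^sub>2\<close> are \<open>\<delta>\<^sub>2\<close> and \<open>\<delta>\<^sub>1\<close> for the exchanged parameters and \<open>\<alpha> = cnj (\<zeta> \<theta>)\<close>.
\<close>

lemma right_leaf_parameters:
  fixes a b \<theta> :: complex
  assumes \<zeta>: "norm \<zeta> = 1"
  defines "d \<equiv> complex_of_real ((norm (1 - \<zeta> * \<theta> * b))\<^sup>2 - (norm (\<theta> * a))\<^sup>2)"
  shows "left_beta2 (cnj (\<zeta> * \<theta>)) b a = a * complex_of_real (1 - (norm \<theta>)\<^sup>2) / d"
    and "left_beta1 \<zeta> (cnj (\<zeta> * \<theta>)) b a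
      = (cnj \<theta> * complex_of_real (1 - (norm a)\<^sup>2 + (norm b)\<^sup>2) - \<zeta> * b - cnj \<zeta> * (cnj \<theta>)\<^sup>2 * cnj b) / d"
proof -
  have den: "complex_of_real ((norm (1 - cnj (cnj (\<zeta> * \<theta>)) * b))\<^sup>2 - (norm (cnj (\<zeta> * \<theta>) * a))\<^sup>2) = d"
    using \<zeta> by (simp add: d_def norm_mult)
  show "left_beta2 (cnj (\<zeta> * \<theta>)) b a = a * complex_of_real (1 - (norm \<theta>)\<^sup>2) / d"
    unfolding left_beta2_def den using \<zeta> by (simp add: norm_mult)
  have e: "\<zeta> * (cnj \<zeta> * c) = c" for c using mult_cnj_eq_1[OF \<zeta>] by (simp flip: mult.assoc)
  have "\<zeta> * (cnj (\<zeta> * \<theta>) * complex_of_real (1 - (norm a)\<^sup>2 + (norm b)\<^sup>2) - b - (cnj (\<zeta> * \<theta>))\<^sup>2 * cnj b)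
      = cnj \<theta> * complex_of_real (1 - (norm a)\<^sup>2 + (norm b)\<^sup>2) - \<zeta> * b - cnj \<zeta> * (cnj \<theta>)\<^sup>2 * cnj b"
    by (simp add: right_diff_distrib power2_eq_square mult.assoc e mult.left_commute[of "cnj \<theta>" "cnj \<zeta>"])
  then show "left_beta1 \<zeta> (cnj (\<zeta> * \<theta>)) b a
      = (cnj \<theta> * complex_of_real (1 - (norm a)\<^sup>2 + (norm b)\<^sup>2) - \<zeta> * b - cnj \<zeta> * (cnj \<theta>)\<^sup>2 * cnj b) / d"
    unfolding left_beta1_def den times_divide_eq_right by simp
qed

lemma left_action_on_leaf:
  assumes ab: "norm a + norm b < 1" and x: "x \<in> \<phi> a b ` \<D>" and \<omega>: "norm \<omega> = 1" and \<alpha>: "norm \<alpha> < 1"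
    and \<upsilon>: "\<And>z. norm z < 1 \<Longrightarrow> \<upsilon> z = \<omega> * ((z - \<alpha>) / (cnj \<alpha> * z - 1))"
  shows "norm (left_beta1 \<omega> \<alpha> a b) + norm (left_beta2 \<alpha> a b) < 1"
    and "left_act \<upsilon> x \<in> \<phi> (left_beta1 \<omega> \<alpha> a b) (left_beta2 \<alpha> a b) ` \<D>"
proof -
  show "norm (left_beta1 \<omega> \<alpha> a b) + norm (left_beta2 \<alpha> a b) < 1"
    by (rule left_moebius_beta_disc(3)[OF ab \<omega> \<alpha>, of 0]) simp
  show "left_act \<upsilon> x \<in> \<phi> (left_beta1 \<omega> \<alpha> a b) (left_beta2 \<alpha> a b) ` \<D>"
  proof -
    have "left_act \<upsilon> x = left_moebius \<omega> \<alpha> x" using \<omega> \<alpha> \<upsilon> by (rule left_act_eq)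
    then show ?thesis using x unfolding left_moebius_leaf[OF ab \<omega> \<alpha>, symmetric] by simp
  qed
qed

lemma right_action_on_leaf:
  assumes ab: "norm a + norm b < 1" and x: "x \<in> \<phi> a b ` \<D>" and \<zeta>: "norm \<zeta> = 1" and \<theta>: "norm \<theta> < 1"
    and \<eta>: "\<And>z. norm z < 1 \<Longrightarrow> \<eta> z = \<zeta> * ((z - \<theta>) / (cnj \<theta> * z - 1))"
  defines "c \<equiv> left_beta2 (cnj (\<zeta> * \<theta>)) b a" and "d \<equiv> left_beta1 \<zeta> (cnj (\<zeta> * \<theta>)) b a"
  shows "norm c + norm d < 1" and "right_act x \<eta> \<in> \<phi> c d ` \<D>"
proof -
  have ba: "norm b + norm a < 1" using ab by simp
  have \<theta>': "norm (cnj (\<zeta> * \<theta>)) < 1" using \<zeta> \<theta> by (simp add: norm_mult)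
  show "norm c + norm d < 1"
    using left_moebius_beta_disc(3)[OF ba \<zeta> \<theta>', of 0] unfolding c_def d_def by simp
  show "right_act x \<eta> \<in> \<phi> c d ` \<D>"
  proof -
    have "right_act x \<eta> = right_moebius \<zeta> \<theta> x" using \<zeta> \<theta> \<eta> by (rule right_act_eq)
    then show ?thesis
      using x unfolding c_def d_def right_moebius_leaf[OF ab \<zeta> \<theta>, symmetric] by simp
  qed
qed

text \<open>
  Both disc automorphisms are involutions, and so are their actions; hence they undo
  \<open>beta_leaf_from_central_leaf\<close>.
\<close>

lemma two_sided_act_to_central_leaf:
  assumes ab: "norm a + norm b < 1" and \<alpha>: "norm \<alpha> < 1" and \<theta>: "norm \<theta> < 1"
    and leaf: "left_moebius 1 \<alpha> ` right_moebius 1 \<theta> ` \<phi> 0 0 ` \<D> = \<phi> a b ` \<D>"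
    and \<upsilon>: "\<upsilon> \<in> carrier Aut_disc" "\<And>z. norm z < 1 \<Longrightarrow> \<upsilon> z = (z - \<alpha>) / (cnj \<alpha> * z - 1)"
    and \<eta>: "\<eta> \<in> carrier Aut_disc" "\<And>z. norm z < 1 \<Longrightarrow> \<eta> z = (z - \<theta>) / (cnj \<theta> * z - 1)"
  shows "two_sided_act (inv\<^bsub>Aut_disc\<^esub> \<upsilon>) (\<phi> a b ` \<D>) (inv\<^bsub>Aut_disc\<^esub> \<eta>) = \<phi> 0 0 ` \<D>"
proof -
  have inv: "inv\<^bsub>Aut_disc\<^esub> f = f" if f: "f \<in> carrier Aut_disc" "\<And>z. norm z < 1 \<Longrightarrow> f z = (z - c) / (cnj c * z - 1)"
    and c: "norm c < 1" for f c
  proof (rule inv_Aut_disc_involution[OF f(1)])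
    fix z assume z: "z \<in> \<D>"
    have "f \<in> \<D> \<rightarrow> \<D>"
      by (rule Bij_imp_funcset) (use f(1) in \<open>simp add: Aut_disc_def Aut_group_def\<close>)
    then have "f z \<in> \<D>" using z by blast
    then show "f (f z) = z" using moebius_involution[OF c, of z] f(2)[of z] f(2)[of "f z"] z by simp
  qed
  have L: "left_act \<upsilon> x = left_moebius 1 \<alpha> x" for x
    by (rule left_act_eq) (use \<alpha> \<upsilon> in simp_all)
  have R: "right_act x \<eta> = right_moebius 1 \<theta> x" for x
    by (rule right_act_eq) (use \<theta> \<eta> in simp_all)
  have LL: "left_moebius 1 c (left_moebius 1 c x) = x" if "x \<in> \<E>" "norm c < 1" for x c
    using left_moebius_inverse[OF that(1) norm_one that(2)] by simp
  have RR: "right_moebius 1 \<theta> (right_moebius 1 \<theta> x) = x" if "x \<in> \<E>" for x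
    using LL[of "swap12 x" "cnj \<theta>"] that \<theta> by (simp add: right_moebius_def)
  have RE: "right_moebius 1 \<theta> x \<in> \<E>" if "x \<in> \<E>" for x
    using left_moebius_in_tetrablock[of "swap12 x" 1 "cnj \<theta>"] that \<theta> by (simp add: right_moebius_def)
  have "two_sided_act (inv\<^bsub>Aut_disc\<^esub> \<upsilon>) (\<phi> a b ` \<D>) (inv\<^bsub>Aut_disc\<^esub> \<eta>) = right_moebius 1 \<theta> ` left_moebius 1 \<alpha> ` \<phi> a b ` \<D>"
  proof -
    have "inv\<^bsub>Aut_disc\<^esub> \<upsilon> = \<upsilon>" using \<upsilon> \<alpha> by (rule inv)
    moreover have "inv\<^bsub>Aut_disc\<^esub> \<eta> = \<eta>" using \<eta> \<theta> by (rule inv)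
    ultimately show ?thesis by (auto simp: two_sided_act_def L R)
  qed
  also have "\<dots> = (\<lambda>l. right_moebius 1 \<theta> (left_moebius 1 \<alpha> (left_moebius 1 \<alpha> (right_moebius 1 \<theta> (\<phi> 0 0 l))))) ` \<D>"
    unfolding leaf[symmetric] by (simp only: image_image)
  also have "\<dots> = \<phi> 0 0 ` \<D>"
    by (rule image_cong[OF refl]) (simp add: LL RR RE leaf_point_in_tetrablock \<alpha>)
  finally show ?thesis .
qed

theorem theorem5p1:
  shows
    "(\<forall>f \<in> carrier Aut_tetrablock. \<forall>L \<in> beta_leaves. f ` L \<in> beta_leaves) \<and>
     transitive_action Aut_tetrablock beta_leaves (\<lambda>f. \<lambda>L\<in>beta_leaves. f ` L) \<and>
     (\<forall>\<beta>\<^sub>1 \<beta>\<^sub>2 x \<upsilon> \<eta> \<omega> \<zeta> \<alpha> \<theta>.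
        norm \<beta>\<^sub>1 + norm \<beta>\<^sub>2 < 1 \<longrightarrow> x \<in> \<phi> \<beta>\<^sub>1 \<beta>\<^sub>2 ` \<D> \<longrightarrow>
        \<upsilon> \<in> carrier Aut_disc \<longrightarrow> \<eta> \<in> carrier Aut_disc \<longrightarrow>
        norm \<omega> = 1 \<longrightarrow> norm \<zeta> = 1 \<longrightarrow> \<alpha> \<in> \<D> \<longrightarrow> \<theta> \<in> \<D> \<longrightarrow>
        (\<forall>z\<in>\<D>. \<upsilon> z = \<omega> * ((z - \<alpha>) / (cnj \<alpha> * z - 1))) \<longrightarrow>
        (\<forall>z\<in>\<D>. \<eta> z = \<zeta> * ((z - \<theta>) / (cnj \<theta> * z - 1))) \<longrightarrow>
        (let d = complex_of_real ((norm (1 - \<zeta> * \<theta> * \<beta>\<^sub>2))\<^sup>2 - (norm (\<theta> * \<beta>\<^sub>1))\<^sup>2);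
             \<gamma>\<^sub>1 = \<beta>\<^sub>1 * complex_of_real (1 - (norm \<theta>)\<^sup>2) / d;
             \<gamma>\<^sub>2 = (cnj \<theta> * complex_of_real (1 - (norm \<beta>\<^sub>1)\<^sup>2 + (norm \<beta>\<^sub>2)\<^sup>2)
                    - \<zeta> * \<beta>\<^sub>2 - cnj \<zeta> * (cnj \<theta>)\<^sup>2 * cnj \<beta>\<^sub>2) / d
         in d \<noteq> 0 \<and> norm \<gamma>\<^sub>1 + norm \<gamma>\<^sub>2 < 1 \<and> right_act x \<eta> \<in> \<phi> \<gamma>\<^sub>1 \<gamma>\<^sub>2 ` \<D>) \<and>
        (let d = complex_of_real ((norm (1 - cnj \<alpha> * \<beta>\<^sub>1))\<^sup>2 - (norm (\<alpha> * \<beta>\<^sub>2))\<^sup>2);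
             \<delta>\<^sub>1 = \<omega> * ((\<alpha> * complex_of_real (1 - (norm \<beta>\<^sub>2)\<^sup>2 + (norm \<beta>\<^sub>1)\<^sup>2)
                    - \<beta>\<^sub>1 - \<alpha>\<^sup>2 * cnj \<beta>\<^sub>1) / d);
             \<delta>\<^sub>2 = \<beta>\<^sub>2 * complex_of_real (1 - (norm \<alpha>)\<^sup>2) / d
         in d \<noteq> 0 \<and> norm \<delta>\<^sub>1 + norm \<delta>\<^sub>2 < 1 \<and> left_act \<upsilon> x \<in> \<phi> \<delta>\<^sub>1 \<delta>\<^sub>2 ` \<D>)) \<and>
     (\<forall>\<beta>\<^sub>1 \<beta>\<^sub>2 \<xi>\<^sub>1 \<xi>\<^sub>2 \<alpha> \<theta> \<upsilon> \<eta>.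
        norm \<beta>\<^sub>1 + norm \<beta>\<^sub>2 < 1 \<longrightarrow>
        norm \<xi>\<^sub>1 = 1 \<longrightarrow> norm \<xi>\<^sub>2 = 1 \<longrightarrow>
        \<beta>\<^sub>1 = complex_of_real (norm \<beta>\<^sub>1) * \<xi>\<^sub>1 \<longrightarrow> cnj \<beta>\<^sub>2 = complex_of_real (norm \<beta>\<^sub>2) * \<xi>\<^sub>2 \<longrightarrow>
        \<alpha> = \<xi>\<^sub>1 * complex_of_real (tanh (1/2 * artanh (norm \<beta>\<^sub>1 + norm \<beta>\<^sub>2)
                                          + 1/2 * artanh (norm \<beta>\<^sub>1 - norm \<beta>\<^sub>2))) \<longrightarrow>
        \<theta> = \<xi>\<^sub>2 * complex_of_real (tanh (1/2 * artanh (norm \<beta>\<^sub>1 + norm \<beta>\<^sub>2)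
                                          - 1/2 * artanh (norm \<beta>\<^sub>1 - norm \<beta>\<^sub>2))) \<longrightarrow>
        \<upsilon> \<in> carrier Aut_disc \<longrightarrow> \<eta> \<in> carrier Aut_disc \<longrightarrow>
        (\<forall>z\<in>\<D>. \<upsilon> z = (z - \<alpha>) / (cnj \<alpha> * z - 1)) \<longrightarrow>
        (\<forall>z\<in>\<D>. \<eta> z = (z - \<theta>) / (cnj \<theta> * z - 1)) \<longrightarrow>
        two_sided_act (inv\<^bsub>Aut_disc\<^esub> \<upsilon>) (\<phi> \<beta>\<^sub>1 \<beta>\<^sub>2 ` \<D>) (inv\<^bsub>Aut_disc\<^esub> \<eta>) = \<phi> 0 0 ` \<D> \<and>
        \<phi> 0 0 ` \<D> = {vector [0, 0, z] | z. z \<in> \<D>})"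
proof (intro conjI allI impI, goal_cases)
  case 1
  show ?case using automorphism_maps_leaf_to_leaf carrier_Aut_tetrablockD(2) by blast
next
  case 2
  show ?case by (rule transitive_action_on_leaves)
next
  case (3 a b x \<upsilon> \<eta> \<omega> \<zeta> \<alpha> \<theta>)
  have ba: "norm b + norm a < 1" and \<theta>': "norm (cnj (\<zeta> * \<theta>)) < 1" using 3 by (simp_all add: norm_mult)
  have "(norm (1 - \<zeta> * \<theta> * b))\<^sup>2 - (norm (\<theta> * a))\<^sup>2 > 0"
    using left_denominator_pos[OF ba \<theta>'] 3(6) by (simp add: norm_mult)
  then have "complex_of_real ((norm (1 - \<zeta> * \<theta> * b))\<^sup>2 - (norm (\<theta> * a))\<^sup>2) \<noteq> 0"
    unfolding of_real_eq_0_iff by linarith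
  moreover have "norm \<theta> < 1" "\<And>z. norm z < 1 \<Longrightarrow> \<eta> z = \<zeta> * ((z - \<theta>) / (cnj \<theta> * z - 1))"
    using 3 by simp_all
  note R = right_action_on_leaf[OF 3(1,2,6) this, unfolded right_leaf_parameters[OF 3(6)]]
  ultimately show ?case unfolding Let_def using R by blast
next
  case (4 a b x \<upsilon> \<eta> \<omega> \<zeta> \<alpha> \<theta>)
  have \<alpha>: "norm \<alpha> < 1" using 4 by simp
  have "complex_of_real ((norm (1 - cnj \<alpha> * a))\<^sup>2 - (norm (\<alpha> * b))\<^sup>2) \<noteq> 0"
    unfolding of_real_eq_0_iff using left_denominator_pos[OF 4(1) \<alpha>] by linarith
  moreover have "\<And>z. norm z < 1 \<Longrightarrow> \<upsilon> z = \<omega> * ((z - \<alpha>) / (cnj \<alpha> * z - 1))"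
    using 4 by simp
  note L = left_action_on_leaf[OF 4(1,2,5) \<alpha> this, unfolded left_beta1_def left_beta2_def]
  ultimately show ?case unfolding Let_def using L by blast
next
  case (5 a b \<xi>\<^sub>1 \<xi>\<^sub>2 \<alpha> \<theta> \<upsilon> \<eta>)
  note leaf = beta_leaf_from_central_leaf[OF 5(1-7)]
  show ?case
    by (rule two_sided_act_to_central_leaf[OF 5(1) leaf]) (use 5 in simp_all)
next
  case (6 a b \<xi>\<^sub>1 \<xi>\<^sub>2 \<alpha> \<theta> \<upsilon> \<eta>)
  show ?case by (auto simp: beta_disc_def)
qed

end
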